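(* There is a universal constant $C>0$ such that for every integer $M\ge1$ and every real $t>0$, \[ \left|\frac1M\left|\left\{1\le N\le M : \exp\left(-t\left(\frac{\log 3N}{\log\log 3N}\right)^{3/2}\right)\le P_N(e)\le\exp\left(t\left(\frac{\log 3N}{\log\log 3N}\right)^{3/2}\right)\right\}\right|-1\right|\le Ct^{-2}. \] In particular, for any sequence of reals $t_N\to\infty$ the set \[ \left\{N\in\mathbb{N},\ N\ge 3 : \exp\left(-t_N\left(\frac{\log N}{\log\log N}\right)^{3/2}\right)\le P_N(e)\le\exp\left(t_N\left(\frac{\log N}{\log\log N}\right)^{3/2}\right)\right\} \] has asymptotic density $1$.
   Context: $e$ is Euler's number (the base of the natural logarithm), and $P_N(\alpha)=\prod_{n=1}^N|2\sin(\pi n\alpha)|$ is the Sudler product. *)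

theory Defs
  imports Complex_Main
begin

definition sudler_product :: "nat \<Rightarrow> real \<Rightarrow> real" where
  "sudler_product N \<alpha> = (\<Prod>n=1..N. \<bar>2 * sin (pi * real n * \<alpha>)\<bar>)"

definition has_asymptotic_density :: "nat set \<Rightarrow> real \<Rightarrow> bool" where
  "has_asymptotic_density A d \<longleftrightarrow>
     (\<lambda>M. real (card (A \<inter> {1..M})) / real M) \<longlonglongrightarrow> d"

end

theory Submission
  imports Defs "HOL-Analysis.Analysis"
begin

text \<open>
  Let \<open>L(N) = ln P\<^sub>N(e)\<close>. The theorem is Chebyshev's inequality for \<open>L\<close>, once the mean square of
  \<open>L(N)\<close> over \<open>N \<le> M\<close> is known to be \<open>O(k\<^sup>3)\<close>, where \<open>k\<close> is determined by
  \<open>q\<^sub>k \<le> M < q\<^sub>k\<^sub>+\<^sub>1\<close> and \<open>p\<^sub>k / q\<^sub>k\<close> are the diagonal Pade approximants of \<open>e\<close>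
  (\<open>3/1\<close>, \<open>19/7\<close>, \<open>193/71\<close>, ...). Their denominators satisfy
  \<open>q\<^sub>k\<^sub>+\<^sub>1 = (4 k + 2) q\<^sub>k + q\<^sub>k\<^sub>-\<^sub>1\<close>, so \<open>k\<close> is at most a constant times
  \<open>ln M / ln (ln M)\<close>. Adding up absolute values over the scales \<open>q\<^sub>j\<close> would only give
  \<open>L(N) = O(k\<^sup>2)\<close>; the exponent \<open>3/2\<close> expresses the orthogonality of the scales.

  \<^item> For a rational number \<open>p / Q\<close> the orthogonality is Parseval's identity modulo \<open>Q\<close>. Give
    \<open>ln \<bar>2 sin (\<pi> n / Q)\<bar>\<close> the value \<open>- ln Q\<close> at \<open>n = 0\<close>. It then has sum zero over a period,
    and its \<open>r\<close>-th Fourier coefficient is \<open>O(Q / r)\<close> for \<open>r \<le> Q / 2\<close>. Summing along multiples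
    of \<open>p\<close> divides the coefficient by \<open>2 sin (\<pi> p r / Q)\<close> in modulus, so the variance of
    \<open>ln P\<^sub>N(p / Q)\<close> over \<open>0 \<le> N < Q\<close> is at most a constant times
    \<open>\<Sum> 1 / (r\<^sup>2 sin\<^sup>2 (\<pi> p r / Q))\<close>, with mean \<open>ln Q / 2\<close> (\<open>logsin_sum_variance\<close>).

  \<^item> For \<open>p / Q = p\<^sub>k / q\<^sub>k\<close> the part of this sum with \<open>q\<^sub>j \<le> r < q\<^sub>j\<^sub>+\<^sub>1\<close> is
    \<open>O((q\<^sub>j\<^sub>+\<^sub>1 / q\<^sub>j)\<^sup>2) = O(j\<^sup>2)\<close>, because in every block of \<open>q\<^sub>j\<close> consecutive \<open>r\<close> the points
    \<open>r p / Q\<close> are nearly equidistributed modulo 1 and only one of them can be close to an integer.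
    The total is \<open>O(k\<^sup>3)\<close> (\<open>pade_variance\<close>).

  \<^item> For \<open>q\<^sub>k \<le> N < q\<^sub>k\<^sub>+\<^sub>1\<close>, \<open>L(N)\<close> differs from \<open>ln P\<^sub>N\<^sub>'(p\<^sub>k / q\<^sub>k)\<close>, where \<open>N'\<close> is the remainder of
    \<open>N\<close> modulo \<open>q\<^sub>k\<close>, by \<open>O(k\<^bsup>3/2\<^esup>)\<close>. Indeed the first \<open>N'\<close> factors hardly
    change, and each of the at most \<open>4 k + 3\<close> full blocks of length \<open>q\<^sub>k\<close> after them contributes only
    \<open>O(k\<^bsup>1/2\<^esup>)\<close> (\<open>pade_transfer\<close>). Averaging over the remainders gives the
    mean square of \<open>L\<close>.
\<close>

section \<open>Distance to the nearest integer\<close>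

definition nint_dist :: "real \<Rightarrow> real" where
  "nint_dist x = \<bar>x - of_int (round x)\<bar>"

lemma nint_dist_nonneg [simp]: "0 \<le> nint_dist x"
  by (simp add: nint_dist_def)

lemma nint_dist_le: "nint_dist x \<le> \<bar>x - of_int m\<bar>"
  unfolding nint_dist_def by (rule round_diff_minimal)

lemma nint_dist_le_half: "nint_dist x \<le> 1/2"
  unfolding nint_dist_def using of_int_round_abs_le[of x] by linarith

lemma nint_dist_add: "nint_dist (x + y) \<le> nint_dist x + \<bar>y\<bar>"
proof -
  have "nint_dist (x + y) \<le> \<bar>x + y - of_int (round x)\<bar>" by (rule nint_dist_le)
  also have "\<dots> \<le> nint_dist x + \<bar>y\<bar>" unfolding nint_dist_def by linarith
  finally show ?thesis .
qed

lemma nint_dist_add_int: "nint_dist (x + of_int m) = nint_dist x"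
proof (rule antisym)
  show "nint_dist (x + of_int m) \<le> nint_dist x"
    using nint_dist_le[of "x + of_int m" "round x + m"] by (simp add: nint_dist_def)
  show "nint_dist x \<le> nint_dist (x + of_int m)"
    using nint_dist_le[of x "round (x + of_int m) - m"] by (simp add: nint_dist_def[of "x + of_int m"] algebra_simps)
qed

lemma nint_dist_mod:
  assumes "Q > 0"
  shows "nint_dist (of_int (n mod Q) / of_int Q) = nint_dist (of_int n / of_int Q)"
proof -
  have "real_of_int n = of_int (n mod Q) + of_int (n div Q) * of_int Q"
    by (metis mod_div_mult_eq of_int_add of_int_mult)
  hence "of_int n / of_int Q = of_int (n mod Q) / of_int Q + real_of_int (n div Q)"
    using assms by (simp add: add_divide_distrib)
  thus ?thesis using nint_dist_add_int by metis
qed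

lemma nint_dist_fraction:
  fixes n Q :: int
  assumes "Q > 0" "\<not> Q dvd n"
  shows "1 / of_int Q \<le> nint_dist (of_int n / of_int Q)"
proof -
  define m where "m = round (of_int n / of_int Q :: real)"
  have "n - m * Q \<noteq> 0" using assms by (metis dvd_triv_right right_minus_eq)
  hence "1 \<le> \<bar>real_of_int (n - m * Q)\<bar>" by linarith
  moreover have "\<bar>of_int n / of_int Q - of_int m\<bar> = \<bar>real_of_int (n - m * Q)\<bar> / of_int Q"
    using assms by (simp add: field_simps abs_divide flip: abs_of_pos)
  ultimately show ?thesis
    using assms by (simp add: nint_dist_def m_def divide_right_mono)
qed

lemma nint_dist_fraction_interior:
  assumes "l \<in> {1..<Q}"
  shows "1 / of_int Q \<le> nint_dist (of_int l / of_int Q)"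
  using assms zdvd_not_zless by (intro nint_dist_fraction) auto

text \<open>For \<open>0 < n < Q\<close> this is in fact an equality; it turns sums over the
  fractions \<open>n / Q\<close> into sums over the integers \<open>n\<close> and \<open>Q -
  n\<close>.\<close>

lemma nint_dist_fraction_min:
  fixes n Q :: int
  assumes "0 < n" "n < Q"
  shows "of_int (min n (Q - n)) / of_int Q \<le> nint_dist (of_int n / of_int Q)"
proof -
  define m where "m = round (of_int n / of_int Q :: real)"
  have "min n (Q - n) \<le> \<bar>n - m * Q\<bar>"
  proof (cases "m \<le> 0")
    case True
    hence "m * Q \<le> 0" using assms by (simp add: mult_nonpos_nonneg)
    thus ?thesis by linarith
  next
    case False
    hence "1 * Q \<le> m * Q" using assms by (intro mult_right_mono) auto
    thus ?thesis by linarith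
  qed
  hence "real_of_int (min n (Q - n)) \<le> \<bar>real_of_int (n - m * Q)\<bar>" by linarith
  moreover have "\<bar>of_int n / of_int Q - of_int m\<bar> = \<bar>real_of_int (n - m * Q)\<bar> / of_int Q"
    using assms by (simp add: field_simps abs_divide flip: abs_of_pos)
  ultimately show ?thesis
    using assms by (simp add: nint_dist_def m_def divide_right_mono)
qed

text \<open>Both sides are even and have period 1 in \<open>x\<close>. Together with
  Jordan's inequality this makes \<open>\<bar>sin (\<pi> x)\<bar>\<close> and the distance
  of \<open>x\<close> to the integers interchangeable up to constant factors.\<close>

lemma abs_sin_pi_nint_dist: "\<bar>sin (pi * x)\<bar> = sin (pi * nint_dist x)"
proof -
  define m where "m = round x"
  have "sin (pi * x) = sin (pi * (x - of_int m) + of_int m * pi)" by (simp add: algebra_simps)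
  also have "\<bar>\<dots>\<bar> = \<bar>sin (pi * (x - of_int m))\<bar>"
  proof -
    have "sin (of_int m * pi) = 0" by (simp add: sin_times_pi_eq_0)
    moreover have "\<bar>cos (of_int m * pi)\<bar> = 1"
      using calculation sin_cos_squared_add[of "of_int m * pi"] by (simp add: power2_eq_1_iff) (metis abs_1 abs_minus_cancel)
    ultimately show ?thesis by (simp add: sin_add abs_mult)
  qed
  also have "\<dots> = \<bar>sin (pi * nint_dist x)\<bar>"
  proof (cases "x - of_int m \<ge> 0")
    case True
    thus ?thesis by (simp add: nint_dist_def m_def)
  next
    case False
    hence "pi * nint_dist x = - (pi * (x - of_int m))" by (simp add: nint_dist_def m_def algebra_simps)
    thus ?thesis by (metis abs_minus_cancel sin_minus)
  qed
  also have "\<dots> = sin (pi * nint_dist x)"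
  proof -
    have "pi * nint_dist x \<le> pi * 1" using nint_dist_le_half[of x] by (intro mult_left_mono) auto
    hence "0 \<le> sin (pi * nint_dist x)" by (intro sin_ge_zero) auto
    thus ?thesis by simp
  qed
  finally show ?thesis .
qed

lemma jordan_sin_ineq:
  fixes x :: real
  assumes "0 \<le> x" "x \<le> 1/2"
  shows "2 * x \<le> sin (pi * x)"
proof -
  have "concave_on {0..1/2} (\<lambda>x. sin (pi * x))"
  proof (rule f''_le0_imp_concave[where f' = "\<lambda>x. pi * cos (pi * x)" and f'' = "\<lambda>x. - pi * pi * sin (pi * x)"])
    fix x :: real assume "x \<in> {0..1/2}"
    hence "0 \<le> pi * x" "pi * x \<le> pi * 1" by (auto intro!: mult_left_mono simp del: mult_1_right)
    hence "0 \<le> sin (pi * x)" by (intro sin_ge_zero) auto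
    thus "- pi * pi * sin (pi * x) \<le> 0" by simp
  qed (auto intro!: derivative_eq_intros simp: algebra_simps)
  \<comment> \<open>the chord over \<open>[0, 1/2]\<close> lies below the graph\<close>
  hence "(1 - 2*x) * sin (pi * 0) + 2*x * sin (pi * (1/2)) \<le> sin (pi * ((1 - 2*x) *\<^sub>R 0 + (2*x) *\<^sub>R (1/2)))"
    using assms by (intro concave_onD) auto
  thus ?thesis by simp
qed

lemma nint_dist_le_sin: "2 * nint_dist x \<le> \<bar>sin (pi * x)\<bar>"
  unfolding abs_sin_pi_nint_dist by (rule jordan_sin_ineq) (simp_all add: nint_dist_le_half[simplified])

lemma sin_le_nint_dist: "\<bar>sin (pi * x)\<bar> \<le> pi * nint_dist x"
  unfolding abs_sin_pi_nint_dist by (rule sin_x_le_x) simp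

lemma sin_frac_eq_0_iff:
  fixes n Q :: int
  assumes "Q > 0" shows "sin (pi * (of_int n / of_int Q)) = 0 \<longleftrightarrow> Q dvd n"
proof
  assume "sin (pi * (of_int n / of_int Q)) = 0"
  hence "nint_dist (of_int n / of_int Q) = 0"
    using nint_dist_le_sin[of "of_int n / of_int Q"] nint_dist_nonneg[of "of_int n / of_int Q"]
    by simp
  thus "Q dvd n" using nint_dist_fraction[OF assms, of n] assms by fastforce
next
  assume "Q dvd n"
  then obtain k where "n = Q * k" by blast
  thus "sin (pi * (of_int n / of_int Q)) = 0"
    using assms sin_times_pi_eq_0[of "of_int k"] by (simp add: mult.commute)
qed

section \<open>Elementary estimates\<close>

lemma two_sin_sq_le_sin_double_sq:
  fixes b :: real
  assumes "0 < b" "b \<le> pi / 4"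
  shows "2 * (sin b)\<^sup>2 \<le> (sin (2 * b))\<^sup>2"
proof -
  have "cos (pi/4) \<le> cos b" using assms by (intro cos_monotone_0_pi_le) auto
  hence "sqrt 2 / 2 \<le> cos b" by (simp add: cos_45)
  hence "(sqrt 2 / 2)\<^sup>2 \<le> (cos b)\<^sup>2" by (intro power_mono) auto
  hence "1/2 \<le> (cos b)\<^sup>2" by (simp add: power_divide)
  hence "4 * (sin b)\<^sup>2 * (1/2) \<le> 4 * (sin b)\<^sup>2 * (cos b)\<^sup>2" by (intro mult_left_mono) auto
  thus ?thesis by (simp add: sin_double power_mult_distrib)
qed

text \<open>Every pairing argument below rests on this identity: the first order variation
  of \<open>ln \<bar>sin\<bar>\<close> cancels between \<open>a + b\<close> and \<open>a -
  b\<close>.\<close>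

lemma sin_plus_times_sin_minus:
  fixes a b :: real
  shows "sin (a + b) * sin (a - b) = (sin a)\<^sup>2 - (sin b)\<^sup>2"
  by (simp add: sin_times_sin cos_double_sin flip: mult_2)

lemma abs_sin_diff_le: "\<bar>sin u - sin v\<bar> \<le> \<bar>u - v\<bar>" for u v :: real
proof -
  have "\<bar>sin u - sin v\<bar> = 2 * \<bar>sin ((u - v) / 2)\<bar> * \<bar>cos ((u + v) / 2)\<bar>"
    by (simp add: sin_diff_sin abs_mult)
  also have "\<dots> \<le> 2 * \<bar>(u - v) / 2\<bar> * 1"
    by (intro mult_mono abs_sin_x_le_abs_x) auto
  finally show ?thesis by simp
qed

lemma pi_squared_le_10: "pi\<^sup>2 \<le> 10"
proof -
  have "pi \<le> 3.16" using pi_approx by simp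
  hence "pi\<^sup>2 \<le> 3.16\<^sup>2" by (intro power_mono) auto
  also have "\<dots> \<le> (10::real)" by (simp add: power2_eq_square)
  finally show ?thesis .
qed

lemma abs_ln_one_plus_le:
  fixes x :: real
  assumes "\<bar>x\<bar> \<le> 1/2" shows "\<bar>ln (1 + x)\<bar> \<le> 2 * \<bar>x\<bar>"
proof -
  have "\<bar>ln (1 + x) - x\<bar> \<le> 2 * x\<^sup>2" by (rule abs_ln_one_plus_x_minus_x_bound[OF assms])
  also have "2 * x\<^sup>2 = 2 * \<bar>x\<bar> * \<bar>x\<bar>" by (simp add: power2_eq_square)
  also have "\<dots> \<le> 1 * \<bar>x\<bar>" using assms by (intro mult_right_mono) auto
  finally show ?thesis by linarith
qed

lemma ln_le_2_sqrt:
  assumes "x > 0" shows "ln x \<le> 2 * sqrt x"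
proof -
  have "ln (sqrt x) \<le> sqrt x - 1" using assms by (intro ln_le_minus_one) simp
  thus ?thesis using assms by (simp add: ln_sqrt)
qed

lemma int_atLeastAtMost_Suc: "{1..int (Suc n)} = insert (int (Suc n)) {1..int n}"
  by auto

lemma sum_inverse_squares_le: "(\<Sum>l=1..int n. 1 / (of_int l)\<^sup>2) \<le> (2::real)"
proof -
  have "(\<Sum>l=1..int (Suc n). 1 / (of_int l)\<^sup>2) \<le> 2 - 1 / real (Suc n)" for n
  proof (induction n)
    case 0
    have "{1..int (Suc 0)} = {1}" by auto
    thus ?case by simp
  next
    case (Suc n)
    define x where "x = real (Suc n)"
    have x: "x > 0" by (simp add: x_def)
    have "(\<Sum>l=1..int (Suc (Suc n)). 1 / (of_int l)\<^sup>2)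
        = 1 / (x + 1)\<^sup>2 + (\<Sum>l=1..int (Suc n). 1 / (real_of_int l)\<^sup>2)"
      unfolding int_atLeastAtMost_Suc[of "Suc n"] by (simp add: x_def add.commute)
    also have "\<dots> \<le> 1 / (x + 1)\<^sup>2 + (2 - 1 / x)" using Suc by (simp add: x_def)
    also have "1 / (x + 1)\<^sup>2 \<le> 1 / x - 1 / (x + 1)"
    proof -
      have "1 / x - 1 / (x + 1) = 1 / (x * (x + 1))" using x by (simp add: field_simps)
      moreover have "1 / (x + 1)\<^sup>2 \<le> 1 / (x * (x + 1))"
        using x by (intro divide_left_mono) (auto simp: power2_eq_square)
      ultimately show ?thesis by simp
    qed
    finally show ?case by (simp add: x_def add.commute)
  qed
  note * = this
  show ?thesis
  proof (cases n)
    case (Suc m)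
    have "2 - 1 / real (Suc m) \<le> 2" by simp
    with *[of m] show ?thesis unfolding Suc by linarith
  qed simp
qed

lemma sum_inverse_le_ln: "n \<ge> 1 \<Longrightarrow> (\<Sum>l=1..int n. 1 / of_int l) \<le> 1 + ln (real n)"
proof (induction n rule: nat_induct_at_least)
  case base
  have "{1..int 1} = {1}" by auto
  thus ?case by simp
next
  case (Suc n)
  have "1 / (real n + 1) \<le> ln (real n + 1) - ln (real n)"
  proof -
    have "ln (real n / (real n + 1)) \<le> real n / (real n + 1) - 1"
      using Suc by (intro ln_le_minus_one) auto
    also have "\<dots> = - (1 / (real n + 1))" by (simp add: field_simps)
    finally show ?thesis using Suc by (simp add: ln_div)
  qed
  thus ?case using Suc unfolding int_atLeastAtMost_Suc by (simp add: add.commute)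
qed

lemma sum_reflect_interval:
  fixes f :: "int \<Rightarrow> 'a :: comm_monoid_add"
  shows "(\<Sum>l=1..<Q. f (Q - l)) = (\<Sum>l=1..<Q. f l)"
  by (rule sum.reindex_bij_witness[where i = "\<lambda>n. Q - n" and j = "\<lambda>n. Q - n"]) auto

lemma sum_inverse_nint_dist_squares:
  assumes "Q > 0"
  shows "(\<Sum>l=1..<Q. 1 / (nint_dist (of_int l / of_int Q))\<^sup>2) \<le> 4 * (of_int Q)\<^sup>2"
proof -
  have "(\<Sum>l=1..<Q. 1 / (nint_dist (of_int l / of_int Q))\<^sup>2)
      \<le> (\<Sum>l=1..<Q. (of_int Q)\<^sup>2 * (1 / (of_int l)\<^sup>2 + 1 / (of_int (Q - l))\<^sup>2))"
  proof (rule sum_mono)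
    fix l assume l: "l \<in> {1..<Q}"
    define \<mu> where "\<mu> = real_of_int (min l (Q - l))"
    have mu: "\<mu> > 0" using l by (simp add: \<mu>_def)
    have "\<mu> / of_int Q \<le> nint_dist (of_int l / of_int Q)"
      unfolding \<mu>_def using l by (intro nint_dist_fraction_min) auto
    hence "1 / (nint_dist (of_int l / of_int Q))\<^sup>2 \<le> 1 / (\<mu> / of_int Q)\<^sup>2"
      using mu assms by (intro divide_left_mono power_mono) (auto intro!: mult_pos_pos zero_less_power elim: less_le_trans[rotated])
    also have "\<dots> = (of_int Q)\<^sup>2 * (1 / \<mu>\<^sup>2)" by (simp add: power_divide)
    also have "\<dots> \<le> (of_int Q)\<^sup>2 * (1 / (of_int l)\<^sup>2 + 1 / (of_int (Q - l))\<^sup>2)"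
      by (intro mult_left_mono) (auto simp: \<mu>_def min_def)
    finally show "1 / (nint_dist (of_int l / of_int Q))\<^sup>2
       \<le> (of_int Q)\<^sup>2 * (1 / (of_int l)\<^sup>2 + 1 / (of_int (Q - l))\<^sup>2)" .
  qed
  also have "\<dots> = (of_int Q)\<^sup>2 * ((\<Sum>l=1..<Q. 1 / (of_int l)\<^sup>2) + (\<Sum>l=1..<Q. 1 / (of_int (Q - l))\<^sup>2))"
    by (simp only: sum_distrib_left[symmetric] sum.distrib)
  also have "\<dots> = (of_int Q)\<^sup>2 * (2 * (\<Sum>l=1..<Q. 1 / (real_of_int l)\<^sup>2))"
    using sum_reflect_interval[of "\<lambda>l. 1 / (real_of_int l)\<^sup>2" Q] by simp
  also have "\<dots> \<le> (of_int Q)\<^sup>2 * (2 * 2)"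
  proof (intro mult_left_mono)
    have "{1..<Q} = {1..int (nat (Q - 1))}" using assms by auto
    thus "(\<Sum>l=1..<Q. 1 / (real_of_int l)\<^sup>2) \<le> 2" using sum_inverse_squares_le[of "nat (Q - 1)"] by simp
  qed auto
  finally show ?thesis by simp
qed

text \<open>In contrast to the sum of inverse squares a logarithm is lost here. In
  \<open>pade_transfer\<close> this is harmless, because the sum is multiplied there by a
  displacement of size \<open>1 / (k Q)\<close>.\<close>

lemma sum_inverse_nint_dist:
  assumes "Q \<ge> 2"
  shows "(\<Sum>l=1..<Q. 1 / nint_dist (of_int l / of_int Q)) \<le> 2 * of_int Q * (1 + ln (of_int Q))"
proof -
  have Qr: "real_of_int Q > 0" using assms by simp
  have "(\<Sum>l=1..<Q. 1 / nint_dist (of_int l / of_int Q))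
      \<le> (\<Sum>l=1..<Q. of_int Q * (1 / of_int l + 1 / of_int (Q - l)))"
  proof (rule sum_mono)
    fix l assume l: "l \<in> {1..<Q}"
    define \<mu> where "\<mu> = real_of_int (min l (Q - l))"
    have mu: "\<mu> > 0" using l by (simp add: \<mu>_def)
    have nd: "\<mu> / of_int Q \<le> nint_dist (of_int l / of_int Q)"
      unfolding \<mu>_def using l by (intro nint_dist_fraction_min) auto
    have pos: "0 < \<mu> / of_int Q" using mu Qr by simp
    have "1 / nint_dist (of_int l / of_int Q) \<le> 1 / (\<mu> / of_int Q)"
    proof (rule divide_left_mono[OF nd])
      have "0 < nint_dist (of_int l / of_int Q)" using pos nd by linarith
      thus "0 < nint_dist (of_int l / of_int Q) * (\<mu> / of_int Q)" using pos by (rule mult_pos_pos)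
    qed simp
    also have "\<dots> = of_int Q * (1 / \<mu>)" by simp
    also have "\<dots> \<le> of_int Q * (1 / of_int l + 1 / of_int (Q - l))"
      using l Qr by (intro mult_left_mono) (auto simp: \<mu>_def min_def)
    finally show "1 / nint_dist (of_int l / of_int Q) \<le> of_int Q * (1 / of_int l + 1 / of_int (Q - l))" .
  qed
  also have "\<dots> = of_int Q * ((\<Sum>l=1..<Q. 1 / of_int l) + (\<Sum>l=1..<Q. 1 / of_int (Q - l)))"
    by (simp only: sum_distrib_left[symmetric] sum.distrib)
  also have "\<dots> = of_int Q * (2 * (\<Sum>l=1..<Q. 1 / real_of_int l))"
    using sum_reflect_interval[of "\<lambda>l. 1 / real_of_int l" Q] by simp
  also have "\<dots> \<le> of_int Q * (2 * (1 + ln (of_int Q)))"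
  proof (intro mult_left_mono)
    have "{1..<Q} = {1..int (nat (Q - 1))}" using assms by auto
    hence "(\<Sum>l=1..<Q. 1 / real_of_int l) \<le> 1 + ln (real (nat (Q - 1)))"
      using sum_inverse_le_ln[of "nat (Q - 1)"] assms by simp
    also have "ln (real (nat (Q - 1))) \<le> ln (of_int Q)" using assms by (intro ln_mono) auto
    finally show "(\<Sum>l=1..<Q. 1 / real_of_int l) \<le> 1 + ln (of_int Q)" by simp
  qed (use Qr in auto)
  finally show ?thesis by (simp add: algebra_simps)
qed

section \<open>Sums over complete residue systems\<close>

lemma periodic_mod:
  fixes h :: "int \<Rightarrow> 'a"
  assumes "\<And>n. h (n + Q) = h n"
  shows "h (n mod Q) = h n"
proof -
  have nat: "h (n + int k * Q) = h n" for n k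
    by (induction k) (simp_all add: algebra_simps, metis assms add.assoc add.commute)
  have "h (n + k * Q) = h n" for n k
  proof (cases "k \<ge> 0")
    case True thus ?thesis using nat[of n "nat k"] by simp
  next
    case False thus ?thesis using nat[of "n + k * Q" "nat (-k)"] by simp
  qed
  from this[of "n mod Q" "n div Q"] show ?thesis by (simp add: add.commute)
qed

text \<open>An affine map with multiplier prime to \<open>Q\<close> permutes the residue
  classes modulo \<open>Q\<close>. Periodicity is expressed by invariance under reduction
  modulo \<open>Q\<close>, which applies directly to the representative in
  \<open>{0..<Q}\<close>.\<close>

lemma sum_residue_system:
  fixes h :: "int \<Rightarrow> 'a :: comm_monoid_add"
  assumes Q: "Q > 0" and per: "\<And>n. h (n mod Q) = h n" and cop: "coprime p Q"
  shows "(\<Sum>n=s..<s+Q. h (p * n + c)) = (\<Sum>n=0..<Q. h n)"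
proof -
  let ?f = "\<lambda>n. (p * n + c) mod Q"
  have inj: "inj_on ?f {s..<s+Q}"
  proof (rule inj_onI)
    fix x y assume xy: "x \<in> {s..<s+Q}" "y \<in> {s..<s+Q}" and "?f x = ?f y"
    hence "Q dvd p * x + c - (p * y + c)" by (simp add: mod_eq_dvd_iff)
    hence "Q dvd p * (x - y)" by (simp add: algebra_simps)
    hence "Q dvd x - y" using cop by (simp add: coprime_commute coprime_dvd_mult_right_iff)
    moreover have "\<bar>x - y\<bar> < Q" using xy by auto
    ultimately show "x = y" using zdvd_imp_le[of Q "\<bar>x - y\<bar>"] by force
  qed
  have sub: "?f ` {s..<s+Q} \<subseteq> {0..<Q}" using Q by auto
  have "?f ` {s..<s+Q} = {0..<Q}"
    by (rule card_subset_eq) (use sub Q card_image[OF inj] in auto)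
  hence "(\<Sum>n=0..<Q. h n) = (\<Sum>n=s..<s+Q. h (?f n))"
    using sum.reindex[OF inj, of h] by simp
  thus ?thesis by (simp add: per)
qed

lemma sum_period_shift:
  fixes h :: "int \<Rightarrow> 'a :: comm_monoid_add"
  assumes "Q > 0" "\<And>n. h (n mod Q) = h n"
  shows "(\<Sum>n=0..<Q. h (n + c)) = (\<Sum>n=0..<Q. h n)"
  using sum_residue_system[where h = h and p = 1 and s = 0 and c = c, OF assms(1)] assms(2)
  by (simp only: mult_1 add_0 coprime_1_left)

lemma sum_period_dilate:
  fixes h :: "int \<Rightarrow> 'a :: comm_monoid_add"
  assumes "Q > 0" "\<And>n. h (n mod Q) = h n" "coprime p Q"
  shows "(\<Sum>n=0..<Q. h (p * n)) = (\<Sum>n=0..<Q. h n)"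
  using sum_residue_system[of Q h p 0 0] assms by simp

lemma sum_period_reflect:
  fixes h :: "int \<Rightarrow> 'a :: comm_monoid_add"
  assumes "Q > 0" "\<And>n. h (n mod Q) = h n"
  shows "(\<Sum>n=0..<Q. h (- n)) = (\<Sum>n=0..<Q. h n)"
  using sum_period_dilate[of Q h "-1"] assms by simp

lemma sum_periods:
  fixes h :: "int \<Rightarrow> real"
  assumes "Q > 0" "\<And>n. h (n mod Q) = h n"
  shows "(\<Sum>n=0..<int m * Q. h n) = real m * (\<Sum>n=0..<Q. h n)"
proof (induction m)
  case (Suc m)
  have nn: "0 \<le> int m * Q" using assms(1) by simp
  have e: "int (Suc m) * Q = int m * Q + Q" by (simp add: algebra_simps)
  have "{0..<z + Q} = {0..<z} \<union> {z..<z + Q}" if "0 \<le> z" for z using that assms(1) by auto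
  from this[OF nn] have "{0..<int m * Q + Q} = {0..<int m * Q} \<union> {int m * Q..<int m * Q + Q}" .
  hence "(\<Sum>n=0..<int m * Q + Q. h n) = (\<Sum>n\<in>{0..<int m * Q} \<union> {int m * Q..<int m * Q + Q}. h n)" by (simp only:)
  also have "\<dots> = (\<Sum>n=0..<int m * Q. h n) + (\<Sum>n=int m * Q..<int m * Q + Q. h n)"
    by (rule sum.union_disjoint) auto
  also have "(\<Sum>n=int m * Q..<int m * Q + Q. h n) = (\<Sum>n=0..<Q. h n)"
    using sum_residue_system[where h = h and p = 1 and c = 0 and s = "int m * Q", OF assms] by simp
  finally show ?case unfolding e using Suc by (simp add: algebra_simps)
qed simp

section \<open>Fourier analysis modulo Q\<close>

definition char_mod :: "int \<Rightarrow> int \<Rightarrow> complex" where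
  "char_mod Q n = cis (2 * pi * of_int n / of_int Q)"

lemma char_mod_add: "char_mod Q (m + n) = char_mod Q m * char_mod Q n"
  by (simp add: char_mod_def cis_mult add_divide_distrib distrib_left)

lemma char_mod_0 [simp]: "char_mod Q 0 = 1"
  by (simp add: char_mod_def)

lemma cnj_char_mod: "cnj (char_mod Q n) = char_mod Q (- n)"
  by (simp add: char_mod_def cis_cnj)

lemma char_mod_multiple:
  assumes "Q > 0" "Q dvd n" shows "char_mod Q n = 1"
proof -
  obtain k where "n = Q * k" using assms by blast
  hence "2 * pi * of_int n / of_int Q = 2 * pi * of_int k" using assms by simp
  hence "char_mod Q n = cis (2 * pi * of_int k)" unfolding char_mod_def by (rule arg_cong)
  thus ?thesis by (simp only: cis_multiple_2pi Ints_of_int)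
qed

lemma char_mod_cong:
  assumes "Q > 0" "m mod Q = n mod Q" shows "char_mod Q m = char_mod Q n"
proof -
  have "Q dvd m - n" using assms by (simp add: mod_eq_dvd_iff)
  thus ?thesis using char_mod_add[of Q "m - n" n] char_mod_multiple[OF assms(1)] by simp
qed

lemma char_mod_period: "Q > 0 \<Longrightarrow> char_mod Q (m * (n mod Q)) = char_mod Q (m * n)"
  by (rule char_mod_cong) (simp_all add: mod_simps)

lemma one_minus_char_mod:
  "cmod (1 - char_mod Q n) = 2 * \<bar>sin (pi * (of_int n / of_int Q))\<bar>"
proof -
  define a where "a = pi * (of_int n / of_int Q)"
  have "char_mod Q n = cis (2 * a)" by (simp add: char_mod_def a_def mult.assoc)
  hence "(cmod (1 - char_mod Q n))\<^sup>2 = (1 - cos (2*a))\<^sup>2 + (sin (2*a))\<^sup>2"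
    by (simp add: cmod_power2)
  also have "\<dots> = (2 * sin a)\<^sup>2"
  proof -
    have "(1 - cos (2*a))\<^sup>2 + (sin (2*a))\<^sup>2 = 2 - 2 * cos (2 * a)"
      using sin_cos_squared_add[of "2*a"] by (simp add: power2_eq_square algebra_simps)
    thus ?thesis by (simp add: cos_double_sin power2_eq_square)
  qed
  finally have "cmod (1 - char_mod Q n) = \<bar>2 * sin a\<bar>"
    by (metis norm_ge_zero real_sqrt_abs real_sqrt_power abs_of_nonneg)
  thus ?thesis by (simp add: a_def abs_mult)
qed

lemma char_mod_plus_inverse:
  "char_mod Q n + char_mod Q (- n) - 2 = - of_real (4 * (sin (pi * (of_int n / of_int Q)))\<^sup>2)"
proof -
  define a where "a = pi * (of_int n / of_int Q)"
  have "char_mod Q n = cis (2 * a)" "char_mod Q (- n) = cis (- (2 * a))"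
    by (simp_all add: char_mod_def a_def mult.assoc)
  thus ?thesis unfolding a_def[symmetric]
    by (simp add: complex_eq_iff cos_double_sin)
qed

lemma char_mod_neq_1: "Q > 0 \<Longrightarrow> \<not> Q dvd n \<Longrightarrow> char_mod Q n \<noteq> 1"
  using one_minus_char_mod[of Q n] sin_frac_eq_0_iff[of Q n] by force

lemma sum_char_mod:
  assumes "Q > 0"
  shows "(\<Sum>m=0..<Q. char_mod Q (m * n)) = (if Q dvd n then of_int Q else 0)"
proof (cases "Q dvd n")
  case True
  thus ?thesis using assms by (simp add: char_mod_multiple)
next
  case False
  let ?S = "\<Sum>m=0..<Q. char_mod Q (m * n)"
  \<comment> \<open>shifting the summation index multiplies the sum by a number other than 1\<close>
  have "?S = (\<Sum>m=0..<Q. char_mod Q ((m + 1) * n))"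
    by (rule sum_period_shift[symmetric]) (use assms char_mod_period[of Q n] in \<open>simp_all add: mult.commute\<close>)
  also have "\<dots> = char_mod Q n * ?S"
    by (simp add: sum_distrib_left distrib_right char_mod_add mult.commute[of "char_mod Q n"])
  finally have "(1 - char_mod Q n) * ?S = 0" by (simp add: algebra_simps)
  thus ?thesis using False char_mod_neq_1[OF assms False] by auto
qed

lemma parseval_mod:
  fixes h :: "int \<Rightarrow> real"
  assumes Q: "Q > 0"
  shows "(\<Sum>m=0..<Q. (cmod (\<Sum>n=0..<Q. of_real (h n) * char_mod Q (m * n)))\<^sup>2)
           = of_int Q * (\<Sum>n=0..<Q. (h n)\<^sup>2)"
proof -
  let ?F = "\<lambda>m. \<Sum>n=0..<Q. of_real (h n) * char_mod Q (m * n)"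
  have "complex_of_real (\<Sum>m=0..<Q. (cmod (?F m))\<^sup>2) = (\<Sum>m=0..<Q. ?F m * cnj (?F m))"
    by (simp only: of_real_sum complex_norm_square)
  also have "\<dots> = (\<Sum>m=0..<Q. \<Sum>n=0..<Q. \<Sum>k=0..<Q. of_real (h n * h k) * char_mod Q (m * (n - k)))"
    by (simp add: sum_product cnj_char_mod right_diff_distrib mult_ac flip: char_mod_add)
  also have "\<dots> = (\<Sum>n=0..<Q. \<Sum>m=0..<Q. \<Sum>k=0..<Q. of_real (h n * h k) * char_mod Q (m * (n - k)))"
    by (rule sum.swap)
  also have "\<dots> = (\<Sum>n=0..<Q. \<Sum>k=0..<Q. \<Sum>m=0..<Q. of_real (h n * h k) * char_mod Q (m * (n - k)))"
    by (intro sum.cong refl sum.swap)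
  also have "\<dots> = (\<Sum>n=0..<Q. \<Sum>k=0..<Q. of_real (h n * h k) * (if Q dvd n - k then of_int Q else 0))"
    by (simp add: sum_char_mod[OF Q] flip: sum_distrib_left)
  also have "\<dots> = (\<Sum>n=0..<Q. \<Sum>k=0..<Q. if k = n then of_real (h n * h k) * of_int Q else 0)"
  proof (intro sum.cong refl)
    fix n k assume nk: "n \<in> {0..<Q}" "k \<in> {0..<Q}"
    have "Q dvd n - k \<longleftrightarrow> n = k"
      using nk by (metis atLeastLessThan_iff mod_eq_dvd_iff mod_pos_pos_trivial)
    thus "of_real (h n * h k) * (if Q dvd n - k then of_int Q else 0)
        = (if k = n then complex_of_real (h n * h k) * of_int Q else 0)" by auto
  qed
  also have "\<dots> = of_real (of_int Q * (\<Sum>n=0..<Q. (h n)\<^sup>2))"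
    by (simp add: sum.delta' sum_distrib_left power2_eq_square mult_ac cong: if_cong)
  finally show ?thesis by (simp only: of_real_eq_iff)
qed

text \<open>This is Parseval's identity for the indicator function of an interval of length
  \<open>r\<close>, with the frequency \<open>n = 0\<close>, which contributes
  \<open>r\<^sup>2\<close>, removed. The summands are values of the Fejer kernel.\<close>

lemma fejer_sum:
  fixes Q r :: int
  assumes Q: "Q > 0" and r: "0 \<le> r" "r \<le> Q"
  shows "(\<Sum>n=1..<Q. (sin (pi * (of_int (r * n) / of_int Q)))\<^sup>2 / (sin (pi * (of_int n / of_int Q)))\<^sup>2)
           = of_int (r * (Q - r))"
proof -
  define F where "F n = (\<Sum>j=0..<r. char_mod Q (n * j))" for n
  have tele: "(1 - char_mod Q n) * F n = 1 - char_mod Q (n * r)" for n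
  proof -
    have "(1 - char_mod Q n) * (\<Sum>j=0..<int k. char_mod Q (n * j)) = 1 - char_mod Q (n * int k)" for k
    proof (induction k)
      case (Suc k)
      have "{0..<int (Suc k)} = insert (int k) {0..<int k}" by auto
      hence "(1 - char_mod Q n) * (\<Sum>j=0..<int (Suc k). char_mod Q (n * j))
          = (1 - char_mod Q n) * char_mod Q (n * int k) + (1 - char_mod Q n) * (\<Sum>j=0..<int k. char_mod Q (n * j))"
        by (simp add: distrib_left)
      also have "\<dots> = 1 - char_mod Q n * char_mod Q (n * int k)"
        unfolding Suc by (simp add: algebra_simps)
      also have "char_mod Q n * char_mod Q (n * int k) = char_mod Q (n * int (Suc k))"
        by (simp add: distrib_left char_mod_add)
      finally show ?case .
    qed simp
    from this[of "nat r"] show ?thesis using r by (simp add: F_def)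
  qed
  have F: "(cmod (F n))\<^sup>2 = (sin (pi * (of_int (r * n) / of_int Q)))\<^sup>2 / (sin (pi * (of_int n / of_int Q)))\<^sup>2"
    if "n \<in> {1..<Q}" for n
  proof -
    have "\<not> Q dvd n" using that zdvd_not_zless by auto
    hence nz: "sin (pi * (of_int n / of_int Q)) \<noteq> 0" using sin_frac_eq_0_iff[OF Q] by blast
    have "2 * \<bar>sin (pi * (of_int n / of_int Q))\<bar> * cmod (F n)
            = 2 * \<bar>sin (pi * (of_int (n * r) / of_int Q))\<bar>"
      using arg_cong[OF tele[of n], of cmod] unfolding norm_mult one_minus_char_mod .
    hence "cmod (F n) = \<bar>sin (pi * (of_int (n * r) / of_int Q))\<bar> / \<bar>sin (pi * (of_int n / of_int Q))\<bar>"
      using nz by (simp add: field_simps)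
    thus ?thesis by (simp add: power_divide mult.commute)
  qed
  \<comment> \<open>\<open>F\<close> is the Fourier transform of the indicator function of \<open>{0..<r}\<close>\<close>
  have "(\<Sum>j=0..<Q. complex_of_real (if j < r then 1 else 0) * char_mod Q (n * j)) = F n" for n
  proof -
    have "(\<Sum>j=0..<Q. complex_of_real (if j < r then 1 else 0) * char_mod Q (n * j))
        = (\<Sum>j=0..<Q. if j \<in> {0..<r} then char_mod Q (n * j) else 0)"
      by (intro sum.cong) auto
    also have "\<dots> = (\<Sum>j\<in>{0..<Q} \<inter> {0..<r}. char_mod Q (n * j))"
      by (rule sum.inter_restrict[symmetric]) simp
    also have "{0..<Q} \<inter> {0..<r} = {0..<r}" using r by auto
    finally show ?thesis by (simp add: F_def)
  qed
  moreover have "(\<Sum>j=0..<Q. ((if j < r then 1 else 0)::real)\<^sup>2) = of_int r"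
  proof -
    have "(\<Sum>j=0..<Q. ((if j < r then 1 else 0)::real)\<^sup>2) = (\<Sum>j=0..<Q. if j \<in> {0..<r} then 1 else 0)"
      by (intro sum.cong) auto
    also have "\<dots> = (\<Sum>j\<in>{0..<Q} \<inter> {0..<r}. 1)"
      by (rule sum.inter_restrict[symmetric]) simp
    also have "{0..<Q} \<inter> {0..<r} = {0..<r}" using r by auto
    finally show ?thesis using r by simp
  qed
  ultimately have "(\<Sum>n=0..<Q. (cmod (F n))\<^sup>2) = of_int Q * of_int r"
    using parseval_mod[OF Q, of "\<lambda>j. if j < r then 1 else 0"] by (simp only:)
  moreover have "{0..<Q} = insert 0 {1..<Q}" using Q by auto
  moreover have "cmod (F 0) = of_int r" using r by (simp add: F_def)
  ultimately have "(\<Sum>n=1..<Q. (cmod (F n))\<^sup>2) = of_int (r * (Q - r))"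
    by (simp add: algebra_simps power2_eq_square)
  moreover have "(\<Sum>n=1..<Q. (cmod (F n))\<^sup>2)
      = (\<Sum>n=1..<Q. (sin (pi * (of_int (r * n) / of_int Q)))\<^sup>2 / (sin (pi * (of_int n / of_int Q)))\<^sup>2)"
    by (intro sum.cong refl F)
  ultimately show ?thesis by simp
qed

section \<open>The logarithmic sine modulo Q and its Fourier coefficients\<close>

lemma prod_sin_root_unity:
  assumes "n > 0"
  shows "(\<Prod>l=1..<n. \<bar>2 * sin (pi * (real l / real n))\<bar>) = real n"
proof -
  define z where "z l = cis (2 * pi * real l / real n)" for l
  have bij: "bij_betw z {..<n} {z. z ^ n = 1}"
    using Complex.bij_betw_roots_unity[OF assms] by (simp add: z_def[abs_def])
  hence inj: "inj_on z {1..<n}" by (rule inj_on_subset[OF bij_betw_imp_inj_on]) auto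
  have z1: "z l \<noteq> 1" and zn: "z l ^ n = 1" if "l \<in> {1..<n}" for l
  proof -
    have "z l \<noteq> z 0"
      using bij_betw_imp_inj_on[OF bij] that by (auto dest!: inj_onD)
    thus "z l \<noteq> 1" by (simp add: z_def)
    show "z l ^ n = 1" using bij_betwE[OF bij] that by auto
  qed
  \<comment> \<open>\<open>1 + X + \<dots> + X^(n-1)\<close> is the product of \<open>X - z\<close> over the roots of unity \<open>z \<noteq> 1\<close>; evaluate at 1\<close>
  define p q where "p = (\<Sum>i<n. monom (1::complex) i)" and "q = (\<Prod>l=1..<n. [:- z l, 1:])"
  have degq: "degree q = n - 1"
    unfolding q_def by (subst degree_prod_eq_sum_degree) auto
  have lcq: "coeff q (n - 1) = 1"
    using lead_coeff_prod[of "\<lambda>l. [:- z l, 1:]" "{1..<n}"] degq by (simp add: q_def)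
  have cp: "coeff p k = (if k < n then 1 else 0)" for k
    by (simp add: p_def coeff_sum)
  have "p = q"
  proof (rule poly_eqI_degree_lead_coeff[where n = "n - 1" and A = "z ` {1..<n}"])
    show "coeff p (n - 1) = coeff q (n - 1)" using cp lcq assms by simp
    show "n - 1 \<le> card (z ` {1..<n})" unfolding card_image[OF inj] by simp
    show "degree p \<le> n - 1" by (rule degree_le) (auto simp: cp)
    show "degree q \<le> n - 1" by (simp add: degq)
  next
    fix w assume "w \<in> z ` {1..<n}"
    then obtain l where l: "l \<in> {1..<n}" "w = z l" by blast
    have "poly p w = (\<Sum>i<n. w ^ i)" by (simp add: p_def poly_sum poly_monom)
    also have "\<dots> = 0" using z1[OF l(1)] zn[OF l(1)] l(2) by (simp add: geometric_sum)
    also have "0 = poly q w" using l by (auto simp: q_def poly_prod)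
    finally show "poly p w = poly q w" .
  qed
  hence "poly p 1 = poly q 1" by simp
  hence "of_nat n = (\<Prod>l=1..<n. 1 - z l)"
    by (simp add: p_def q_def poly_sum poly_monom poly_prod)
  hence "real n = cmod (\<Prod>l=1..<n. 1 - z l)" by (metis norm_of_nat)
  also have "\<dots> = (\<Prod>l=1..<n. cmod (1 - z l))" by (simp add: prod_norm)
  also have "\<dots> = (\<Prod>l=1..<n. \<bar>2 * sin (pi * (real l / real n))\<bar>)"
    using one_minus_char_mod[of "int n" "int _"]
    by (intro prod.cong refl) (simp add: z_def char_mod_def abs_mult)
  finally show ?thesis by simp
qed

lemma sum_ln_sin_root_unity:
  fixes Q :: int
  assumes "Q > 0"
  shows "(\<Sum>l=1..<Q. ln \<bar>2 * sin (pi * (of_int l / of_int Q))\<bar>) = ln (of_int Q)"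
proof -
  define n where "n = nat Q"
  have n: "Q = int n" "n > 0" using assms by (auto simp: n_def)
  have "{1..<Q} = int ` {1..<n}"
    using n by (simp add: image_int_atLeastLessThan)
  hence "(\<Sum>l=1..<Q. ln \<bar>2 * sin (pi * (of_int l / of_int Q))\<bar>)
      = (\<Sum>l=1..<n. ln \<bar>2 * sin (pi * (real l / real n))\<bar>)"
    by (simp add: sum.reindex n)
  also have "\<dots> = ln (\<Prod>l=1..<n. \<bar>2 * sin (pi * (real l / real n))\<bar>)"
  proof (rule ln_prod[symmetric])
    fix l assume l: "l \<in> {1..<n}"
    have "\<not> int n dvd int l" using l zdvd_not_zless by auto
    thus "\<bar>2 * sin (pi * (real l / real n))\<bar> \<noteq> 0"
      using sin_frac_eq_0_iff[of "int n" "int l"] n by simp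
  qed simp
  finally show ?thesis using prod_sin_root_unity[OF n(2)] n by simp
qed

text \<open>The value at the multiples of \<open>Q\<close>, where the sine vanishes, is
  chosen so that the sum over a period is zero. Then partial sums along \<open>p, 2 p, 3 p,
  \<dots>\<close> are again periodic.\<close>

definition logsin_mod :: "int \<Rightarrow> int \<Rightarrow> real" where
  "logsin_mod Q n =
     (if Q dvd n then - ln (of_int Q) else ln \<bar>2 * sin (pi * (of_int n / of_int Q))\<bar>)"

lemma logsin_mod_period:
  assumes "Q > 0" shows "logsin_mod Q (n mod Q) = logsin_mod Q n"
proof -
  have "logsin_mod Q (n + Q) = logsin_mod Q n" for n
  proof -
    have "pi * (of_int (n + Q) / of_int Q) = pi * (of_int n / of_int Q) + pi"
      using assms by (simp add: field_simps)
    thus ?thesis unfolding logsin_mod_def by simp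
  qed
  thus ?thesis by (rule periodic_mod)
qed

lemma logsin_mod_minus: "logsin_mod Q (- n) = logsin_mod Q n"
  by (simp add: logsin_mod_def)

lemma sum_logsin_mod_units:
  assumes "Q > 0" shows "(\<Sum>n=1..<Q. logsin_mod Q n) = ln (of_int Q)"
proof -
  have "(\<Sum>n=1..<Q. logsin_mod Q n) = (\<Sum>l=1..<Q. ln \<bar>2 * sin (pi * (of_int l / of_int Q))\<bar>)"
    using zdvd_not_zless by (intro sum.cong) (auto simp: logsin_mod_def)
  thus ?thesis using sum_ln_sin_root_unity[OF assms] by simp
qed

lemma sum_logsin_mod:
  assumes "Q > 0" shows "(\<Sum>n=0..<Q. logsin_mod Q n) = 0"
proof -
  have "{0..<Q} = insert 0 {1..<Q}" using assms by auto
  thus ?thesis using sum_logsin_mod_units[OF assms] by (simp add: logsin_mod_def)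
qed

definition logsin_diff2 :: "int \<Rightarrow> int \<Rightarrow> real" where
  "logsin_diff2 Q n = logsin_mod Q (n + 1) + logsin_mod Q (n - 1) - 2 * logsin_mod Q n"

lemma logsin_diff2_period:
  assumes "Q > 0" shows "logsin_diff2 Q (n mod Q) = logsin_diff2 Q n"
  unfolding logsin_diff2_def
  using logsin_mod_period[OF assms] by (metis mod_add_left_eq mod_diff_left_eq)

lemma logsin_diff2_minus: "logsin_diff2 Q (- n) = logsin_diff2 Q n"
  using logsin_mod_minus[of Q "n + 1"] logsin_mod_minus[of Q "n - 1"] logsin_mod_minus[of Q n]
  by (simp add: logsin_diff2_def)

lemma sum_logsin_diff2:
  assumes "Q > 0" shows "(\<Sum>n=0..<Q. logsin_diff2 Q n) = 0"
  unfolding logsin_diff2_def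
  using sum_period_shift[of Q "logsin_mod Q" 1] sum_period_shift[of Q "logsin_mod Q" "-1"]
    logsin_mod_period[OF assms] assms
  by (simp add: sum.distrib sum_subtractf sum_logsin_mod flip: sum_distrib_left)

text \<open>Away from the residues \<open>0, 1, -1\<close> the angle is at least \<open>2
  \<pi> / Q\<close> from the zeros of the sine, and doubling an angle of at most
  \<open>\<pi> / 4\<close> at least doubles the square of its sine.\<close>

lemma sin2_pi_div_le:
  fixes Q n :: int
  assumes Q: "Q \<ge> 4" and n: "\<not> Q dvd n" "\<not> Q dvd n + 1" "\<not> Q dvd n - 1"
  shows "(sin (pi / of_int Q))\<^sup>2 / (sin (pi * (of_int n / of_int Q)))\<^sup>2 \<le> 1 / 2"
proof -
  define b where "b = pi / of_int Q"
  define m where "m = n mod Q"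
  have b: "0 < b" "b \<le> pi / 4" using Q by (auto simp: b_def field_simps)
  have m: "2 \<le> m" "m \<le> Q - 2"
  proof -
    have "0 \<le> m" "m < Q" "m \<noteq> 0" using Q n(1) by (auto simp: m_def dvd_eq_mod_eq_0)
    moreover have "m \<noteq> 1" using n(3) Q by (auto simp: m_def mod_eq_dvd_iff[symmetric])
    moreover have "m \<noteq> Q - 1"
    proof
      assume "m = Q - 1"
      hence "n mod Q = (-1) mod Q" using Q by (simp add: m_def zmod_minus1)
      thus False using n(2) by (simp add: mod_eq_dvd_iff)
    qed
    ultimately show "2 \<le> m" "m \<le> Q - 2" by linarith+
  qed
  have "nint_dist (of_int m / of_int Q) \<ge> of_int (min m (Q - m)) / of_int Q"
    using m Q by (intro nint_dist_fraction_min) auto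
  moreover have "of_int (min m (Q - m)) / of_int Q \<ge> (2::real) / of_int Q"
    using m Q by (intro divide_right_mono) linarith+
  ultimately have nd: "nint_dist (of_int m / of_int Q) \<ge> 2 / of_int Q" by linarith
  have sin_nm: "\<bar>sin (pi * (of_int n / of_int Q))\<bar> = \<bar>sin (pi * (of_int m / of_int Q))\<bar>"
    unfolding m_def
  proof (rule periodic_mod[of "\<lambda>n. \<bar>sin (pi * (of_int n / of_int Q))\<bar>", symmetric])
    fix n
    have "pi * (of_int (n + Q) / of_int Q) = pi * (of_int n / of_int Q) + pi"
      using Q by (simp add: field_simps)
    thus "\<bar>sin (pi * (of_int (n + Q) / of_int Q))\<bar> = \<bar>sin (pi * (of_int n / of_int Q))\<bar>" by simp
  qed
  have "sin (2 * b) \<le> \<bar>sin (pi * (of_int m / of_int Q))\<bar>"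
    unfolding abs_sin_pi_nint_dist
  proof (rule sin_monotone_2pi_le)
    show "2 * b \<le> pi * nint_dist (of_int m / of_int Q)"
      using mult_left_mono[OF nd, of pi] by (simp add: b_def mult_ac)
    show "pi * nint_dist (of_int m / of_int Q) \<le> pi / 2"
      using mult_left_mono[OF nint_dist_le_half, of pi] by simp
    show "- (pi / 2) \<le> 2 * b" using b pi_gt_zero by linarith
  qed
  moreover have "0 \<le> sin (2 * b)" using b by (intro sin_ge_zero) auto
  ultimately have "(sin (2*b))\<^sup>2 \<le> (sin (pi * (of_int m / of_int Q)))\<^sup>2"
    by (metis power2_abs power_mono)
  moreover have "(sin (2*b))\<^sup>2 \<ge> 2 * (sin b)\<^sup>2" using b by (rule two_sin_sq_le_sin_double_sq)
  ultimately have "2 * (sin b)\<^sup>2 \<le> (sin (pi * (of_int n / of_int Q)))\<^sup>2"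
    using sin_nm by (metis order_trans power2_abs)
  moreover have "0 < (sin (pi * (of_int n / of_int Q)))\<^sup>2"
    using sin_frac_eq_0_iff[of Q n] n Q by simp
  ultimately show ?thesis by (simp add: b_def field_simps)
qed

text \<open>Discrete analogue of \<open>(ln sin)'' = - 1 / sin\<^sup>2\<close>: away from
  the singular residue the second difference equals \<open>ln (1 - sin\<^sup>2 b /
  sin\<^sup>2 a)\<close> with \<open>b = \<pi> / Q\<close> and \<open>a = \<pi> n /
  Q\<close>.\<close>

lemma logsin_diff2_bound:
  fixes Q n :: int
  assumes Q: "Q \<ge> 4" and n: "\<not> Q dvd n"
  shows "\<bar>logsin_diff2 Q n\<bar> \<le> 3 * (sin (pi / of_int Q))\<^sup>2 / (sin (pi * (of_int n / of_int Q)))\<^sup>2"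
proof -
  define b where "b = pi / of_int Q"
  have b: "0 < b" "b \<le> pi / 4" using Q by (auto simp: b_def field_simps)
  have sb: "0 < sin b" using b by (intro sin_gt_zero) auto
  \<comment> \<open>next to the singular residue the modified value \<open>- ln Q\<close> enters; the second difference stays bounded\<close>
  have one: "\<bar>logsin_diff2 Q 1\<bar> \<le> 3"
  proof -
    have nd2: "\<not> Q dvd 2" and nd1: "\<not> Q dvd 1" using Q zdvd_not_zless by auto
    have s2: "sin (2 * b) > 0" using b by (intro sin_gt_zero) auto
    have cb: "1 / 2 \<le> cos b"
    proof -
      have "cos (pi / 3) \<le> cos b" using b by (intro cos_monotone_0_pi_le) auto
      thus ?thesis by (simp add: cos_60)
    qed
    have Qs: "2 \<le> of_int Q * sin b" "of_int Q * sin b \<le> pi"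
    proof -
      have "2 * (1 / of_int Q) \<le> sin (pi * (1 / of_int Q))"
        using Q by (intro jordan_sin_ineq) (auto simp: field_simps)
      thus "2 \<le> of_int Q * sin b" using Q by (simp add: b_def field_simps)
      have "sin b \<le> b" using b by (intro sin_x_le_x) auto
      thus "of_int Q * sin b \<le> pi" using Q by (simp add: b_def field_simps)
    qed
    have "logsin_diff2 Q 1 = ln (2 * sin (2*b)) - ln (of_int Q) - 2 * ln (2 * sin b)"
      using nd1 nd2 sb s2 by (simp add: logsin_diff2_def logsin_mod_def b_def abs_mult mult.commute)
    also have "\<dots> = ln (2 * sin (2*b)) - (ln (of_int Q) + ln ((2 * sin b)\<^sup>2))"
      by (subst ln_realpow) (use sb in auto)
    also have "\<dots> = ln (2 * sin (2*b) / (of_int Q * (2 * sin b)\<^sup>2))"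
      using sb s2 Q by (subst ln_div) (simp_all add: ln_mult)
    also have "2 * sin (2*b) / (of_int Q * (2 * sin b)\<^sup>2) = cos b / (of_int Q * sin b)"
      unfolding sin_double using sb Q by (simp add: power2_eq_square field_simps)
    finally have eq: "logsin_diff2 Q 1 = ln (cos b / (of_int Q * sin b))" .
    have "cos b / (of_int Q * sin b) \<le> 1 / 1"
      using Qs cb by (intro frac_le) auto
    hence up: "logsin_diff2 Q 1 \<le> 0" unfolding eq using Qs cb by (subst ln_le_zero_iff) auto
    have "exp (-3) \<le> (1/2) / pi"
    proof -
      have "1 + 3 + 3\<^sup>2/2 \<le> exp (3::real)" by (rule exp_lower_Taylor_quadratic) simp
      hence "2 * pi \<le> exp 3" using pi_less_4 by simp
      hence "1 / exp 3 \<le> 1 / (2 * pi)" by (intro divide_left_mono) auto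
      thus ?thesis by (simp add: exp_minus field_simps)
    qed
    also have "(1/2) / pi \<le> cos b / (of_int Q * sin b)"
      using Qs cb by (intro frac_le) auto
    finally have "-3 \<le> logsin_diff2 Q 1"
      unfolding eq using Qs cb by (subst ln_ge_iff) auto
    with up show ?thesis by simp
  qed
  consider "Q dvd n - 1" | "Q dvd n + 1" | "\<not> Q dvd n + 1" "\<not> Q dvd n - 1" by blast
  thus ?thesis
  proof cases
    case 1
    hence "n mod Q = 1 mod Q" by (simp add: mod_eq_dvd_iff)
    hence D: "logsin_diff2 Q n = logsin_diff2 Q 1" 
      using logsin_diff2_period[of Q] Q by (metis less_le_trans zero_less_numeral)
    obtain k where "n = 1 + Q * k" using 1 by (metis add.commute diff_add_cancel dvdE)
    hence "pi * (of_int n / of_int Q) = b + of_int k * pi" using Q by (simp add: b_def field_simps)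
    hence "(sin (pi * (of_int n / of_int Q)))\<^sup>2 = (sin b)\<^sup>2"
      using sin_times_pi_eq_0[of "of_int k"] sin_cos_squared_add[of "of_int k * pi"]
      by (simp add: sin_add power_mult_distrib)
    thus ?thesis using D one sb by (simp add: b_def)
  next
    case 2
    hence "(- n) mod Q = 1 mod Q" by (simp add: mod_eq_dvd_iff) (metis add.commute dvd_minus_iff minus_add_distrib uminus_add_conv_diff minus_diff_eq diff_minus_eq_add)
    hence D: "logsin_diff2 Q n = logsin_diff2 Q 1" 
      using logsin_diff2_period[of Q] Q logsin_diff2_minus by (metis less_le_trans zero_less_numeral)
    obtain k where "n = Q * k - 1" using 2 by (metis add_diff_cancel_right' dvdE)
    hence "real_of_int n = of_int Q * of_int k - 1" by simp
    hence "pi * (of_int n / of_int Q) = pi * ((of_int Q * of_int k - 1) / of_int Q)" by simp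
    also have "\<dots> = - b + of_int k * pi" using Q by (simp add: b_def diff_divide_distrib right_diff_distrib)
    finally have "pi * (of_int n / of_int Q) = - b + of_int k * pi" .
    hence "(sin (pi * (of_int n / of_int Q)))\<^sup>2 = (sin b)\<^sup>2"
      using sin_times_pi_eq_0[of "of_int k"] sin_cos_squared_add[of "of_int k * pi"]
      by (simp add: sin_diff power_mult_distrib)
    thus ?thesis using D one sb by (simp add: b_def)
  next
    case 3
    define a where "a = pi * (of_int n / of_int Q)"
    define x where "x = (sin b)\<^sup>2 / (sin a)\<^sup>2"
    have x: "0 \<le> x" "x \<le> 1/2"
      using sin2_pi_div_le[OF Q n 3] by (auto simp: x_def a_def b_def)
    have ap: "pi * (of_int (n + 1) / of_int Q) = a + b" and am: "pi * (of_int (n - 1) / of_int Q) = a - b"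
      using Q by (simp_all add: a_def b_def field_simps)
    have nz: "sin a \<noteq> 0" "sin (a + b) \<noteq> 0" "sin (a - b) \<noteq> 0"
      using sin_frac_eq_0_iff[of Q n] sin_frac_eq_0_iff[of Q "n+1"] sin_frac_eq_0_iff[of Q "n-1"] n 3 Q
      unfolding ap am a_def[symmetric] by auto
    have "logsin_diff2 Q n = ln \<bar>2 * sin (a + b)\<bar> + ln \<bar>2 * sin (a - b)\<bar> - 2 * ln \<bar>2 * sin a\<bar>"
      using n 3 unfolding logsin_diff2_def logsin_mod_def ap am a_def[symmetric] by simp
    also have "\<dots> = ln (\<bar>2 * sin (a + b)\<bar> * \<bar>2 * sin (a - b)\<bar>) - ln (\<bar>2 * sin a\<bar>\<^sup>2)"
    proof -
      have "ln (\<bar>2 * sin a\<bar>\<^sup>2) = 2 * ln \<bar>2 * sin a\<bar>" by (subst ln_realpow) (use nz in auto)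
      moreover have "ln (\<bar>2 * sin (a + b)\<bar> * \<bar>2 * sin (a - b)\<bar>) = ln \<bar>2 * sin (a + b)\<bar> + ln \<bar>2 * sin (a - b)\<bar>"
        by (rule ln_mult_pos) (use nz in auto)
      ultimately show ?thesis by (simp only:)
    qed
    also have "\<dots> = ln (\<bar>2 * sin (a + b)\<bar> * \<bar>2 * sin (a - b)\<bar> / \<bar>2 * sin a\<bar>\<^sup>2)"
      using nz by (subst ln_div) auto
    also have "\<bar>2 * sin (a + b)\<bar> * \<bar>2 * sin (a - b)\<bar> / \<bar>2 * sin a\<bar>\<^sup>2 = \<bar>sin (a + b) * sin (a - b)\<bar> / (sin a)\<^sup>2"
      by (simp add: abs_mult power_mult_distrib)
    also have "\<dots> = \<bar>1 - x\<bar>"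
    proof -
      have "\<bar>sin (a + b) * sin (a - b)\<bar> / (sin a)\<^sup>2 = \<bar>((sin a)\<^sup>2 - (sin b)\<^sup>2) / (sin a)\<^sup>2\<bar>"
        by (simp add: sin_plus_times_sin_minus)
      also have "((sin a)\<^sup>2 - (sin b)\<^sup>2) / (sin a)\<^sup>2 = 1 - x"
        using nz by (simp add: x_def diff_divide_distrib)
      finally show ?thesis .
    qed
    also have "\<dots> = 1 + (- x)" using x by simp
    finally have "\<bar>logsin_diff2 Q n\<bar> \<le> 2 * \<bar>- x\<bar>" using abs_ln_one_plus_le[of "-x"] x by simp
    also have "\<dots> \<le> 3 * x" using x by simp
    finally show ?thesis by (simp add: x_def a_def b_def)
  qed
qed

definition logsin_fourier :: "int \<Rightarrow> int \<Rightarrow> complex" where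
  "logsin_fourier Q r = (\<Sum>n=0..<Q. of_real (logsin_mod Q n) * char_mod Q (r * n))"

text \<open>Two summations by parts. Since the second differences are even and sum to zero,
  the character may be replaced by \<open>cos - 1\<close>, that is, by minus twice a squared
  sine. This second order smallness at low frequencies is what avoids a logarithmic loss in
  the next estimate.\<close>

lemma logsin_fourier_diff2:
  assumes Q: "Q > 0"
  shows "logsin_fourier Q r * of_real (4 * (sin (pi * (of_int r / of_int Q)))\<^sup>2)
           = of_real (\<Sum>n=0..<Q. logsin_diff2 Q n * (2 * (sin (pi * (of_int (r * n) / of_int Q)))\<^sup>2))"
proof -
  let ?g = "\<lambda>n. complex_of_real (logsin_mod Q n)"
  let ?D = "\<lambda>n. complex_of_real (logsin_diff2 Q n)"
  let ?c = "char_mod Q"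
  let ?s = "\<lambda>n. complex_of_real (4 * (sin (pi * (of_int (r * n) / of_int Q)))\<^sup>2)"
  have per: "?c (r * (n mod Q)) = ?c (r * n)" for n
    using char_mod_period[OF Q] .
  have g_per: "logsin_mod Q (n mod Q + k) = logsin_mod Q (n + k)" for n k
    using logsin_mod_period[OF Q] by (metis mod_add_left_eq)
  have shift: "(\<Sum>n=0..<Q. ?g (n + k) * ?c (r * n)) = ?c (- (r * k)) * logsin_fourier Q r" for k
  proof -
    have "(\<Sum>n=0..<Q. ?g (n + k) * ?c (r * n)) = (\<Sum>n=0..<Q. ?g (n + - k + k) * ?c (r * (n + - k)))"
      by (rule sum_period_shift[OF Q, where h = "\<lambda>n. ?g (n + k) * ?c (r * n)", symmetric])
        (simp only: per g_per)
    also have "\<dots> = (\<Sum>n=0..<Q. ?c (- (r * k)) * (?g n * ?c (r * n)))"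
    proof (rule sum.cong[OF refl])
      fix n
      have "?c (r * (n + - k)) = ?c (- (r * k)) * ?c (r * n)"
        using char_mod_add[of Q "- (r * k)" "r * n"] by (simp add: algebra_simps)
      thus "?g (n + - k + k) * ?c (r * (n + - k)) = ?c (- (r * k)) * (?g n * ?c (r * n))" by simp
    qed
    also have "\<dots> = ?c (- (r * k)) * logsin_fourier Q r"
      by (simp only: logsin_fourier_def sum_distrib_left)
    finally show ?thesis .
  qed
  have "(\<Sum>n=0..<Q. ?D n * ?c (r * n))
      = (\<Sum>n=0..<Q. ?g (n + 1) * ?c (r * n)) + (\<Sum>n=0..<Q. ?g (n + - 1) * ?c (r * n))
        - 2 * (\<Sum>n=0..<Q. ?g (n + 0) * ?c (r * n))"
    by (simp add: logsin_diff2_def sum.distrib sum_subtractf sum_distrib_left algebra_simps)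
  also have "\<dots> = (?c r + ?c (- r) - 2) * logsin_fourier Q r"
    unfolding shift by (simp add: algebra_simps)
  also have "?c r + ?c (- r) - 2 = - of_real (4 * (sin (pi * (of_int r / of_int Q)))\<^sup>2)"
    by (rule char_mod_plus_inverse)
  finally have main: "(\<Sum>n=0..<Q. ?D n * ?c (r * n))
      = - of_real (4 * (sin (pi * (of_int r / of_int Q)))\<^sup>2) * logsin_fourier Q r" .
  have "(\<Sum>n=0..<Q. ?D (- n) * ?c (r * (- n))) = (\<Sum>n=0..<Q. ?D n * ?c (r * n))"
    by (rule sum_period_reflect[OF Q, where h = "\<lambda>n. ?D n * ?c (r * n)"])
      (simp only: per logsin_diff2_period[OF Q])
  hence refl: "(\<Sum>n=0..<Q. ?D n * ?c (- (r * n))) = (\<Sum>n=0..<Q. ?D n * ?c (r * n))"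
    by (simp add: logsin_diff2_minus)
  have zero: "(\<Sum>n=0..<Q. ?D n) = 0"
    using sum_logsin_diff2[OF Q] by (metis of_real_0 of_real_sum)
  \<comment> \<open>average over \<open>n\<close> and \<open>- n\<close>, and subtract the vanishing sum of the second differences\<close>
  have "2 * (\<Sum>n=0..<Q. ?D n * ?c (r * n))
      = (\<Sum>n=0..<Q. ?D n * ?c (r * n)) + (\<Sum>n=0..<Q. ?D n * ?c (- (r * n))) - 2 * (\<Sum>n=0..<Q. ?D n)"
    unfolding refl zero by simp
  also have "\<dots> = (\<Sum>n=0..<Q. ?D n * (?c (r * n) + ?c (- (r * n)) - 2))"
    by (simp add: sum.distrib sum_subtractf sum_distrib_left algebra_simps)
  also have "\<dots> = - (\<Sum>n=0..<Q. ?D n * ?s n)"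
    unfolding char_mod_plus_inverse by (simp add: sum_negf)
  finally have "of_real (4 * (sin (pi * (of_int r / of_int Q)))\<^sup>2) * logsin_fourier Q r
      = (\<Sum>n=0..<Q. ?D n * ?s n) / 2"
    unfolding main by simp
  moreover have "(\<Sum>n=0..<Q. ?D n * ?s n)
      = 2 * of_real (\<Sum>n=0..<Q. logsin_diff2 Q n * (2 * (sin (pi * (of_int (r * n) / of_int Q)))\<^sup>2))"
    unfolding of_real_sum sum_distrib_left
    by (intro sum.cong refl) (simp only: of_real_mult of_real_numeral, simp add: mult_ac)
  ultimately show ?thesis by (simp only: mult.commute) simp
qed

text \<open>The bound for the second differences and the Fejer sum give \<open>r (Q - r) /
  (Q sin (\<pi> r / Q))\<^sup>2\<close> up to a constant, and \<open>sin (\<pi> r /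
  Q)\<close> is comparable to \<open>min r (Q - r) / Q\<close>. The order \<open>Q /
  r\<close> agrees with the Fourier series \<open>ln \<bar>2 sin (\<pi> x)\<bar> = - \<Sum>
  cos (2 \<pi> r x) / r\<close>.\<close>

lemma logsin_fourier_bound:
  assumes Q: "Q \<ge> 4" and r: "1 \<le> r" "r < Q"
  shows "cmod (logsin_fourier Q r) \<le> 4 * of_int Q / of_int (min r (Q - r))"
proof -
  define S where "S = (sin (pi * (of_int r / of_int Q)))\<^sup>2"
  define \<mu> where "\<mu> = real_of_int (min r (Q - r))"
  have Q0: "Q > 0" using Q by simp
  have mu: "\<mu> \<ge> 1" using r by (simp add: \<mu>_def)
  have set: "{0..<Q} = insert 0 {1..<Q}" using Q by auto
  have "2 * (\<mu> / of_int Q) \<le> \<bar>sin (pi * (of_int r / of_int Q))\<bar>"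
    using nint_dist_le_sin[of "of_int r / of_int Q"] nint_dist_fraction_min[of r Q] r
    unfolding \<mu>_def by linarith
  hence "(2 * (\<mu> / of_int Q))\<^sup>2 \<le> \<bar>sin (pi * (of_int r / of_int Q))\<bar>\<^sup>2"
    using mu Q by (intro power_mono) auto
  hence S: "4 * \<mu>\<^sup>2 / (of_int Q)\<^sup>2 \<le> S" by (simp add: S_def power_mult_distrib power_divide)
  have S0: "S > 0" using S mu Q by (smt (verit) divide_pos_pos of_int_0_less_iff zero_less_power)
  have sinb: "(sin (pi / of_int Q))\<^sup>2 \<le> 10 / (of_int Q)\<^sup>2"
  proof -
    have "0 \<le> sin (pi / of_int Q)" using Q by (intro sin_ge_zero) (auto simp: field_simps)
    moreover have "sin (pi / of_int Q) \<le> pi / of_int Q" using Q by (intro sin_x_le_x) auto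
    ultimately have "(sin (pi / of_int Q))\<^sup>2 \<le> (pi / of_int Q)\<^sup>2" by (intro power_mono)
    also have "\<dots> = pi\<^sup>2 / (of_int Q)\<^sup>2" by (simp add: power_divide)
    finally show ?thesis using pi_squared_le_10 by (simp add: divide_right_mono order_trans)
  qed
  have "cmod (logsin_fourier Q r) * (4 * S)
      = \<bar>\<Sum>n=0..<Q. logsin_diff2 Q n * (2 * (sin (pi * (of_int (r * n) / of_int Q)))\<^sup>2)\<bar>"
    using arg_cong[OF logsin_fourier_diff2[OF Q0, of r], of cmod] S0
    unfolding norm_mult norm_of_real S_def by simp
  also have "\<dots> = \<bar>\<Sum>n=1..<Q. logsin_diff2 Q n * (2 * (sin (pi * (of_int (r * n) / of_int Q)))\<^sup>2)\<bar>"
    unfolding set by simp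
  also have "\<dots> \<le> (\<Sum>n=1..<Q. \<bar>logsin_diff2 Q n * (2 * (sin (pi * (of_int (r * n) / of_int Q)))\<^sup>2)\<bar>)"
    by (rule sum_abs)
  also have "\<dots> \<le> (\<Sum>n=1..<Q. 6 * (sin (pi / of_int Q))\<^sup>2 *
      ((sin (pi * (of_int (r * n) / of_int Q)))\<^sup>2 / (sin (pi * (of_int n / of_int Q)))\<^sup>2))"
  proof (rule sum_mono)
    fix n assume "n \<in> {1..<Q}"
    hence "\<not> Q dvd n" using zdvd_not_zless by auto
    hence "\<bar>logsin_diff2 Q n\<bar> * (2 * (sin (pi * (of_int (r * n) / of_int Q)))\<^sup>2)
      \<le> (3 * (sin (pi / of_int Q))\<^sup>2 / (sin (pi * (of_int n / of_int Q)))\<^sup>2)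
         * (2 * (sin (pi * (of_int (r * n) / of_int Q)))\<^sup>2)"
      using logsin_diff2_bound[OF Q] by (intro mult_right_mono) auto
    thus "\<bar>logsin_diff2 Q n * (2 * (sin (pi * (of_int (r * n) / of_int Q)))\<^sup>2)\<bar>
      \<le> 6 * (sin (pi / of_int Q))\<^sup>2 *
      ((sin (pi * (of_int (r * n) / of_int Q)))\<^sup>2 / (sin (pi * (of_int n / of_int Q)))\<^sup>2)"
      by (simp add: abs_mult mult_ac)
  qed
  also have "\<dots> = 6 * (sin (pi / of_int Q))\<^sup>2 * of_int (r * (Q - r))"
  proof -
    have "0 \<le> r" "r \<le> Q" using r by auto
    thus ?thesis by (simp only: sum_distrib_left[symmetric] fejer_sum[OF Q0])
  qed
  also have "\<dots> \<le> 6 * (10 / (of_int Q)\<^sup>2) * (\<mu> * of_int Q)"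
  proof (intro mult_mono order_refl)
    have "r * (Q - r) \<le> min r (Q - r) * Q"
    proof (cases "r \<le> Q - r")
      case True thus ?thesis using r by (simp add: mult_left_mono)
    next
      case False thus ?thesis using r by (simp add: mult.commute mult_left_mono)
    qed
    hence "real_of_int (r * (Q - r)) \<le> real_of_int (min r (Q - r) * Q)" by linarith
    thus "real_of_int (r * (Q - r)) \<le> \<mu> * of_int Q" by (simp add: \<mu>_def)
  qed (use sinb r in auto)
  also have "\<dots> = 60 * \<mu> / of_int Q" using Q by (simp add: power2_eq_square)
  finally have "cmod (logsin_fourier Q r) * (4 * S) \<le> 60 * \<mu> / of_int Q" .
  moreover have "cmod (logsin_fourier Q r) * (4 * (4 * \<mu>\<^sup>2 / (of_int Q)\<^sup>2)) \<le> cmod (logsin_fourier Q r) * (4 * S)"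
    using S by (intro mult_left_mono) auto
  ultimately have "cmod (logsin_fourier Q r) * (16 * \<mu>\<^sup>2 / (of_int Q)\<^sup>2) \<le> 60 * \<mu> / of_int Q" by simp
  hence "cmod (logsin_fourier Q r) * (16 * \<mu>) * \<mu> \<le> (60 * of_int Q) * \<mu>"
    using Q by (simp add: field_simps power2_eq_square)
  hence "cmod (logsin_fourier Q r) * (16 * \<mu>) \<le> 60 * of_int Q" using mu by simp
  hence "16 * (cmod (logsin_fourier Q r) * \<mu>) \<le> 60 * of_int Q" by (simp only: mult_ac)
  moreover have "real_of_int Q \<ge> 4" using Q by simp
  ultimately have "cmod (logsin_fourier Q r) * \<mu> \<le> 4 * of_int Q" by linarith
  thus ?thesis using mu by (simp add: \<mu>_def[symmetric] pos_le_divide_eq)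
qed

section \<open>Variance of the logarithmic Sudler product at a rational number\<close>

text \<open>For \<open>0 \<le> N < Q\<close> and \<open>p\<close> prime to \<open>Q\<close>
  this is the logarithm of the Sudler product \<open>P\<^sub>N(p / Q)\<close>.\<close>

definition logsin_sum :: "int \<Rightarrow> int \<Rightarrow> int \<Rightarrow> real" where
  "logsin_sum Q p N = (\<Sum>n=1..N. logsin_mod Q (p * n))"

lemma sum_logsin_dilate:
  assumes Q: "Q > 0" and p: "coprime p Q"
  shows "(\<Sum>n=1..<Q. logsin_mod Q (p * n)) = ln (of_int Q)"
proof -
  have set: "{0..<Q} = insert 0 {1..<Q}" using Q by auto
  have "(\<Sum>n=0..<Q. logsin_mod Q (p * n)) = 0"
    using sum_period_dilate[of Q "logsin_mod Q" p] logsin_mod_period[OF Q] sum_logsin_mod[OF Q] Q p by simp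
  thus ?thesis unfolding set by (simp add: logsin_mod_def)
qed

text \<open>The partial sums, extended periodically, satisfy the difference equation also
  across the end of a period. This is the role of the value \<open>- ln Q\<close> at the
  residue 0.\<close>

lemma logsin_sum_step:
  assumes "Q > 0" "coprime p Q"
  shows "logsin_sum Q p (N mod Q) - logsin_sum Q p ((N - 1) mod Q) = logsin_mod Q (p * N)"
proof (cases "Q dvd N")
  case True
  hence "N mod Q = 0" by simp
  moreover have "(N - 1) mod Q = Q - 1"
    using True assms by (metis mod_0_imp_dvd dvd_imp_mod_0 mod_diff_left_eq diff_0 zmod_minus1)
  moreover have "{1..Q-1} = {1..<Q}" by auto
  ultimately show ?thesis
    using sum_logsin_dilate[OF assms] True by (simp add: logsin_sum_def logsin_mod_def)
next
  case False
  define m where "m = N mod Q"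
  have m: "1 \<le> m" "m < Q" using False assms by (auto simp: m_def dvd_eq_mod_eq_0 order.not_eq_order_implies_strict intro!: zle_diff1_eq[THEN iffD1])
     (metis int_one_le_iff_zero_less le_neq_trans pos_mod_sign)
  have "(N - 1) mod Q = (m - 1) mod Q" by (simp add: m_def mod_diff_left_eq)
  hence "(N - 1) mod Q = m - 1" using m by simp
  moreover have "{1..m} = insert m {1..m-1}" using m by auto
  moreover have "logsin_mod Q (p * m) = logsin_mod Q (p * N)"
    using logsin_mod_period[of Q] assms unfolding m_def by (metis mod_mult_right_eq)
  ultimately show ?thesis by (simp add: logsin_sum_def m_def)
qed

text \<open>The symmetry \<open>P\<^sub>N P\<^bsub>Q-1-N\<^esub> = Q\<close> of Sudler
  products at rational numbers with denominator \<open>Q\<close>. It shows that the mean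
  over a period is \<open>ln Q / 2\<close>.\<close>

lemma logsin_sum_reflect:
  assumes Q: "Q > 0" "coprime p Q" and N: "0 \<le> N" "N < Q"
  shows "logsin_sum Q p N + logsin_sum Q p (Q - 1 - N) = ln (of_int Q)"
proof -
  have "logsin_sum Q p (Q - 1 - N) = (\<Sum>n=N+1..<Q. logsin_mod Q (p * n))"
    unfolding logsin_sum_def
  proof (rule sum.reindex_bij_witness[where i = "\<lambda>n. Q - n" and j = "\<lambda>n. Q - n"])
    fix n assume "n \<in> {1..Q - 1 - N}"
    have "p * (Q - n) = - (p * n) + p * Q" by (simp add: algebra_simps)
    hence "(p * (Q - n)) mod Q = (- (p * n)) mod Q" by (simp add: mod_eq_dvd_iff)
    thus "logsin_mod Q (p * (Q - n)) = logsin_mod Q (p * n)"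
      using logsin_mod_period[OF Q(1)] logsin_mod_minus by metis
  qed auto
  moreover have "{1..<Q} = {1..N} \<union> {N+1..<Q}" using N by auto
  moreover have "(\<Sum>n\<in>{1..N} \<union> {N+1..<Q}. logsin_mod Q (p * n))
      = logsin_sum Q p N + (\<Sum>n=N+1..<Q. logsin_mod Q (p * n))"
    unfolding logsin_sum_def by (intro sum.union_disjoint) auto
  ultimately show ?thesis using sum_logsin_dilate[OF Q] by simp
qed

text \<open>Let \<open>G\<close> be the centred and periodically extended partial sum. Its
  difference equation says that the Fourier coefficient of \<open>G\<close> at \<open>p
  r\<close>, multiplied by \<open>1 - \<chi>(p r)\<close>, is the coefficient at
  \<open>r\<close> of the logarithmic sine. The coefficient of \<open>G\<close> at 0
  vanishes by the reflection symmetry. Now apply Parseval's identity, with the frequencies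
  enumerated as \<open>p r\<close>.\<close>

theorem logsin_sum_variance:
  fixes Q p :: int
  assumes Q: "Q \<ge> 4" and p: "coprime p Q"
  shows "(\<Sum>N=0..<Q. (logsin_sum Q p N - ln (of_int Q) / 2)\<^sup>2)
    \<le> 8 * of_int Q * (\<Sum>r=1..<Q. 1 / ((of_int r)\<^sup>2 * (sin (pi * (of_int (p * r) / of_int Q)))\<^sup>2))"
proof -
  have Q0: "Q > 0" using Q by simp
  have set: "{0..<Q} = insert 0 {1..<Q}" using Q by auto
  define G where "G N = logsin_sum Q p (N mod Q) - ln (of_int Q) / 2" for N
  define F where "F m = (\<Sum>N=0..<Q. of_real (G N) * char_mod Q (m * N))" for m
  have G_per: "G (N mod Q) = G N" for N by (simp add: G_def)
  have G_shift: "G (n mod Q + k) = G (n + k)" for n k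
    using G_per by (metis mod_add_left_eq)
  have "(\<Sum>N=0..<Q. G (- 1 - N)) = (\<Sum>N=0..<Q. G N)"
  proof -
    have "(\<Sum>N=0..<Q. G (- N + - 1)) = (\<Sum>N=0..<Q. G (N + - 1))"
      by (rule sum_period_reflect[OF Q0, of "\<lambda>N. G (N + - 1)"]) (rule G_shift)
    also have "\<dots> = (\<Sum>N=0..<Q. G N)" by (rule sum_period_shift[where h = G, OF Q0 G_per])
    finally have "(\<Sum>N=0..<Q. G (- N + - 1)) = (\<Sum>N=0..<Q. G N)" .
    moreover have "- 1 - N = - N + - 1" for N :: int by simp
    ultimately show ?thesis by (simp only:)
  qed
  moreover have "G (- 1 - N) = - G N" if "N \<in> {0..<Q}" for N
  proof -
    have "(- 1 - N) mod Q = (Q - 1 - N) mod Q" by (simp add: mod_eq_dvd_iff)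
    hence "(- 1 - N) mod Q = Q - 1 - N" using that by simp
    thus ?thesis using logsin_sum_reflect[OF Q0 p, of N] that by (simp add: G_def)
  qed
  ultimately have "(\<Sum>N=0..<Q. G N) = 0" by (simp add: sum_negf)
  hence F0: "F 0 = 0" by (simp add: F_def flip: of_real_sum)
  \<comment> \<open>transform of the difference equation satisfied by \<open>G\<close>\<close>
  have F_eq: "F m * (1 - char_mod Q m) = (\<Sum>N=0..<Q. of_real (logsin_mod Q (p * N)) * char_mod Q (m * N))" for m
  proof -
    have "(\<Sum>N=0..<Q. of_real (G (N + - 1)) * char_mod Q (m * N))
        = (\<Sum>N=0..<Q. of_real (G (N + 1 + - 1)) * char_mod Q (m * (N + 1)))"
      by (rule sum_period_shift[OF Q0, where h = "\<lambda>N. of_real (G (N + - 1)) * char_mod Q (m * N)", symmetric])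
        (simp only: G_shift char_mod_period[OF Q0])
    also have "\<dots> = F m * char_mod Q m"
      unfolding F_def sum_distrib_right
      by (intro sum.cong refl) (simp add: distrib_left char_mod_add)
    finally have "F m * (1 - char_mod Q m) = (\<Sum>N=0..<Q. of_real (G N - G (N - 1)) * char_mod Q (m * N))"
      by (simp add: F_def sum_subtractf algebra_simps)
    moreover have "G N - G (N - 1) = logsin_mod Q (p * N)" for N
      using logsin_sum_step[OF Q0 p, of N] by (simp add: G_def)
    ultimately show ?thesis by (simp only:)
  qed
  have F_pr: "F (p * r) * (1 - char_mod Q (p * r)) = logsin_fourier Q r" for r
  proof -
    have "F (p * r) * (1 - char_mod Q (p * r))
        = (\<Sum>N=0..<Q. of_real (logsin_mod Q (p * N)) * char_mod Q (r * (p * N)))"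
      unfolding F_eq by (simp add: mult_ac)
    also have "\<dots> = logsin_fourier Q r" unfolding logsin_fourier_def
      by (rule sum_period_dilate[OF Q0 _ p, where h = "\<lambda>n. of_real (logsin_mod Q n) * char_mod Q (r * n)"])
        (simp only: logsin_mod_period[OF Q0] char_mod_period[OF Q0])
    finally show ?thesis .
  qed
  define H where "H r = 1 / ((of_int r)\<^sup>2 * (sin (pi * (of_int (p * r) / of_int Q)))\<^sup>2)" for r
  have F_bound: "(cmod (F (p * r)))\<^sup>2 \<le> 4 * (of_int Q)\<^sup>2 * (H r + H (Q - r))" if "r \<in> {1..<Q}" for r
  proof -
    have "\<not> Q dvd r" using that zdvd_not_zless by auto
    hence "\<not> Q dvd p * r" using p by (simp add: coprime_commute coprime_dvd_mult_right_iff)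
    hence nz: "sin (pi * (of_int (p * r) / of_int Q)) \<noteq> 0" using sin_frac_eq_0_iff[OF Q0] by blast
    define s where "s = (sin (pi * (of_int (p * r) / of_int Q)))\<^sup>2"
    have s: "s > 0" using nz by (simp add: s_def)
    have s': "(sin (pi * (of_int (p * (Q - r)) / of_int Q)))\<^sup>2 = s"
    proof -
      have "pi * (of_int (p * (Q - r)) / of_int Q) = - (pi * (of_int (p * r) / of_int Q)) + of_int p * pi"
        using Q by (simp add: field_simps)
      thus ?thesis
        using sin_times_pi_eq_0[of "of_int p"] sin_cos_squared_add[of "of_int p * pi"]
        by (simp add: sin_diff power_mult_distrib s_def)
    qed
    define \<mu> where "\<mu> = real_of_int (min r (Q - r))"
    have mu: "\<mu> > 0" using that by (simp add: \<mu>_def)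
    have "(cmod (F (p * r)))\<^sup>2 * (4 * s) = (cmod (logsin_fourier Q r))\<^sup>2"
      using F_pr[of r] one_minus_char_mod[of Q "p * r"]
      by (metis norm_mult power_mult_distrib power2_abs s_def mult.assoc four_x_squared power2_eq_square mult_2 numeral_Bit0 numeral_times_numeral semiring_norm(11) semiring_norm(13))
    also have "\<dots> \<le> (4 * of_int Q / \<mu>)\<^sup>2"
      using logsin_fourier_bound[OF Q, of r] that by (intro power_mono) (auto simp: \<mu>_def)
    also have "\<dots> = 16 * (of_int Q)\<^sup>2 * (1 / \<mu>\<^sup>2)" by (simp add: power_divide power_mult_distrib)
    also have "\<dots> \<le> 16 * (of_int Q)\<^sup>2 * (1 / (of_int r)\<^sup>2 + 1 / (of_int (Q - r))\<^sup>2)"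
      by (intro mult_left_mono) (auto simp: \<mu>_def min_def)
    finally have "(cmod (F (p * r)))\<^sup>2 \<le> 16 * (of_int Q)\<^sup>2 * (1 / (of_int r)\<^sup>2 + 1 / (of_int (Q - r))\<^sup>2) / (4 * s)"
      using s by (simp add: pos_le_divide_eq mult_ac)
    also have "\<dots> = 4 * (of_int Q)\<^sup>2 * (H r + H (Q - r))"
      unfolding H_def s' unfolding s_def[symmetric] using s by (simp add: add_divide_distrib distrib_left mult.commute)
    finally show ?thesis .
  qed
  have "of_int Q * (\<Sum>N=0..<Q. (logsin_sum Q p N - ln (of_int Q) / 2)\<^sup>2) = of_int Q * (\<Sum>N=0..<Q. (G N)\<^sup>2)"
    by (simp add: G_def)
  also have "\<dots> = (\<Sum>m=0..<Q. (cmod (F m))\<^sup>2)"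
    using parseval_mod[OF Q0, of G] by (simp add: F_def)
  also have "\<dots> = (\<Sum>r=0..<Q. (cmod (F (p * r)))\<^sup>2)"
  proof (rule sum_period_dilate[OF Q0 _ p, symmetric])
    fix n show "(cmod (F (n mod Q)))\<^sup>2 = (cmod (F n))\<^sup>2"
      using char_mod_period[OF Q0] by (simp add: F_def mult.commute)
  qed
  also have "\<dots> = (\<Sum>r=1..<Q. (cmod (F (p * r)))\<^sup>2)" unfolding set using F0 by simp
  also have "\<dots> \<le> (\<Sum>r=1..<Q. 4 * (of_int Q)\<^sup>2 * (H r + H (Q - r)))"
    by (rule sum_mono) (rule F_bound)
  also have "\<dots> = 4 * (of_int Q)\<^sup>2 * ((\<Sum>r=1..<Q. H r) + (\<Sum>r=1..<Q. H (Q - r)))"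
    by (simp add: sum_distrib_left[symmetric] sum.distrib[symmetric])
  also have "(\<Sum>r=1..<Q. H (Q - r)) = (\<Sum>r=1..<Q. H r)"
    by (rule sum.reindex_bij_witness[where i = "\<lambda>n. Q - n" and j = "\<lambda>n. Q - n"]) auto
  finally have "of_int Q * (\<Sum>N=0..<Q. (logsin_sum Q p N - ln (of_int Q) / 2)\<^sup>2)
      \<le> of_int Q * (8 * of_int Q * (\<Sum>r=1..<Q. H r))"
    by (simp add: power2_eq_square mult_ac)
  thus ?thesis using Q0 by (simp add: H_def)
qed

section \<open>Pade approximants of e\<close>

text \<open>Every third convergent of the continued fraction \<open>e = [2; 1, 2, 1, 1, 4,
  1, 1, 6, \<dots>]\<close>, starting with \<open>3 / 1\<close> at index 1. Skipping the
  other convergents makes the denominators grow by a factor of at least 6 from index 1 on.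
  The fraction of index 0 is \<open>1 / 1\<close>.\<close>

fun pade_den :: "nat \<Rightarrow> int" where
  "pade_den 0 = 1"
| "pade_den (Suc 0) = 1"
| "pade_den (Suc (Suc n)) = (4 * int n + 6) * pade_den (Suc n) + pade_den n"

fun pade_num :: "nat \<Rightarrow> int" where
  "pade_num 0 = 1"
| "pade_num (Suc 0) = 3"
| "pade_num (Suc (Suc n)) = (4 * int n + 6) * pade_num (Suc n) + pade_num n"

text \<open>Terms of a positive series for \<open>\<bar>q\<^sub>n e -
  p\<^sub>n\<bar>\<close>. It arises from the integral \<open>(1 / n!) \<integral> x\<^sup>n
  (1 - x)\<^sup>n e\<^sup>x dx\<close> over \<open>[0, 1]\<close> by expanding the
  exponential.\<close>

definition pade_term :: "nat \<Rightarrow> nat \<Rightarrow> real" where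
  "pade_term n k = fact (n + k) / (fact k * fact (2 * n + k + 1))"

text \<open>The recurrence of the denominators holds coefficientwise. The shift by two
  reflects that for \<open>e\<^sup>z\<close> the last term of the recurrence carries a
  factor \<open>z\<^sup>2\<close>. The two equations after this one are its instances where
  the shifted term is absent.\<close>

lemma pade_term_rec:
  "pade_term n (k + 2) = (4 * real n + 6) * pade_term (Suc n) (k + 2) + pade_term (Suc (Suc n)) k"
proof -
  define A where "A = (fact (n + k + 2) :: real)"
  define B where "B = (fact k :: real)"
  define C where "C = (fact (2 * n + k + 3) :: real)"
  have nz: "B \<noteq> 0" "C \<noteq> 0" by (simp_all add: B_def C_def)
  have *: "fact (k + 2) = (real k + 2) * (real k + 1) * B"
    "fact (2 * n + k + 5) = (2 * real n + real k + 5) * (2 * real n + real k + 4) * C"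
    "fact (n + k + 3) = (real n + real k + 3) * A"
    by (simp_all add: A_def B_def C_def numeral_eq_Suc algebra_simps)
  have "pade_term n (k + 2) = A / ((real k + 2) * (real k + 1) * B * C)"
    using * by (simp add: pade_term_def A_def C_def numeral_eq_Suc)
  moreover have "pade_term (Suc n) (k + 2) = (real n + real k + 3) * A /
     ((real k + 2) * (real k + 1) * B * ((2 * real n + real k + 5) * (2 * real n + real k + 4) * C))"
  proof -
    have "Suc n + (k + 2) = n + k + 3" "2 * Suc n + (k + 2) + 1 = 2 * n + k + 5" by simp_all
    thus ?thesis unfolding pade_term_def using * by metis
  qed
  moreover have "pade_term (Suc (Suc n)) k = A / (B * ((2 * real n + real k + 5) * (2 * real n + real k + 4) * C))"
  proof -
    have "Suc (Suc n) + k = n + k + 2" "2 * Suc (Suc n) + k + 1 = 2 * n + k + 5" by simp_all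
    thus ?thesis unfolding pade_term_def using * A_def B_def by metis
  qed
  moreover have "A / (p * B * C) = w' * (w * A / (p * B * (q * C))) + A / (B * (q * C))"
    if "q = w' * w + p" "p \<noteq> 0" "q \<noteq> 0" for p q w w'
  proof -
    have "w' * (w * A / (p * B * (q * C))) + A / (B * (q * C)) = A * (w' * w + p) / (p * B * C * q)"
      using that nz by (simp add: divide_simps) (simp add: algebra_simps)
    thus ?thesis using that by simp
  qed
  moreover have "(2 * real n + real k + 5) * (2 * real n + real k + 4)
      = (4 * real n + 6) * (real n + real k + 3) + (real k + 2) * (real k + 1)"
    by (simp add: algebra_simps)
  moreover have "(real k + 2) * (real k + 1) \<noteq> 0" "(2 * real n + real k + 5) * (2 * real n + real k + 4) \<noteq> 0"
    by (simp_all add: add_eq_0_iff)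
  ultimately show ?thesis by metis
qed

lemma pade_term_rec_0: "pade_term n 0 = (4 * real n + 6) * pade_term (Suc n) 0"
  by (simp add: pade_term_def divide_simps) (simp add: algebra_simps)

lemma pade_term_rec_1: "pade_term n 1 = (4 * real n + 6) * pade_term (Suc n) 1"
  by (simp add: pade_term_def divide_simps) (simp add: algebra_simps)

lemma exp_tail_sums: "(\<lambda>k. 1 / fact (k + m)) sums (exp 1 - (\<Sum>k<m. 1 / fact k) :: real)"
proof -
  have "(\<lambda>k. 1 / fact k) sums (exp 1 :: real)"
    using exp_converges[of "1::real"] by (simp add: scaleR_conv_of_real divide_inverse)
  thus ?thesis by (subst sums_iff_shift) simp
qed

lemma pade_term_sums:
  "pade_term n sums ((-1) ^ n * (of_int (pade_den n) * exp 1 - of_int (pade_num n)))"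
proof (induction n rule: pade_den.induct)
  case 1
  have "pade_term 0 = (\<lambda>k. 1 / fact (k + 1))" by (simp add: pade_term_def fun_eq_iff)
  thus ?case using exp_tail_sums[of 1] by simp
next
  case 2
  have "pade_term (Suc 0) k = 1 / fact (k + 2) - 2 * (1 / fact (k + 3))" for k
  proof -
    define F where "F = (fact (k + 2) :: real)"
    have F: "F \<noteq> 0" by (simp add: F_def)
    have F3: "fact (k + 3) = (real k + 3) * F" by (simp add: F_def numeral_eq_Suc)
    have "pade_term (Suc 0) k = (real k + 1) / ((real k + 3) * F)"
    proof -
      have "2 * Suc 0 + k + 1 = k + 3" "fact (Suc 0 + k) = (real k + 1) * fact k" by simp_all
      hence "pade_term (Suc 0) k = ((real k + 1) * fact k) / (fact k * ((real k + 3) * F))"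
        unfolding pade_term_def using F3 by metis
      thus ?thesis by simp
    qed
    also have "\<dots> = 1 / F - 2 * (1 / ((real k + 3) * F))"
    proof -
      have "1 / F - 2 * (1 / (x * F)) = (x - 2) / (x * F)" if "x \<noteq> 0" for x
        using that F by (simp add: diff_divide_distrib)
      from this[of "real k + 3"] show ?thesis by (simp add: add.commute)
    qed
    finally show ?thesis by (simp only: F3 F_def)
  qed
  moreover have "(\<lambda>k. 1 / fact (k + 2) - 2 * (1 / fact (k + 3))) sums
     ((exp 1 - (\<Sum>k<2. 1 / fact k)) - 2 * (exp 1 - (\<Sum>k<3. 1 / fact k)) :: real)"
    by (intro sums_diff sums_mult exp_tail_sums)
  moreover have "((exp 1 - (\<Sum>k<2. 1 / fact k)) - 2 * (exp 1 - (\<Sum>k<3. 1 / fact k)) :: real) = 3 - exp 1"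
    by (simp add: numeral_eq_Suc)
  ultimately show ?case by (simp add: fun_eq_iff[symmetric])
next
  case (3 n)
  \<comment> \<open>the recurrence holds termwise after a shift by two, and the two leading terms cancel\<close>
  define f where "f k = pade_term n k - (4 * real n + 6) * pade_term (Suc n) k" for k
  have "f sums ((-1) ^ n * (of_int (pade_den n) * exp 1 - of_int (pade_num n))
      - (4 * real n + 6) * ((-1) ^ Suc n * (of_int (pade_den (Suc n)) * exp 1 - of_int (pade_num (Suc n)))))"
    (is "_ sums ?S")
    unfolding f_def by (intro sums_diff sums_mult 3)
  hence "(\<lambda>k. f (k + 2)) sums (?S - (\<Sum>k<2. f k))" by (subst sums_iff_shift) simp
  moreover have "f (k + 2) = pade_term (Suc (Suc n)) k" for k
    using pade_term_rec[of n k] by (simp add: f_def)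
  moreover have "(\<Sum>k<2. f k) = 0"
    using pade_term_rec_0[of n] pade_term_rec_1[of n] by (simp add: f_def numeral_eq_Suc)
  moreover have "?S = (-1) ^ Suc (Suc n) * (of_int (pade_den (Suc (Suc n))) * exp 1 - of_int (pade_num (Suc (Suc n))))"
    by (simp add: algebra_simps)
  ultimately show ?case by simp
qed

text \<open>The errors alternate in sign. With the determinant identity this alone
  determines their size.\<close>

lemma pade_error_pos: "0 < (-1) ^ n * (of_int (pade_den n) * exp 1 - of_int (pade_num n) :: real)"
proof -
  have "0 < suminf (pade_term n)"
    using pade_term_sums[of n] by (intro suminf_pos) (auto simp: sums_iff pade_term_def)
  thus ?thesis using pade_term_sums[of n] by (simp add: sums_iff)
qed

lemma pade_det:
  "pade_den n * pade_num (Suc n) - pade_den (Suc n) * pade_num n = (-1) ^ n * 2"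
  by (induction n) (simp_all add: algebra_simps)

lemma pade_den_pos: "pade_den n \<ge> 1"
proof (induction n rule: pade_den.induct)
  case (3 n)
  have "0 \<le> (4 * int n + 6) * pade_den (Suc n)" using 3 by simp
  thus ?case unfolding pade_den.simps using 3 by linarith
qed simp_all

lemma pade_den_ge: "n \<ge> 1 \<Longrightarrow> (4 * int n + 2) * pade_den n \<le> pade_den (Suc n)"
  using pade_den_pos[of "n - 1"] by (cases n) (auto simp: algebra_simps)

lemma pade_den_mono_Suc: "pade_den n \<le> pade_den (Suc n)"
proof (cases n)
  case (Suc m)
  have "1 * pade_den n \<le> (4 * int n + 2) * pade_den n"
    using pade_den_pos[of n] by (intro mult_right_mono) auto
  also have "\<dots> \<le> pade_den (Suc n)" using Suc by (intro pade_den_ge) auto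
  finally show ?thesis by simp
qed simp

lemma pade_den_mono: "m \<le> n \<Longrightarrow> pade_den m \<le> pade_den n"
  by (rule lift_Suc_mono_le[of pade_den]) (rule pade_den_mono_Suc)

lemma pade_den_le: "pade_den (Suc n) \<le> (4 * int n + 3) * pade_den n"
proof (cases n)
  case (Suc m)
  thus ?thesis using pade_den_mono_Suc[of m] by (simp add: algebra_simps)
qed simp

lemma pade_den_ge_6: "n \<ge> 1 \<Longrightarrow> 6 * pade_den n \<le> pade_den (Suc n)"
proof -
  assume n: "n \<ge> 1"
  have "6 * pade_den n \<le> (4 * int n + 2) * pade_den n"
    using pade_den_pos[of n] n by (intro mult_right_mono) auto
  with pade_den_ge[OF n] show ?thesis by simp
qed

text \<open>The determinant \<open>2\<close> is a sum of two positive quantities, one of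
  which is \<open>q\<^sub>n\<^sub>+\<^sub>1 \<bar>q\<^sub>n e -
  p\<^sub>n\<bar>\<close>.\<close>

lemma pade_error_less: "\<bar>of_int (pade_den n) * exp 1 - of_int (pade_num n)\<bar> < 2 / real_of_int (pade_den (Suc n))"
proof -
  define u where "u n = (-1) ^ n * (of_int (pade_den n) * exp 1 - of_int (pade_num n) :: real)" for n
  have u: "u n > 0" for n unfolding u_def by (rule pade_error_pos)
  have "of_int (pade_den n) * u (Suc n) + of_int (pade_den (Suc n)) * u n
      = (-1) ^ n * of_int (pade_den n * pade_num (Suc n) - pade_den (Suc n) * pade_num n)"
    by (simp add: u_def algebra_simps)
  also have "\<dots> = 2" unfolding pade_det by (simp flip: power_mult_distrib)
  finally have "of_int (pade_den n) * u (Suc n) + of_int (pade_den (Suc n)) * u n = 2" .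
  moreover have "of_int (pade_den n) * u (Suc n) > 0" using u pade_den_pos[of n] by simp
  ultimately have "of_int (pade_den (Suc n)) * u n < 2" by linarith
  moreover have "\<bar>of_int (pade_den n) * exp 1 - of_int (pade_num n)\<bar> = u n"
    using u[of n] unfolding u_def by (cases "even n") auto
  ultimately show ?thesis using pade_den_pos[of "Suc n"] by (simp add: field_simps)
qed

lemma odd_pade_den: "odd (pade_den n)"
  by (induction n rule: pade_den.induct) simp_all

text \<open>A common divisor divides the determinant \<open>2\<close> up to sign, and the
  denominators are odd.\<close>

lemma coprime_pade: "coprime (pade_num n) (pade_den n)"
proof (rule coprimeI)
  fix c assume c: "c dvd pade_num n" "c dvd pade_den n"
  hence "c dvd (-1) ^ n * 2" unfolding pade_det[symmetric] by simp
  hence "c dvd 2" by (cases "even n") auto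
  moreover have "coprime (pade_den n) 2" using odd_pade_den[of n] by simp
  ultimately show "is_unit c" using c(2) by (meson coprime_common_divisor)
qed

text \<open>The constant \<open>7/3\<close> leaves room for both \<open>e\<close>, where
  \<open>2\<close> is enough, and all later approximants, so that the same lower bounds
  apply to all of these numbers.\<close>

definition pade_close :: "real \<Rightarrow> nat \<Rightarrow> bool" where
  "pade_close \<beta> j \<longleftrightarrow>
     \<bar>\<beta> - of_int (pade_num j) / of_int (pade_den j)\<bar> \<le> 7 / (3 * of_int (pade_den j) * of_int (pade_den (Suc j)))"

lemma pade_error_le:
  "\<bar>exp 1 - of_int (pade_num j) / of_int (pade_den j)\<bar> \<le> 2 / (real_of_int (pade_den j) * of_int (pade_den (Suc j)))"
proof -
  have Q: "real_of_int (pade_den j) > 0" using pade_den_pos[of j] by simp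
  have "\<bar>exp 1 - of_int (pade_num j) / of_int (pade_den j)\<bar>
      = \<bar>of_int (pade_den j) * exp 1 - of_int (pade_num j)\<bar> / real_of_int (pade_den j)"
  proof -
    have "exp 1 - of_int (pade_num j) / of_int (pade_den j)
        = (of_int (pade_den j) * exp 1 - of_int (pade_num j)) / real_of_int (pade_den j)"
      using Q by (simp add: diff_divide_distrib)
    thus ?thesis using Q by simp
  qed
  also have "\<dots> \<le> (2 / of_int (pade_den (Suc j))) / of_int (pade_den j)"
    using pade_error_less[of j] Q by (intro divide_right_mono) auto
  finally show ?thesis by (simp add: mult.commute)
qed

lemma pade_close_exp: "pade_close (exp 1) j"
proof -
  have "0 < real_of_int (pade_den j)" "0 < real_of_int (pade_den (Suc j))"
    using pade_den_pos[of j] pade_den_pos[of "Suc j"] by linarith+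
  hence "0 < real_of_int (pade_den j) * of_int (pade_den (Suc j))" by (rule mult_pos_pos)
  hence "2 / (real_of_int (pade_den j) * of_int (pade_den (Suc j)))
     \<le> (7 / 3) / (real_of_int (pade_den j) * of_int (pade_den (Suc j)))"
    by (intro divide_right_mono) linarith+
  also have "\<dots> = 7 / (3 * (real_of_int (pade_den j) * of_int (pade_den (Suc j))))" by simp
  finally show ?thesis
    using pade_error_le[of j] unfolding pade_close_def mult.assoc by (rule order_trans[rotated])
qed

lemma pade_close_pade:
  assumes "1 \<le> j" "j \<le> k"
  shows "pade_close (of_int (pade_num k) / of_int (pade_den k)) j"
proof (cases "j = k")
  case True
  have "0 \<le> real_of_int (pade_den k)" "0 \<le> real_of_int (pade_den (Suc k))"
    using pade_den_pos[of k] pade_den_pos[of "Suc k"] by linarith+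
  thus ?thesis unfolding pade_close_def True by simp
next
  case False
  define D where "D i = real_of_int (pade_den i) * of_int (pade_den (Suc i))" for i
  have Dpos: "D i > 0" for i
    unfolding D_def using pade_den_pos[of i] pade_den_pos[of "Suc i"] by (intro mult_pos_pos) linarith+
  have "6 * pade_den j \<le> 6 * pade_den k" using assms pade_den_mono by simp
  also have "\<dots> \<le> pade_den (Suc k)" using assms by (intro pade_den_ge_6) auto
  finally have 1: "6 * real_of_int (pade_den j) \<le> of_int (pade_den (Suc k))" by linarith
  have 2: "real_of_int (pade_den (Suc j)) \<le> of_int (pade_den k)"
    using False assms pade_den_mono[of "Suc j" k] by simp
  have "6 * D j = (6 * real_of_int (pade_den j)) * of_int (pade_den (Suc j))" by (simp add: D_def)
  also have "\<dots> \<le> of_int (pade_den (Suc k)) * of_int (pade_den k)"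
    using 1 2 pade_den_pos[of "Suc j"] pade_den_pos[of j] pade_den_pos[of "Suc k"]
    by (intro mult_mono) linarith+
  finally have "6 * D j \<le> D k" by (simp add: D_def mult.commute)
  hence "2 / D k \<le> 2 / (6 * D j)"
    by (rule divide_left_mono) (use Dpos[of j] Dpos[of k] in \<open>simp_all add: mult_pos_pos\<close>)
  also have "2 / (6 * D j) = (1 / 3) / D j" by simp
  finally have "2 / D j + 2 / D k \<le> (2 + 1 / 3) / D j" unfolding add_divide_distrib by simp
  moreover have "\<bar>exp 1 - of_int (pade_num j) / of_int (pade_den j)\<bar> \<le> 2 / D j"
    unfolding D_def by (rule pade_error_le)
  moreover have "\<bar>exp 1 - of_int (pade_num k) / of_int (pade_den k)\<bar> \<le> 2 / D k"
    unfolding D_def by (rule pade_error_le)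
  ultimately have "\<bar>of_int (pade_num k) / of_int (pade_den k) - of_int (pade_num j) / of_int (pade_den j)\<bar>
     \<le> (2 + 1 / 3) / D j" by linarith
  also have "(2 + 1 / 3) / D j = 7 / (3 * D j)" by simp
  finally show ?thesis unfolding pade_close_def D_def mult.assoc .
qed

text \<open>Since \<open>q\<^sub>j\<^sub>+\<^sub>1 \<ge> 6 q\<^sub>j\<close>. The constant
  keeps the total displacement of a point in a block of length \<open>q\<^sub>j\<close>,
  which is at most \<open>1 / (2 q\<^sub>j) + 7 / (18 q\<^sub>j)\<close>, below the spacing
  \<open>1 / q\<^sub>j\<close>.\<close>

lemma pade_close_square:
  assumes "1 \<le> j" "pade_close \<beta> j"
  shows "\<bar>\<beta> - of_int (pade_num j) / of_int (pade_den j)\<bar> \<le> 7 / (18 * (real_of_int (pade_den j))\<^sup>2)"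
proof -
  have Q: "real_of_int (pade_den j) > 0" using pade_den_pos[of j] by simp
  have "6 * real_of_int (pade_den j) \<le> of_int (pade_den (Suc j))" using pade_den_ge_6[OF assms(1)] by linarith
  hence "3 * of_int (pade_den j) * (6 * real_of_int (pade_den j)) \<le> 3 * of_int (pade_den j) * of_int (pade_den (Suc j))"
    using Q by (intro mult_left_mono) auto
  hence "7 / (3 * of_int (pade_den j) * of_int (pade_den (Suc j))) \<le> 7 / (18 * (real_of_int (pade_den j))\<^sup>2)"
    using Q by (intro divide_left_mono) (auto simp: power2_eq_square intro!: mult_pos_pos dest: pade_den_pos[THEN order.trans])
  thus ?thesis using assms(2) by (simp add: pade_close_def)
qed

text \<open>The fraction \<open>m p\<^sub>j / q\<^sub>j\<close> is at least \<open>1 /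
  q\<^sub>j\<close> away from the integers, and replacing \<open>p\<^sub>j /
  q\<^sub>j\<close> by \<open>\<beta>\<close> moves it by less than half of this.\<close>

lemma nint_dist_pade_lower:
  assumes "1 \<le> j" "pade_close \<beta> j" "0 < m" "m < pade_den j"
  shows "1 / (2 * real_of_int (pade_den j)) \<le> nint_dist (of_int m * \<beta>)"
proof -
  define Q where "Q = real_of_int (pade_den j)"
  define Q' where "Q' = real_of_int (pade_den (Suc j))"
  have Q: "Q > 0" and Q': "6 * Q \<le> Q'"
    using pade_den_pos[of j] pade_den_ge_6[OF assms(1)] by (simp_all add: Q_def Q'_def)
  define \<delta> where "\<delta> = of_int m * (\<beta> - of_int (pade_num j) / Q)"
  have "\<not> pade_den j dvd m" using assms zdvd_not_zless by auto
  hence "\<not> pade_den j dvd m * pade_num j"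
    using coprime_pade[of j] by (simp add: coprime_commute coprime_dvd_mult_left_iff)
  hence "1 / Q \<le> nint_dist (of_int (m * pade_num j) / of_int (pade_den j))"
    unfolding Q_def using pade_den_pos[of j] by (intro nint_dist_fraction) auto
  also have "of_int (m * pade_num j) / of_int (pade_den j) = of_int m * \<beta> + - \<delta>"
    by (simp add: \<delta>_def Q_def algebra_simps)
  also have "nint_dist \<dots> \<le> nint_dist (of_int m * \<beta>) + \<bar>- \<delta>\<bar>" by (rule nint_dist_add)
  finally have 1: "1 / Q \<le> nint_dist (of_int m * \<beta>) + \<bar>\<delta>\<bar>" by simp
  have "\<bar>\<delta>\<bar> = of_int m * \<bar>\<beta> - of_int (pade_num j) / Q\<bar>" using assms by (simp add: \<delta>_def abs_mult)
  also have "\<dots> \<le> Q * (7 / (3 * Q * Q'))"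
    using assms by (intro mult_mono) (auto simp: pade_close_def Q_def Q'_def)
  also have "\<dots> = 7 / (3 * Q')" using Q by simp
  also have "\<dots> \<le> 7 / (3 * (6 * Q))" using Q Q' by (intro divide_left_mono) auto
  also have "\<dots> \<le> 1 / (2 * Q)" using Q by (simp add: field_simps)
  finally show ?thesis using 1 Q by (simp add: Q_def field_simps)
qed

section \<open>Variance at the Pade approximants\<close>

text \<open>The \<open>Q\<close> points of the block are small displacements of the
  fractions with denominator \<open>Q\<close>. All but one of them stay comparably far from
  the integers and contribute \<open>O(Q\<^sup>2)\<close> together; the remaining one is
  controlled by the assumed lower bound \<open>L\<close>. The set \<open>R\<close> allows
  truncating the block, because the lower bound is available only below the next
  denominator.\<close>

lemma block_inverse_squares:
  assumes Q: "Q > 0" and p: "coprime p Q"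
    and close: "\<bar>\<beta> - of_int p / of_int Q\<bar> \<le> 7 / (18 * (real_of_int Q)\<^sup>2)"
    and L: "L > 0" and lower: "\<And>r. r \<in> R \<Longrightarrow> L \<le> nint_dist (of_int r * \<beta>)"
  shows "(\<Sum>r\<in>{s..<s+Q} \<inter> R. 1 / (nint_dist (of_int r * \<beta>))\<^sup>2) \<le> 324 * (of_int Q)\<^sup>2 + 1 / L\<^sup>2"
proof -
  define \<eta> where "\<eta> = \<beta> - of_int p / of_int Q"
  \<comment> \<open>up to an error below \<open>1/Q\<close>, the points \<open>r \<beta>\<close> of the block are the fractions \<open>(p r + c) / Q\<close>\<close>
  define c where "c = round (of_int Q * (of_int s * \<eta>))"
  define h where "h n = (if Q dvd n then 1 / L\<^sup>2 else 81 * (1 / (nint_dist (of_int n / of_int Q))\<^sup>2))" for n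
  have Qr: "real_of_int Q > 0" using Q by simp
  have h_per: "h (n mod Q) = h n" for n
    unfolding h_def using nint_dist_mod[OF Q] by (simp add: dvd_mod_iff)
  have "(\<Sum>r\<in>{s..<s+Q} \<inter> R. 1 / (nint_dist (of_int r * \<beta>))\<^sup>2) \<le> (\<Sum>r\<in>{s..<s+Q} \<inter> R. h (p * r + c))"
  proof (rule sum_mono)
    fix r assume r: "r \<in> {s..<s+Q} \<inter> R"
    have Lr: "L \<le> nint_dist (of_int r * \<beta>)" using lower r by auto
    show "1 / (nint_dist (of_int r * \<beta>))\<^sup>2 \<le> h (p * r + c)"
    proof (cases "Q dvd p * r + c")
      case True
      have "1 / (nint_dist (of_int r * \<beta>))\<^sup>2 \<le> 1 / L\<^sup>2"
        using L Lr by (intro divide_left_mono power_mono mult_pos_pos zero_less_power) auto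
      thus ?thesis using True by (simp add: h_def)
    next
      case False
      define \<theta> where "\<theta> = of_int r * \<eta> - of_int c / of_int Q"
      define d where "d = nint_dist (of_int (p * r + c) / of_int Q)"
      have d: "1 / of_int Q \<le> d" unfolding d_def by (rule nint_dist_fraction[OF Q False])
      have "\<bar>of_int s * \<eta> - of_int c / of_int Q\<bar> \<le> 1 / (2 * of_int Q)"
      proof -
        have "\<bar>of_int Q * (of_int s * \<eta>) - of_int c\<bar> \<le> 1 / 2"
          unfolding c_def using of_int_round_abs_le by (simp add: abs_minus_commute)
        hence "\<bar>of_int Q * (of_int s * \<eta>) - of_int c\<bar> / of_int Q \<le> (1 / 2) / of_int Q"
          using Qr by (intro divide_right_mono) auto
        moreover have "\<bar>of_int Q * (of_int s * \<eta>) - of_int c\<bar> / of_int Q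
            = \<bar>(of_int Q * (of_int s * \<eta>) - of_int c) / of_int Q\<bar>" using Qr by simp
        moreover have "(of_int Q * (of_int s * \<eta>) - of_int c) / of_int Q = of_int s * \<eta> - of_int c / of_int Q"
          using Qr by (simp add: diff_divide_distrib)
        ultimately show ?thesis by simp
      qed
      moreover have "\<bar>of_int (r - s) * \<eta>\<bar> \<le> 7 / (18 * of_int Q)"
      proof -
        have "\<bar>of_int (r - s) * \<eta>\<bar> = of_int (r - s) * \<bar>\<eta>\<bar>" using r by (simp add: abs_mult)
        also have "\<dots> \<le> of_int Q * (7 / (18 * (of_int Q)\<^sup>2))"
          using r close Qr unfolding \<eta>_def by (intro mult_mono) auto
        also have "\<dots> = 7 / (18 * of_int Q)" using Qr by (simp add: power2_eq_square)
        finally show ?thesis .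
      qed
      moreover have "\<theta> = (of_int s * \<eta> - of_int c / of_int Q) + of_int (r - s) * \<eta>"
        by (simp add: \<theta>_def algebra_simps)
      moreover have "1 / (2 * of_int Q) + 7 / (18 * of_int Q) = (8 / 9) * (1 / real_of_int Q)"
        using Qr by (simp add: field_simps)
      ultimately have \<theta>: "\<bar>\<theta>\<bar> \<le> (8 / 9) * (1 / of_int Q)" by linarith
      have "of_int (p * r + c) / of_int Q = of_int r * \<beta> + - \<theta>"
        by (simp add: \<theta>_def \<eta>_def add_divide_distrib algebra_simps)
      hence "d \<le> nint_dist (of_int r * \<beta>) + \<bar>- \<theta>\<bar>" unfolding d_def by (metis nint_dist_add)
      hence 1: "d / 9 \<le> nint_dist (of_int r * \<beta>)" using \<theta> d by simp
      have "0 < d" using d Qr by (smt (verit) divide_pos_pos)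
      hence "1 / (nint_dist (of_int r * \<beta>))\<^sup>2 \<le> 1 / (d / 9)\<^sup>2"
        using 1 by (intro divide_left_mono power_mono mult_pos_pos zero_less_power) auto
      also have "\<dots> = 81 * (1 / d\<^sup>2)" by (simp add: power_divide)
      finally show ?thesis using False by (simp add: h_def d_def)
    qed
  qed
  also have "\<dots> \<le> (\<Sum>r\<in>{s..<s+Q}. h (p * r + c))"
    by (rule sum_mono2) (auto simp: h_def)
  also have "\<dots> = (\<Sum>n=0..<Q. h n)" by (rule sum_residue_system[where h = h, OF Q h_per p])
  also have "{0..<Q} = insert 0 {1..<Q}" using Q by auto
  also have "sum h (insert 0 {1..<Q}) = 1 / L\<^sup>2 + (\<Sum>n=1..<Q. h n)" by (simp add: h_def)
  also have "(\<Sum>n=1..<Q. h n) = 81 * (\<Sum>n=1..<Q. 1 / (nint_dist (of_int n / of_int Q))\<^sup>2)"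
    unfolding sum_distrib_left using zdvd_not_zless by (intro sum.cong) (auto simp: h_def)
  also have "\<dots> \<le> 81 * (4 * (of_int Q)\<^sup>2)"
    using sum_inverse_nint_dist_squares[OF Q] by simp
  finally show ?thesis by simp
qed

text \<open>Cut the range into blocks of length \<open>Q\<close>. In the \<open>b\<close>-th
  block \<open>1 / r\<^sup>2 \<le> 1 / (b Q)\<^sup>2\<close>, and the remaining sum is
  \<open>O(Q'\<^sup>2)\<close>.\<close>

lemma range_inverse_squares:
  assumes Q: "Q > 0" and Q': "6 * Q \<le> Q'" and p: "coprime p Q"
    and close: "\<bar>\<beta> - of_int p / of_int Q\<bar> \<le> 7 / (18 * (real_of_int Q)\<^sup>2)"
    and lower: "\<And>r. 0 < r \<Longrightarrow> r < Q' \<Longrightarrow> 1 / (2 * of_int Q') \<le> nint_dist (of_int r * \<beta>)"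
  shows "(\<Sum>r=Q..<Q'. 1 / ((of_int r)\<^sup>2 * (nint_dist (of_int r * \<beta>))\<^sup>2)) \<le> 26 * (of_int Q' / of_int Q)\<^sup>2"
proof -
  define R where "R = {0<..<Q'}"
  let ?f = "\<lambda>r. 1 / ((of_int r)\<^sup>2 * (nint_dist (of_int r * \<beta>))\<^sup>2)"
  define K where "K = 13 * (real_of_int Q')\<^sup>2"
  have block: "(\<Sum>r\<in>{b * Q..<b * Q + Q} \<inter> R. ?f r) \<le> K / (of_int Q)\<^sup>2 * (1 / (of_int b)\<^sup>2)" if "b \<ge> 1" for b
  proof -
    have "(\<Sum>r\<in>{b * Q..<b * Q + Q} \<inter> R. ?f r)
       \<le> (\<Sum>r\<in>{b * Q..<b * Q + Q} \<inter> R. 1 / (of_int (b * Q))\<^sup>2 * (1 / (nint_dist (of_int r * \<beta>))\<^sup>2))"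
    proof (rule sum_mono)
      fix r assume r: "r \<in> {b * Q..<b * Q + Q} \<inter> R"
      have bQ: "0 < b * Q" using that Q by simp
      have "1 / (of_int r)\<^sup>2 \<le> 1 / (real_of_int (b * Q))\<^sup>2"
      proof (intro divide_left_mono power_mono mult_pos_pos zero_less_power)
        show "real_of_int (b * Q) \<le> real_of_int r" unfolding of_int_le_iff using r by simp
        show "0 \<le> real_of_int (b * Q)" "0 < real_of_int (b * Q)" using bQ by linarith+
        show "0 < real_of_int r" using r by (auto simp: R_def)
      qed simp
      hence "1 / (of_int r)\<^sup>2 * (1 / (nint_dist (of_int r * \<beta>))\<^sup>2)
         \<le> 1 / (real_of_int (b * Q))\<^sup>2 * (1 / (nint_dist (of_int r * \<beta>))\<^sup>2)"
        by (rule mult_right_mono) simp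
      thus "?f r \<le> 1 / (of_int (b * Q))\<^sup>2 * (1 / (nint_dist (of_int r * \<beta>))\<^sup>2)" by simp
    qed
    also have "\<dots> = 1 / (of_int (b * Q))\<^sup>2 * (\<Sum>r\<in>{b * Q..<b * Q + Q} \<inter> R. 1 / (nint_dist (of_int r * \<beta>))\<^sup>2)"
      by (rule sum_distrib_left[symmetric])
    also have "\<dots> \<le> 1 / (of_int (b * Q))\<^sup>2 * (324 * (of_int Q)\<^sup>2 + 1 / (1 / (2 * of_int Q'))\<^sup>2)"
    proof (rule mult_left_mono)
      show "(\<Sum>r\<in>{b * Q..<b * Q + Q} \<inter> R. 1 / (nint_dist (of_int r * \<beta>))\<^sup>2)
          \<le> 324 * (of_int Q)\<^sup>2 + 1 / (1 / (2 * of_int Q'))\<^sup>2"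
        by (rule block_inverse_squares[OF Q p close]) (use Q Q' lower in \<open>auto simp: R_def\<close>)
    qed simp
    also have "\<dots> \<le> 1 / (of_int (b * Q))\<^sup>2 * K"
    proof (rule mult_left_mono)
      have "(6 * real_of_int Q)\<^sup>2 \<le> (of_int Q')\<^sup>2" using Q Q' by (intro power_mono) linarith+
      thus "324 * (of_int Q)\<^sup>2 + 1 / (1 / (2 * of_int Q'))\<^sup>2 \<le> K"
        by (simp add: K_def power_mult_distrib power_divide)
    qed simp
    also have "\<dots> = K / (of_int Q)\<^sup>2 * (1 / (of_int b)\<^sup>2)" by (simp add: power_mult_distrib)
    finally show ?thesis .
  qed
  have upto: "(\<Sum>r\<in>{Q..<int n * Q + Q} \<inter> R. ?f r) \<le> K / (of_int Q)\<^sup>2 * (\<Sum>b=1..int n. 1 / (of_int b)\<^sup>2)" for n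
  proof (induction n)
    case (Suc n)
    define z where "z = int n * Q"
    have z: "int (Suc n) * Q = z + Q" "0 \<le> z" using Q by (simp_all add: z_def algebra_simps)
    have "{Q..<int (Suc n) * Q + Q} \<inter> R = ({Q..<int n * Q + Q} \<inter> R) \<union> ({int (Suc n) * Q..<int (Suc n) * Q + Q} \<inter> R)"
      unfolding z(1) z_def[symmetric] using Q z(2) by auto
    hence "(\<Sum>r\<in>{Q..<int (Suc n) * Q + Q} \<inter> R. ?f r)
       = (\<Sum>r\<in>({Q..<int n * Q + Q} \<inter> R) \<union> ({int (Suc n) * Q..<int (Suc n) * Q + Q} \<inter> R). ?f r)"
      by (simp only:)
    also have "\<dots> = (\<Sum>r\<in>{Q..<int n * Q + Q} \<inter> R. ?f r) + (\<Sum>r\<in>{int (Suc n) * Q..<int (Suc n) * Q + Q} \<inter> R. ?f r)"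
      by (rule sum.union_disjoint) (auto simp: algebra_simps)
    also have "\<dots> \<le> K / (of_int Q)\<^sup>2 * (\<Sum>b=1..int n. 1 / (of_int b)\<^sup>2) + K / (of_int Q)\<^sup>2 * (1 / (of_int (int (Suc n)))\<^sup>2)"
      by (intro add_mono Suc block) simp
    finally have "(\<Sum>r\<in>{Q..<int (Suc n) * Q + Q} \<inter> R. ?f r)
        \<le> K / (of_int Q)\<^sup>2 * (\<Sum>b=1..int n. 1 / (of_int b)\<^sup>2) + K / (of_int Q)\<^sup>2 * (1 / (of_int (int (Suc n)))\<^sup>2)"
      .
    also have "\<dots> = K / (of_int Q)\<^sup>2 * (\<Sum>b=1..int (Suc n). 1 / (of_int b)\<^sup>2)"
      unfolding int_atLeastAtMost_Suc by (simp add: algebra_simps)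
    finally show ?case .
  qed simp
  \<comment> \<open>a generous number of blocks; \<open>R\<close> cuts off what exceeds \<open>Q'\<close>\<close>
  have "{Q..<Q'} \<subseteq> {Q..<int (nat Q') * Q + Q} \<inter> R"
  proof
    fix r assume r: "r \<in> {Q..<Q'}"
    have "Q' * 1 \<le> Q' * Q" using Q Q' by (intro mult_left_mono) auto
    moreover have "r < Q'" using r by simp
    ultimately have "r < Q' * Q + Q" using Q by linarith
    moreover have "int (nat Q') = Q'" using Q Q' by simp
    ultimately show "r \<in> {Q..<int (nat Q') * Q + Q} \<inter> R" using r Q by (simp add: R_def)
  qed
  hence "(\<Sum>r=Q..<Q'. ?f r) \<le> (\<Sum>r\<in>{Q..<int (nat Q') * Q + Q} \<inter> R. ?f r)"
    by (intro sum_mono2) auto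
  also have "\<dots> \<le> K / (of_int Q)\<^sup>2 * (\<Sum>b=1..int (nat Q'). 1 / (of_int b)\<^sup>2)" by (rule upto)
  also have "\<dots> \<le> K / (of_int Q)\<^sup>2 * 2"
    using sum_inverse_squares_le[of "nat Q'"] by (intro mult_left_mono) (auto simp: K_def)
  also have "\<dots> = 26 * (of_int Q' / of_int Q)\<^sup>2" by (simp add: K_def power_divide)
  finally show ?thesis .
qed

text \<open>The range \<open>q\<^sub>j \<le> r < q\<^sub>j\<^sub>+\<^sub>1\<close>
  contributes \<open>O((q\<^sub>j\<^sub>+\<^sub>1 / q\<^sub>j)\<^sup>2) =
  O(j\<^sup>2)\<close>; now sum over \<open>j < k\<close>.\<close>

lemma pade_inverse_squares:
  assumes "k \<ge> 1"
  shows "(\<Sum>r=1..<pade_den k. 1 / ((of_int r)\<^sup>2 * (nint_dist (of_int r * (of_int (pade_num k) / of_int (pade_den k))))\<^sup>2))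
     \<le> 416 * real k ^ 3"
proof -
  define \<beta> where "\<beta> = real_of_int (pade_num k) / of_int (pade_den k)"
  let ?f = "\<lambda>r. 1 / ((real_of_int r)\<^sup>2 * (nint_dist (of_int r * \<beta>))\<^sup>2)"
  have close: "pade_close \<beta> j" if "1 \<le> j" "j \<le> k" for j
    unfolding \<beta>_def using that by (rule pade_close_pade)
  have range: "(\<Sum>r=pade_den j..<pade_den (Suc j). ?f r) \<le> 416 * (real k)\<^sup>2" if j: "1 \<le> j" "Suc j \<le> k" for j
  proof -
    have "(\<Sum>r=pade_den j..<pade_den (Suc j). ?f r) \<le> 26 * (of_int (pade_den (Suc j)) / of_int (pade_den j))\<^sup>2"
    proof (rule range_inverse_squares)
      show "pade_den j > 0" using pade_den_pos[of j] by simp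
      show "6 * pade_den j \<le> pade_den (Suc j)" using j by (intro pade_den_ge_6)
      show "\<bar>\<beta> - of_int (pade_num j) / of_int (pade_den j)\<bar> \<le> 7 / (18 * (real_of_int (pade_den j))\<^sup>2)"
        using j by (intro pade_close_square close) auto
      show "1 / (2 * of_int (pade_den (Suc j))) \<le> nint_dist (of_int r * \<beta>)" if "0 < r" "r < pade_den (Suc j)" for r
        using that j by (intro nint_dist_pade_lower close) auto
    qed (rule coprime_pade)
    also have "\<dots> \<le> 26 * (4 * real k)\<^sup>2"
    proof (intro mult_left_mono power_mono)
      have Qj: "real_of_int (pade_den j) > 0" using pade_den_pos[of j] by simp
      have "of_int (pade_den (Suc j)) \<le> real_of_int ((4 * int j + 3) * pade_den j)"
        using pade_den_le[of j] by linarith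
      hence "of_int (pade_den (Suc j)) \<le> (4 * real j + 3) * real_of_int (pade_den j)" by simp
      hence "of_int (pade_den (Suc j)) / of_int (pade_den j) \<le> 4 * real j + 3"
        using Qj by (simp add: pos_divide_le_eq)
      also have "\<dots> \<le> 4 * real k" using j by linarith
      finally show "of_int (pade_den (Suc j)) / of_int (pade_den j) \<le> 4 * real k" .
      show "0 \<le> real_of_int (pade_den (Suc j)) / real_of_int (pade_den j)"
        using pade_den_pos[of j] pade_den_pos[of "Suc j"] by simp
    qed auto
    also have "\<dots> = 416 * (real k)\<^sup>2" by (simp add: power_mult_distrib)
    finally show ?thesis .
  qed
  have "(\<Sum>r=1..<pade_den (Suc j). ?f r) \<le> 416 * (real k)\<^sup>2 * real j" if "Suc j \<le> k" for j
    using that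
  proof (induction j)
    case (Suc j)
    have "{1..<pade_den (Suc (Suc j))} = {1..<pade_den (Suc j)} \<union> {pade_den (Suc j)..<pade_den (Suc (Suc j))}"
      using pade_den_pos[of "Suc j"] pade_den_mono_Suc[of "Suc j"] by (auto simp del: pade_den.simps)
    hence "(\<Sum>r=1..<pade_den (Suc (Suc j)). ?f r)
       = (\<Sum>r\<in>{1..<pade_den (Suc j)} \<union> {pade_den (Suc j)..<pade_den (Suc (Suc j))}. ?f r)"
      by (simp only:)
    also have "\<dots> = (\<Sum>r=1..<pade_den (Suc j). ?f r) + (\<Sum>r=pade_den (Suc j)..<pade_den (Suc (Suc j)). ?f r)"
      by (rule sum.union_disjoint) (auto simp del: pade_den.simps)
    finally have "(\<Sum>r=1..<pade_den (Suc (Suc j)). ?f r)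
       = (\<Sum>r=1..<pade_den (Suc j). ?f r) + (\<Sum>r=pade_den (Suc j)..<pade_den (Suc (Suc j)). ?f r)" .
    moreover have "(\<Sum>r=1..<pade_den (Suc j). ?f r) \<le> 416 * (real k)\<^sup>2 * real j" using Suc by simp
    moreover have "(\<Sum>r=pade_den (Suc j)..<pade_den (Suc (Suc j)). ?f r) \<le> 416 * (real k)\<^sup>2"
      using Suc by (intro range) auto
    moreover have "416 * (real k)\<^sup>2 * real (Suc j) = 416 * (real k)\<^sup>2 * real j + 416 * (real k)\<^sup>2"
      by (simp add: algebra_simps)
    ultimately show ?case by linarith
  qed simp
  from this[of "k - 1"] have "(\<Sum>r=1..<pade_den k. ?f r) \<le> 416 * (real k)\<^sup>2 * real (k - 1)"
    using assms by simp
  also have "\<dots> \<le> 416 * (real k)\<^sup>2 * real k" by (intro mult_left_mono) auto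
  also have "\<dots> = 416 * real k ^ 3" by (simp add: power2_eq_square power3_eq_cube)
  finally show ?thesis unfolding \<beta>_def .
qed

theorem pade_variance:
  assumes k: "k \<ge> 2"
  defines "Q \<equiv> pade_den k"
  shows "(\<Sum>N=0..<Q. (logsin_sum Q (pade_num k) N - ln (of_int Q) / 2)\<^sup>2) \<le> 832 * of_int Q * real k ^ 3"
proof -
  have "7 \<le> Q" using pade_den_mono[OF k] by (simp add: Q_def numeral_eq_Suc)
  hence Q: "Q \<ge> 4" by simp
  define \<beta> where "\<beta> = real_of_int (pade_num k) / of_int Q"
  have "(\<Sum>N=0..<Q. (logsin_sum Q (pade_num k) N - ln (of_int Q) / 2)\<^sup>2)
    \<le> 8 * of_int Q * (\<Sum>r=1..<Q. 1 / ((of_int r)\<^sup>2 * (sin (pi * (of_int (pade_num k * r) / of_int Q)))\<^sup>2))"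
    by (rule logsin_sum_variance[OF Q]) (simp add: Q_def coprime_pade)
  also have "\<dots> \<le> 8 * of_int Q * (\<Sum>r=1..<Q. (1 / 4) * (1 / ((of_int r)\<^sup>2 * (nint_dist (of_int r * \<beta>))\<^sup>2)))"
  proof (intro mult_left_mono sum_mono)
    fix r assume r: "r \<in> {1..<Q}"
    have eq: "of_int (pade_num k * r) / of_int Q = of_int r * \<beta>" by (simp add: \<beta>_def mult.commute)
    have nd: "0 < nint_dist (of_int r * \<beta>)"
    proof -
      have "1 / (2 * real_of_int Q) \<le> nint_dist (of_int r * \<beta>)"
        unfolding Q_def \<beta>_def using r k by (intro nint_dist_pade_lower pade_close_pade) (auto simp: Q_def)
      moreover have "0 < 1 / (2 * real_of_int Q)" using Q by simp
      ultimately show ?thesis by linarith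
    qed
    have "(2 * nint_dist (of_int r * \<beta>))\<^sup>2 \<le> \<bar>sin (pi * (of_int r * \<beta>))\<bar>\<^sup>2"
      by (intro power_mono nint_dist_le_sin) simp
    hence s: "4 * (nint_dist (of_int r * \<beta>))\<^sup>2 \<le> (sin (pi * (of_int r * \<beta>)))\<^sup>2"
      by (simp add: power_mult_distrib)
    hence "(of_int r)\<^sup>2 * (4 * (nint_dist (of_int r * \<beta>))\<^sup>2) \<le> (of_int r)\<^sup>2 * (sin (pi * (of_int r * \<beta>)))\<^sup>2"
      by (rule mult_left_mono) simp
    moreover have "0 < (real_of_int r)\<^sup>2 * (4 * (nint_dist (of_int r * \<beta>))\<^sup>2)" using nd r by simp
    ultimately have "1 / ((of_int r)\<^sup>2 * (sin (pi * (of_int r * \<beta>)))\<^sup>2)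
      \<le> 1 / ((of_int r)\<^sup>2 * (4 * (nint_dist (of_int r * \<beta>))\<^sup>2))"
      by (intro divide_left_mono) auto
    thus "1 / ((of_int r)\<^sup>2 * (sin (pi * (of_int (pade_num k * r) / of_int Q)))\<^sup>2)
      \<le> (1 / 4) * (1 / ((of_int r)\<^sup>2 * (nint_dist (of_int r * \<beta>))\<^sup>2))"
      unfolding eq by (simp add: mult.left_commute)
  qed (use Q in auto)
  also have "\<dots> = 2 * of_int Q * (\<Sum>r=1..<Q. 1 / ((of_int r)\<^sup>2 * (nint_dist (of_int r * \<beta>))\<^sup>2))"
    unfolding sum_distrib_left[symmetric] by simp
  also have "\<dots> \<le> 2 * of_int Q * (416 * real k ^ 3)"
    using pade_inverse_squares[of k] k Q unfolding \<beta>_def Q_def by (intro mult_left_mono) auto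
  finally show ?thesis by simp
qed

section \<open>Comparison of e with its approximants\<close>

text \<open>At the integers this is \<open>ln 0 = 0\<close>, unlike the value chosen in
  \<open>logsin_mod\<close>.\<close>

definition logsin :: "real \<Rightarrow> real" where
  "logsin x = ln \<bar>2 * sin (pi * x)\<bar>"

lemma logsin_minus: "logsin (- x) = logsin x"
  by (simp add: logsin_def)

lemma logsin_plus_1: "logsin (x + 1) = logsin x"
  by (simp add: logsin_def distrib_left)

lemma logsin_perturb:
  assumes "0 < nint_dist x" and "\<bar>\<epsilon>\<bar> \<le> 2 / 7 * nint_dist x"
  shows "\<bar>logsin (x + \<epsilon>) - logsin x\<bar> \<le> 4 * \<bar>\<epsilon>\<bar> / nint_dist x"
proof -
  define d where "d = nint_dist x"
  define z where "z = (sin (pi * (x + \<epsilon>)) - sin (pi * x)) / sin (pi * x)"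
  have d: "d > 0" using assms(1) by (simp add: d_def)
  have s: "2 * d \<le> \<bar>sin (pi * x)\<bar>" unfolding d_def by (rule nint_dist_le_sin)
  hence s0: "sin (pi * x) \<noteq> 0" using d by auto
  have "\<bar>sin (pi * (x + \<epsilon>)) - sin (pi * x)\<bar> \<le> \<bar>pi * (x + \<epsilon>) - pi * x\<bar>" by (rule abs_sin_diff_le)
  also have "\<dots> = pi * \<bar>\<epsilon>\<bar>" by (simp add: distrib_left abs_mult)
  finally have "\<bar>z\<bar> \<le> pi * \<bar>\<epsilon>\<bar> / \<bar>sin (pi * x)\<bar>"
    unfolding z_def abs_divide by (rule divide_right_mono) simp
  also have "\<dots> \<le> pi * \<bar>\<epsilon>\<bar> / (2 * d)"
    using s s0 d by (intro divide_left_mono mult_pos_pos) auto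
  finally have z1: "\<bar>z\<bar> \<le> pi * \<bar>\<epsilon>\<bar> / (2 * d)" .
  also have "\<dots> \<le> pi * (2 / 7 * d) / (2 * d)"
    using assms(2) d by (intro divide_right_mono mult_left_mono) (auto simp: d_def)
  also have "\<dots> = pi / 7" using d by simp
  also have "\<dots> \<le> 1 / 2" using pi_approx by simp
  finally have z2: "\<bar>z\<bar> \<le> 1 / 2" .
  have "sin (pi * (x + \<epsilon>)) = (1 + z) * sin (pi * x)"
    using s0 by (simp add: z_def field_simps)
  hence "\<bar>2 * sin (pi * (x + \<epsilon>))\<bar> = (1 + z) * \<bar>2 * sin (pi * x)\<bar>"
    using z2 by (simp add: abs_mult)
  hence "logsin (x + \<epsilon>) = ln (1 + z) + logsin x"
    unfolding logsin_def using z2 s0 by (simp only:) (rule ln_mult_pos, auto)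
  hence "\<bar>logsin (x + \<epsilon>) - logsin x\<bar> \<le> 2 * \<bar>z\<bar>"
    using abs_ln_one_plus_le[OF z2] by simp
  also have "\<dots> \<le> 2 * (pi * \<bar>\<epsilon>\<bar> / (2 * d))" using z1 by simp
  also have "\<dots> = pi * \<bar>\<epsilon>\<bar> / d" by simp
  also have "\<dots> \<le> 4 * \<bar>\<epsilon>\<bar> / d"
    using d pi_less_4 by (intro divide_right_mono mult_right_mono) auto
  finally show ?thesis by (simp add: d_def)
qed

lemma sin_half_step_ratio:
  fixes Q l :: int
  assumes Q: "Q \<ge> 2" and l: "l \<in> {1..<Q}" and y: "\<bar>y\<bar> \<le> 1 / (2 * of_int Q)"
  shows "(sin (pi * y))\<^sup>2 / (sin (pi * (of_int l / of_int Q)))\<^sup>2 \<le> 1 / 2"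
proof -
  define b where "b = pi / (2 * of_int Q)"
  have b: "0 < b" "b \<le> pi / 4" using Q by (auto simp: b_def field_simps)
  have nd: "1 / of_int Q \<le> nint_dist (of_int l / of_int Q)" by (rule nint_dist_fraction_interior[OF l])
  have "nint_dist y \<le> \<bar>y\<bar>" using nint_dist_le[of y 0] by simp
  hence "nint_dist y \<le> 1 / (2 * of_int Q)" using y by simp
  from mult_left_mono[OF this, of pi] have "pi * nint_dist y \<le> b" by (simp add: b_def)
  hence "\<bar>sin (pi * y)\<bar> \<le> sin b"
    unfolding abs_sin_pi_nint_dist
  proof (intro sin_monotone_2pi_le)
    have "0 \<le> pi * nint_dist y" by simp
    thus "- (pi / 2) \<le> pi * nint_dist y" using pi_gt_zero by linarith
  qed (use b pi_gt_zero in linarith)+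
  hence 1: "(sin (pi * y))\<^sup>2 \<le> (sin b)\<^sup>2" by (metis abs_ge_zero power2_abs power_mono)
  have "sin (2 * b) \<le> \<bar>sin (pi * (of_int l / of_int Q))\<bar>"
    unfolding abs_sin_pi_nint_dist
  proof (rule sin_monotone_2pi_le)
    show "2 * b \<le> pi * nint_dist (of_int l / of_int Q)"
      using mult_left_mono[OF nd, of pi] by (simp add: b_def)
    show "pi * nint_dist (of_int l / of_int Q) \<le> pi / 2"
      using mult_left_mono[OF nint_dist_le_half, of pi] by simp
    show "- (pi / 2) \<le> 2 * b" using b pi_gt_zero by linarith
  qed
  moreover have "0 \<le> sin (2 * b)" using b by (intro sin_ge_zero) auto
  ultimately have "(sin (2*b))\<^sup>2 \<le> (sin (pi * (of_int l / of_int Q)))\<^sup>2"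
    by (metis power2_abs power_mono)
  moreover have "(sin (2*b))\<^sup>2 \<ge> 2 * (sin b)\<^sup>2" using b by (rule two_sin_sq_le_sin_double_sq)
  ultimately have "2 * (sin (pi * y))\<^sup>2 \<le> (sin (pi * (of_int l / of_int Q)))\<^sup>2"
    using 1 by linarith
  moreover have "0 < (sin (pi * (of_int l / of_int Q)))\<^sup>2"
    using sin_frac_eq_0_iff[of Q l] zdvd_not_zless[of l Q] l Q by auto
  ultimately show ?thesis by (simp add: field_simps)
qed

text \<open>For \<open>y = 0\<close> the sum is exactly \<open>ln Q\<close>. The changes of
  the terms at \<open>l\<close> and \<open>Q - l\<close> combine to \<open>ln (1 -
  sin\<^sup>2 (\<pi> y) / sin\<^sup>2 (\<pi> l / Q))\<close>, so the shift acts only to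
  second order, and these contributions sum to \<open>O(1)\<close>.\<close>

lemma sum_logsin_shifted:
  fixes Q :: int
  assumes Q: "Q \<ge> 2" and y: "\<bar>y\<bar> \<le> 1 / (2 * of_int Q)"
  shows "\<bar>(\<Sum>l=1..<Q. logsin (of_int l / of_int Q + y)) - ln (of_int Q)\<bar> \<le> 3"
proof -
  define S where "S = (\<Sum>l=1..<Q. logsin (of_int l / of_int Q + y))"
  have Qr: "real_of_int Q > 0" using Q by simp
  have "S = (\<Sum>l=1..<Q. logsin (of_int (Q - l) / of_int Q + y))"
    unfolding S_def by (rule sum_reflect_interval[symmetric])
  also have "\<dots> = (\<Sum>l=1..<Q. logsin (of_int l / of_int Q - y))"
  proof (rule sum.cong[OF refl])
    fix l
    have "of_int (Q - l) / of_int Q + y = - (of_int l / of_int Q - y) + 1"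
      using Qr by (simp add: diff_divide_distrib)
    thus "logsin (of_int (Q - l) / of_int Q + y) = logsin (of_int l / of_int Q - y)"
      by (simp only: logsin_plus_1 logsin_minus)
  qed
  finally have S': "S = (\<Sum>l=1..<Q. logsin (of_int l / of_int Q - y))" .
  have lnQ: "ln (of_int Q) = (\<Sum>l=1..<Q. logsin (of_int l / of_int Q))"
    unfolding logsin_def using sum_ln_sin_root_unity[of Q] Q by simp
  have pointwise: "\<bar>logsin (of_int l / of_int Q + y) + logsin (of_int l / of_int Q - y) - 2 * logsin (of_int l / of_int Q)\<bar>
     \<le> 5 / (4 * (of_int Q)\<^sup>2) * (1 / (nint_dist (of_int l / of_int Q))\<^sup>2)" if l: "l \<in> {1..<Q}" for l
  proof -
    define a where "a = pi * (of_int l / of_int Q)"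
    define d where "d = nint_dist (of_int l / of_int Q)"
    define x where "x = (sin (pi * y))\<^sup>2 / (sin a)\<^sup>2"
    have x: "0 \<le> x" "x \<le> 1 / 2"
      using sin_half_step_ratio[OF Q l y] by (auto simp: x_def a_def)
    have d: "1 / of_int Q \<le> d" unfolding d_def by (rule nint_dist_fraction_interior[OF l])
    hence d0: "d > 0" using Qr by (smt (verit) divide_pos_pos)
    have sa: "2 * d \<le> \<bar>sin a\<bar>" unfolding d_def a_def by (rule nint_dist_le_sin)
    hence sa0: "sin a \<noteq> 0" using d0 by auto
    have prod: "sin (a + pi * y) * sin (a - pi * y) = (1 - x) * (sin a)\<^sup>2"
      unfolding sin_plus_times_sin_minus using sa0 by (simp add: x_def left_diff_distrib)
    hence nz: "sin (a + pi * y) \<noteq> 0" "sin (a - pi * y) \<noteq> 0" using x sa0 by auto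
    have "\<bar>2 * sin (a + pi * y)\<bar> * \<bar>2 * sin (a - pi * y)\<bar> = \<bar>4 * (sin (a + pi * y) * sin (a - pi * y))\<bar>"
      by (simp add: abs_mult)
    also have "\<dots> = (1 - x) * (\<bar>2 * sin a\<bar> * \<bar>2 * sin a\<bar>)"
      unfolding prod using x by (simp add: abs_mult power2_eq_square)
    finally have "ln (\<bar>2 * sin (a + pi * y)\<bar> * \<bar>2 * sin (a - pi * y)\<bar>)
       = ln ((1 - x) * (\<bar>2 * sin a\<bar> * \<bar>2 * sin a\<bar>))" by (rule arg_cong)
    moreover have "ln (\<bar>2 * sin (a + pi * y)\<bar> * \<bar>2 * sin (a - pi * y)\<bar>)
       = ln \<bar>2 * sin (a + pi * y)\<bar> + ln \<bar>2 * sin (a - pi * y)\<bar>"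
      by (rule ln_mult_pos) (use nz in auto)
    moreover have "ln ((1 - x) * (\<bar>2 * sin a\<bar> * \<bar>2 * sin a\<bar>)) = ln (1 - x) + ln (\<bar>2 * sin a\<bar> * \<bar>2 * sin a\<bar>)"
      by (intro ln_mult_pos mult_pos_pos) (use x sa0 in auto)
    moreover have "ln (\<bar>2 * sin a\<bar> * \<bar>2 * sin a\<bar>) = ln \<bar>2 * sin a\<bar> + ln \<bar>2 * sin a\<bar>"
      by (rule ln_mult_pos) (use sa0 in auto)
    ultimately have "ln \<bar>2 * sin (a + pi * y)\<bar> + ln \<bar>2 * sin (a - pi * y)\<bar> - 2 * ln \<bar>2 * sin a\<bar> = ln (1 + - x)"
      by simp
    moreover have "\<bar>ln (1 + - x)\<bar> \<le> 2 * \<bar>- x\<bar>" using x by (intro abs_ln_one_plus_le) auto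
    moreover have "pi * (of_int l / of_int Q + y) = a + pi * y" "pi * (of_int l / of_int Q - y) = a - pi * y"
      by (simp_all add: a_def distrib_left right_diff_distrib)
    ultimately have "\<bar>logsin (of_int l / of_int Q + y) + logsin (of_int l / of_int Q - y) - 2 * logsin (of_int l / of_int Q)\<bar> \<le> 2 * x"
      using x unfolding logsin_def a_def[symmetric] by simp
    also have "x \<le> (10 / (2 * of_int Q)\<^sup>2) / (4 * d\<^sup>2)"
      unfolding x_def
    proof (rule frac_le)
      have "\<bar>sin (pi * y)\<bar> \<le> \<bar>pi * y\<bar>" by (rule abs_sin_x_le_abs_x)
      also have "\<dots> \<le> pi * (1 / (2 * of_int Q))" using mult_left_mono[OF y, of pi] by (simp add: abs_mult)
      finally have "\<bar>sin (pi * y)\<bar>\<^sup>2 \<le> (pi * (1 / (2 * of_int Q)))\<^sup>2" by (rule power_mono) simp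
      also have "\<dots> = pi\<^sup>2 / (2 * of_int Q)\<^sup>2" by (simp add: power_divide)
      also have "\<dots> \<le> 10 / (2 * of_int Q)\<^sup>2"
        using pi_squared_le_10 by (rule divide_right_mono) simp
      finally show "(sin (pi * y))\<^sup>2 \<le> 10 / (2 * of_int Q)\<^sup>2" by simp
      have "(2 * d)\<^sup>2 \<le> \<bar>sin a\<bar>\<^sup>2" using sa d0 by (intro power_mono) auto
      thus "4 * d\<^sup>2 \<le> (sin a)\<^sup>2" by (simp add: power_mult_distrib)
    qed (use d0 in auto)
    also have "2 * ((10 / (2 * of_int Q)\<^sup>2) / (4 * d\<^sup>2)) = 5 / (4 * (of_int Q)\<^sup>2) * (1 / d\<^sup>2)"
      by (simp add: power_mult_distrib)
    finally show ?thesis by (simp add: d_def)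
  qed
  have "2 * (S - ln (of_int Q))
     = (\<Sum>l=1..<Q. logsin (of_int l / of_int Q + y) + logsin (of_int l / of_int Q - y) - 2 * logsin (of_int l / of_int Q))"
    unfolding sum_subtractf sum.distrib sum_distrib_left[symmetric] S'[symmetric] lnQ[symmetric] S_def[symmetric] by simp
  also have "\<bar>\<dots>\<bar> \<le> (\<Sum>l=1..<Q. 5 / (4 * (of_int Q)\<^sup>2) * (1 / (nint_dist (of_int l / of_int Q))\<^sup>2))"
    by (rule order_trans[OF sum_abs sum_mono]) (rule pointwise)
  also have "\<dots> \<le> 5 / (4 * (of_int Q)\<^sup>2) * (4 * (of_int Q)\<^sup>2)"
    unfolding sum_distrib_left[symmetric] using Q by (intro mult_left_mono sum_inverse_nint_dist_squares) auto
  also have "\<dots> = 5" using Qr by simp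
  finally show ?thesis unfolding S_def by (simp add: abs_mult)
qed

text \<open>No cancellation is used: the displacements are at most
  \<open>\<epsilon>\<close>, and the derivative of the logarithmic sine is of the order of
  the inverse distance to the integers.\<close>

lemma logsin_sum_perturb:
  assumes Q: "Q \<ge> 2" and p: "coprime p Q" and N: "N < Q"
    and \<epsilon>: "\<epsilon> \<le> 1 / (7 * of_int Q)" and close: "of_int Q * \<bar>\<alpha> - of_int p / of_int Q\<bar> \<le> \<epsilon>"
  shows "\<bar>(\<Sum>n=1..N. logsin (of_int n * \<alpha>)) - logsin_sum Q p N\<bar> \<le> 8 * \<epsilon> * of_int Q * (1 + ln (of_int Q))"
proof -
  define \<delta> where "\<delta> = \<alpha> - of_int p / of_int Q"
  have Qr: "real_of_int Q > 0" using Q by simp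
  have Q0: "Q > 0" using Q by simp
  have e0: "0 \<le> \<epsilon>" using close Qr by (smt (verit) mult_nonneg_nonneg abs_ge_zero)
  define h where "h n = (if Q dvd n then 0 else 4 * \<epsilon> * (1 / nint_dist (of_int n / of_int Q)))" for n
  have h_per: "h (n mod Q) = h n" for n
    unfolding h_def using nint_dist_mod[OF Q0] by (simp add: dvd_mod_iff)
  have h_nonneg: "0 \<le> h n" for n using e0 by (simp add: h_def)
  have "\<bar>(\<Sum>n=1..N. logsin (of_int n * \<alpha>)) - logsin_sum Q p N\<bar>
      = \<bar>\<Sum>n=1..N. logsin (of_int n * \<alpha>) - logsin_mod Q (p * n)\<bar>"
    by (simp add: logsin_sum_def sum_subtractf)
  also have "\<dots> \<le> (\<Sum>n=1..N. h (p * n))"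
  proof (rule order_trans[OF sum_abs sum_mono])
    fix n assume n: "n \<in> {1..N}"
    have "\<not> Q dvd n" using n N zdvd_not_zless by auto
    hence nd: "\<not> Q dvd p * n" using p by (simp add: coprime_commute coprime_dvd_mult_right_iff)
    define x where "x = real_of_int (p * n) / of_int Q"
    have d: "1 / of_int Q \<le> nint_dist x" unfolding x_def by (rule nint_dist_fraction[OF Q0 nd])
    have "\<bar>of_int n * \<delta>\<bar> = of_int n * \<bar>\<delta>\<bar>" using n by (simp add: abs_mult)
    also have "\<dots> \<le> of_int Q * \<bar>\<delta>\<bar>" using n N by (intro mult_right_mono) auto
    also have "\<dots> \<le> \<epsilon>" using close by (simp add: \<delta>_def)
    finally have nde: "\<bar>of_int n * \<delta>\<bar> \<le> \<epsilon>" .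
    have d0: "0 < nint_dist x" using d Qr by (smt (verit) divide_pos_pos)
    have e2: "\<epsilon> \<le> 2 / 7 * nint_dist x"
    proof -
      have "1 / (7 * real_of_int Q) = 1 / 7 * (1 / of_int Q)" by simp
      thus ?thesis using \<epsilon> d d0 by linarith
    qed
    have eq: "of_int n * \<alpha> = x + of_int n * \<delta>" by (simp add: x_def \<delta>_def algebra_simps)
    have "\<bar>logsin (of_int n * \<alpha>) - logsin x\<bar> \<le> 4 * \<bar>of_int n * \<delta>\<bar> / nint_dist x"
      unfolding eq using nde e2 d0 by (intro logsin_perturb) auto
    also have "\<dots> \<le> 4 * \<epsilon> / nint_dist x" using nde d0 by (intro divide_right_mono) auto
    finally show "\<bar>logsin (of_int n * \<alpha>) - logsin_mod Q (p * n)\<bar> \<le> h (p * n)"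
      using nd by (simp add: h_def logsin_mod_def logsin_def x_def)
  qed
  also have "\<dots> \<le> (\<Sum>n=0..<Q. h (p * n))"
    using N h_nonneg by (intro sum_mono2) auto
  also have "\<dots> = (\<Sum>n=0..<Q. h n)" by (rule sum_period_dilate[where h = h, OF Q0 h_per p])
  also have "{0..<Q} = insert 0 {1..<Q}" using Q by auto
  also have "sum h (insert 0 {1..<Q}) = (\<Sum>n=1..<Q. h n)" by (simp add: h_def)
  also have "(\<Sum>n=1..<Q. h n) = 4 * \<epsilon> * (\<Sum>n=1..<Q. 1 / nint_dist (of_int n / of_int Q))"
    unfolding sum_distrib_left using zdvd_not_zless by (intro sum.cong) (auto simp: h_def)
  also have "\<dots> \<le> 4 * \<epsilon> * (2 * of_int Q * (1 + ln (of_int Q)))"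
    using e0 by (intro mult_left_mono sum_inverse_nint_dist[OF Q]) auto
  finally show ?thesis by simp
qed

text \<open>A full block of \<open>Q\<close> terms is almost balanced. The increments
  \<open>(n - s) \<delta>\<close> inside the block are treated crudely as above, whereas the
  common shift \<open>s \<delta>\<close>, which can be as large as the spacing \<open>1 /
  Q\<close>, is reduced to \<open>\<bar>y\<bar> \<le> 1 / (2 Q)\<close> by relabelling the
  residues and then handled by \<open>sum_logsin_shifted\<close>. The term closest to a zero
  of the sine is of order between \<open>1 / Q'\<close> and \<open>1 / Q\<close>, so after
  multiplication by the product \<open>Q\<close> of the other terms its logarithm is
  \<open>O(1 + ln (Q' / Q))\<close>.\<close>

lemma logsin_block:
  assumes Q: "Q \<ge> 2" and p: "coprime p Q"
    and \<epsilon>: "\<epsilon> \<le> 1 / (7 * of_int Q)" and close: "of_int Q * \<bar>\<alpha> - of_int p / of_int Q\<bar> \<le> \<epsilon>"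
    and lower: "\<And>n. n \<in> {s..<s+Q} \<Longrightarrow> 1 / (2 * of_int Q') \<le> nint_dist (of_int n * \<alpha>)"
    and Q': "2 * Q \<le> Q'"
  shows "\<bar>\<Sum>n=s..<s+Q. logsin (of_int n * \<alpha>)\<bar> \<le> 6 + ln (of_int Q' / of_int Q) + 16 * \<epsilon> * of_int Q * (1 + ln (of_int Q))"
proof -
  define \<delta> where "\<delta> = \<alpha> - of_int p / of_int Q"
  define c where "c = round (of_int Q * (of_int s * \<delta>))"
  define y where "y = of_int s * \<delta> - of_int c / of_int Q"
  have Qr: "real_of_int Q > 0" using Q by simp
  have Q0: "Q > 0" using Q by simp
  have e0: "0 \<le> \<epsilon>" using close Qr by (smt (verit) mult_nonneg_nonneg abs_ge_zero)
  have y: "\<bar>y\<bar> \<le> 1 / (2 * of_int Q)"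
  proof -
    have "\<bar>of_int Q * (of_int s * \<delta>) - of_int c\<bar> \<le> 1 / 2"
      unfolding c_def using of_int_round_abs_le by (simp add: abs_minus_commute)
    hence "\<bar>of_int Q * (of_int s * \<delta>) - of_int c\<bar> / of_int Q \<le> (1 / 2) / of_int Q"
      using Qr by (intro divide_right_mono) auto
    moreover have "\<bar>of_int Q * (of_int s * \<delta>) - of_int c\<bar> / of_int Q
        = \<bar>(of_int Q * (of_int s * \<delta>) - of_int c) / of_int Q\<bar>" using Qr by simp
    moreover have "(of_int Q * (of_int s * \<delta>) - of_int c) / of_int Q = y"
      using Qr by (simp add: diff_divide_distrib y_def)
    ultimately show ?thesis by simp
  qed
  have inc: "\<bar>of_int (n - s) * \<delta>\<bar> \<le> \<epsilon>" if "n \<in> {s..<s+Q}" for n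
  proof -
    have "\<bar>of_int (n - s) * \<delta>\<bar> = of_int (n - s) * \<bar>\<delta>\<bar>" using that by (simp add: abs_mult)
    also have "\<dots> \<le> of_int Q * \<bar>\<delta>\<bar>" using that by (intro mult_right_mono) auto
    finally show ?thesis using close by (simp add: \<delta>_def)
  qed
  have eq: "of_int n * \<alpha> = (of_int (p * n + c) / of_int Q + y) + of_int (n - s) * \<delta>" for n
    by (simp add: \<delta>_def y_def add_divide_distrib diff_divide_distrib algebra_simps)
  \<comment> \<open>\<open>h\<close> bounds the error made by replacing each term with \<open>g\<close>; at the exceptional residue
    \<open>g\<close> is \<open>- ln Q\<close>, which compensates the sum over the other residues\<close>
  define X :: real where "X = 3 + ln (of_int Q' / of_int Q)"
  define h where "h n = (if Q dvd n then X else 8 * \<epsilon> * (1 / nint_dist (of_int n / of_int Q)))" for n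
  define g where "g n = (if Q dvd n then - ln (of_int Q) else logsin (of_int n / of_int Q + y))" for n
  have h_per: "h (n mod Q) = h n" for n
    unfolding h_def using nint_dist_mod[OF Q0] by (simp add: dvd_mod_iff)
  have g_per: "g (n mod Q) = g n" for n
  proof -
    have "g (m + Q) = g m" for m
    proof -
      have "of_int (m + Q) / of_int Q + y = (of_int m / of_int Q + y) + 1" using Qr by (simp add: add_divide_distrib)
      thus ?thesis unfolding g_def by (simp only: logsin_plus_1) simp
    qed
    thus ?thesis by (rule periodic_mod)
  qed
  have pointwise: "\<bar>logsin (of_int n * \<alpha>) - g (p * n + c)\<bar> \<le> h (p * n + c)" if n: "n \<in> {s..<s+Q}" for n
  proof (cases "Q dvd p * n + c")
    case True
    then obtain m where m: "p * n + c = Q * m" by blast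
    define w where "w = nint_dist (of_int n * \<alpha>)"
    have "real_of_int (p * n + c) / of_int Q = of_int m" unfolding m using Qr by simp
    hence "of_int n * \<alpha> - of_int m = y + of_int (n - s) * \<delta>" using eq[of n] by simp
    hence "w \<le> \<bar>y + of_int (n - s) * \<delta>\<bar>" unfolding w_def by (metis nint_dist_le)
    also have "\<dots> \<le> 1 / (2 * of_int Q) + 1 / (7 * of_int Q)" using y inc[OF n] \<epsilon> by linarith
    also have "\<dots> \<le> 1 / of_int Q" using Qr by (simp add: field_simps)
    finally have w1: "w \<le> 1 / of_int Q" .
    have w2: "1 / (2 * of_int Q') \<le> w" unfolding w_def by (rule lower[OF n])
    define v where "v = of_int Q * \<bar>2 * sin (pi * (of_int n * \<alpha>))\<bar>"
    have Q'r: "real_of_int Q' > 0" using Q' Q by simp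
    have "4 * w \<le> \<bar>2 * sin (pi * (of_int n * \<alpha>))\<bar>"
      using nint_dist_le_sin[of "of_int n * \<alpha>"] by (simp add: w_def abs_mult)
    hence "of_int Q * (4 * (1 / (2 * of_int Q'))) \<le> v"
      unfolding v_def using w2 Qr by (intro mult_left_mono) auto
    hence v1: "2 * of_int Q / of_int Q' \<le> v" by (simp add: mult.commute)
    have v0: "0 < v" using v1 Qr Q'r by (smt (verit) divide_pos_pos)
    have s0: "\<bar>2 * sin (pi * (of_int n * \<alpha>))\<bar> > 0" using v0 by (auto simp: v_def zero_less_mult_iff)
    have "\<bar>2 * sin (pi * (of_int n * \<alpha>))\<bar> \<le> 2 * (pi * w)"
      using sin_le_nint_dist[of "of_int n * \<alpha>"] by (simp add: w_def abs_mult)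
    also have "\<dots> \<le> 2 * (pi * (1 / of_int Q))" using w1 by (intro mult_left_mono) auto
    finally have "v \<le> of_int Q * (2 * (pi * (1 / of_int Q)))"
      unfolding v_def using Qr by (intro mult_left_mono) auto
    also have "\<dots> = 2 * pi" using Qr by simp
    finally have v2: "v \<le> 2 * pi" .
    have "ln v = ln (of_int Q) + logsin (of_int n * \<alpha>)"
      unfolding v_def logsin_def using s0 Qr by (rule ln_mult_pos[rotated])
    moreover have "ln v \<le> 3"
    proof -
      have "1 + 3 + 3\<^sup>2/2 \<le> exp (3::real)" by (rule exp_lower_Taylor_quadratic) simp
      hence "v \<le> exp 3" using v2 pi_less_4 by (simp add: power2_eq_square)
      hence "ln v \<le> ln (exp 3)" using v0 by (intro ln_mono) auto
      thus ?thesis by simp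
    qed
    moreover have "- ln (of_int Q' / of_int Q) \<le> ln v"
    proof -
      have "of_int Q / of_int Q' \<le> v" using v1 Qr Q'r by (smt (verit) divide_nonneg_nonneg mult_2 add_divide_distrib)
      hence "ln (of_int Q / of_int Q') \<le> ln v" using Qr Q'r by (intro ln_mono) auto
      thus ?thesis using Qr Q'r by (simp add: ln_div)
    qed
    moreover have "0 \<le> ln (of_int Q' / real_of_int Q)" using Q' Qr Q by (intro ln_ge_zero) (simp add: pos_le_divide_eq)
    ultimately have "\<bar>logsin (of_int n * \<alpha>) + ln (of_int Q)\<bar> \<le> X" unfolding X_def by linarith
    thus ?thesis using True by (simp add: h_def g_def)
  next
    case False
    define x where "x = real_of_int (p * n + c) / of_int Q"
    have d: "1 / of_int Q \<le> nint_dist x" unfolding x_def by (rule nint_dist_fraction[OF Q0 False])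
    have d0: "0 < nint_dist x" using d Qr by (smt (verit) divide_pos_pos)
    have "nint_dist x = nint_dist ((x + y) + - y)" by simp
    also have "\<dots> \<le> nint_dist (x + y) + \<bar>- y\<bar>" by (rule nint_dist_add)
    finally have "nint_dist x \<le> nint_dist (x + y) + 1 / 2 * (1 / of_int Q)" using y by simp
    hence d2: "nint_dist x / 2 \<le> nint_dist (x + y)" using d by linarith
    have e2: "\<epsilon> \<le> 2 / 7 * nint_dist (x + y)"
    proof -
      have "1 / (7 * real_of_int Q) = 1 / 7 * (1 / of_int Q)" by simp
      thus ?thesis using \<epsilon> d d2 by linarith
    qed
    have "\<bar>logsin (of_int n * \<alpha>) - logsin (x + y)\<bar> \<le> 4 * \<bar>of_int (n - s) * \<delta>\<bar> / nint_dist (x + y)"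
      unfolding eq[of n] x_def[symmetric] using inc[OF n] e2 d0 d2 by (intro logsin_perturb) auto
    also have "\<dots> \<le> 4 * \<epsilon> / (nint_dist x / 2)"
      using inc[OF n] d0 d2 e0 by (intro frac_le) auto
    also have "\<dots> = 8 * \<epsilon> * (1 / nint_dist x)" by simp
    finally show ?thesis using False by (simp add: h_def g_def x_def)
  qed
  have set: "{0..<Q} = insert 0 {1..<Q}" using Q by auto
  have "(\<Sum>n=s..<s+Q. g (p * n + c)) = (\<Sum>n=0..<Q. g n)"
    by (rule sum_residue_system[where h = g, OF Q0 g_per p])
  also have "\<dots> = - ln (of_int Q) + (\<Sum>n=1..<Q. g n)" unfolding set by (simp add: g_def)
  also have "(\<Sum>n=1..<Q. g n) = (\<Sum>n=1..<Q. logsin (of_int n / of_int Q + y))"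
    using zdvd_not_zless by (intro sum.cong) (auto simp: g_def)
  finally have g_sum: "\<bar>\<Sum>n=s..<s+Q. g (p * n + c)\<bar> \<le> 3"
    using sum_logsin_shifted[OF Q y] by simp
  have "(\<Sum>n=s..<s+Q. h (p * n + c)) = (\<Sum>n=0..<Q. h n)"
    by (rule sum_residue_system[where h = h, OF Q0 h_per p])
  also have "\<dots> = X + (\<Sum>n=1..<Q. h n)" unfolding set by (simp add: h_def)
  also have "(\<Sum>n=1..<Q. h n) = 8 * \<epsilon> * (\<Sum>n=1..<Q. 1 / nint_dist (of_int n / of_int Q))"
    unfolding sum_distrib_left using zdvd_not_zless by (intro sum.cong) (auto simp: h_def)
  also have "\<dots> \<le> 8 * \<epsilon> * (2 * of_int Q * (1 + ln (of_int Q)))"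
    using e0 by (intro mult_left_mono sum_inverse_nint_dist[OF Q]) auto
  finally have h_sum: "(\<Sum>n=s..<s+Q. h (p * n + c)) \<le> X + 16 * \<epsilon> * of_int Q * (1 + ln (of_int Q))" by simp
  have "(\<Sum>n=s..<s+Q. logsin (of_int n * \<alpha>)) - (\<Sum>n=s..<s+Q. g (p * n + c))
      = (\<Sum>n=s..<s+Q. logsin (of_int n * \<alpha>) - g (p * n + c))" by (simp add: sum_subtractf)
  also have "\<bar>\<dots>\<bar> \<le> (\<Sum>n=s..<s+Q. h (p * n + c))"
    by (rule order_trans[OF sum_abs sum_mono]) (rule pointwise)
  finally show ?thesis using g_sum h_sum unfolding X_def by linarith
qed

lemma pade_den_le_power: "k \<le> K \<Longrightarrow> real_of_int (pade_den k) \<le> (4 * real K) ^ k"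
proof (induction k)
  case (Suc k)
  have "real_of_int (pade_den (Suc k)) \<le> of_int ((4 * int k + 3) * pade_den k)"
    using pade_den_le[of k] by linarith
  also have "\<dots> = (4 * real k + 3) * of_int (pade_den k)" by simp
  also have "\<dots> \<le> (4 * real K) * (4 * real K) ^ k"
    using Suc pade_den_pos[of k] by (intro mult_mono) auto
  finally show ?case by simp
qed simp

lemma ln_pade_den_le:
  assumes "k \<ge> 1" shows "ln (of_int (pade_den k)) \<le> 4 * (real k * sqrt (real k))"
proof -
  have "ln (of_int (pade_den k)) \<le> ln ((4 * real k) ^ k)"
    using pade_den_le_power[of k k] pade_den_pos[of k] by (intro ln_mono) auto
  also have "\<dots> = real k * ln (4 * real k)" by (rule ln_realpow)
  also have "\<dots> \<le> real k * (2 * sqrt (4 * real k))"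
    using assms by (intro mult_left_mono ln_le_2_sqrt) auto
  also have "\<dots> = 4 * (real k * sqrt (real k))" by (simp add: real_sqrt_mult)
  finally show ?thesis .
qed

text \<open>Write \<open>N = r + b q\<^sub>k\<close> with \<open>r < q\<^sub>k\<close>. The
  first \<open>r\<close> terms are compared with those at \<open>p\<^sub>k /
  q\<^sub>k\<close>, and each of the \<open>b \<le> 4 k + 3\<close> blocks after them is
  \<open>O(\<surd>k)\<close>: both \<open>ln (q\<^sub>k\<^sub>+\<^sub>1 / q\<^sub>k)\<close>
  and \<open>(q\<^sub>k / q\<^sub>k\<^sub>+\<^sub>1) ln q\<^sub>k\<close> are \<open>O(ln
  k)\<close>, which is more than enough. The assumption \<open>k \<ge> 3\<close> makes
  \<open>q\<^sub>k\<^sub>+\<^sub>1 \<ge> 14 q\<^sub>k\<close>, so that the displacements are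
  small compared to the spacing.\<close>

lemma pade_transfer:
  assumes k: "k \<ge> 3" and N: "0 \<le> N" "N < pade_den (Suc k)"
  shows "\<bar>(\<Sum>n=1..N. logsin (of_int n * exp 1)) - logsin_sum (pade_den k) (pade_num k) (N mod pade_den k)\<bar>
           \<le> 280 * (real k * sqrt (real k))"
proof -
  define Q Q' p where "Q = pade_den k" and "Q' = pade_den (Suc k)" and "p = pade_num k"
  define \<epsilon> where "\<epsilon> = 2 / real_of_int Q'"
  define f where "f n = logsin (of_int n * exp 1)" for n
  define r where "r = N mod Q"
  have Q1: "Q \<ge> 1" and Q'1: "Q' \<ge> 1" using pade_den_pos by (simp_all add: Q_def Q'_def)
  have Q: "Q \<ge> 2"
  proof -
    have "pade_den 2 \<le> Q" unfolding Q_def using k by (intro pade_den_mono) simp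
    thus ?thesis by (simp add: numeral_eq_Suc)
  qed
  have Qr: "real_of_int Q > 0" "real_of_int Q' > 0" using Q Q'1 by auto
  have "(4 * int k + 2) * Q \<le> Q'" unfolding Q_def Q'_def using k by (intro pade_den_ge) simp
  hence "real_of_int ((4 * int k + 2) * Q) \<le> of_int Q'" by linarith
  hence big: "(4 * real k + 2) * of_int Q \<le> of_int Q'" by simp
  have "Q' \<le> (4 * int k + 3) * Q" unfolding Q_def Q'_def by (rule pade_den_le)
  hence "of_int Q' \<le> real_of_int ((4 * int k + 3) * Q)" by linarith
  hence small: "of_int Q' \<le> (4 * real k + 3) * of_int Q" by simp
  have big14: "14 * real_of_int Q \<le> of_int Q'"
  proof -
    have "14 * real_of_int Q \<le> (4 * real k + 2) * of_int Q" using k Qr by (intro mult_right_mono) auto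
    thus ?thesis using big by linarith
  qed
  have eps: "\<epsilon> \<le> 1 / (7 * of_int Q)"
    unfolding \<epsilon>_def using big14 Qr by (simp add: field_simps)
  have close: "of_int Q * \<bar>exp 1 - of_int p / of_int Q\<bar> \<le> \<epsilon>"
  proof -
    have "of_int Q * \<bar>exp 1 - of_int p / of_int Q\<bar> \<le> of_int Q * (2 / (real_of_int Q * of_int Q'))"
      unfolding Q_def Q'_def p_def using pade_den_pos[of k] by (intro mult_left_mono pade_error_le) auto
    thus ?thesis using Qr by (simp add: \<epsilon>_def)
  qed
  have cop: "coprime p Q" unfolding p_def Q_def by (rule coprime_pade)
  define s where "s = sqrt (real k)"
  have s1: "1 \<le> s" unfolding s_def using k by simp
  \<comment> \<open>here the gap \<open>q\<^sub>k\<^sub>+\<^sub>1 \<ge> (4 k + 2) q\<^sub>k\<close> absorbs the factor \<open>ln q\<^sub>k\<close>\<close>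
  have epsQ: "\<epsilon> * of_int Q \<le> 1 / (2 * real k)"
  proof -
    have "4 * real k * of_int Q \<le> of_int Q'" using big Qr by (simp add: algebra_simps)
    thus ?thesis unfolding \<epsilon>_def using Qr k by (simp add: field_simps)
  qed
  have lnQ: "1 + ln (of_int Q) \<le> 5 * (real k * s)"
  proof -
    have "1 * 1 \<le> real k * s" using k s1 by (intro mult_mono) auto
    thus ?thesis using ln_pade_den_le[of k] k unfolding Q_def s_def by simp
  qed
  have lnQ0: "0 \<le> 1 + ln (real_of_int Q)" using Q1 by simp
  have prod: "\<epsilon> * of_int Q * (1 + ln (of_int Q)) \<le> 5 / 2 * s"
  proof -
    have "\<epsilon> * of_int Q * (1 + ln (of_int Q)) \<le> 1 / (2 * real k) * (5 * (real k * s))"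
      using epsQ lnQ lnQ0 by (intro mult_mono) auto
    thus ?thesis using k by simp
  qed
  have first: "\<bar>(\<Sum>n=1..r. f n) - logsin_sum Q p r\<bar> \<le> 20 * s"
  proof -
    have "\<bar>(\<Sum>n=1..r. f n) - logsin_sum Q p r\<bar> \<le> 8 * \<epsilon> * of_int Q * (1 + ln (of_int Q))"
      unfolding f_def by (rule logsin_sum_perturb[OF Q cop _ eps close]) (use Q in \<open>simp add: r_def\<close>)
    also have "\<dots> = 8 * (\<epsilon> * of_int Q * (1 + ln (of_int Q)))" by simp
    finally show ?thesis using prod by linarith
  qed
  have block: "\<bar>\<Sum>n=t..<t+Q. f n\<bar> \<le> 52 * s" if t: "1 \<le> t" "t + Q \<le> Q'" for t
  proof -
    have "\<bar>\<Sum>n=t..<t+Q. f n\<bar> \<le> 6 + ln (of_int Q' / of_int Q) + 16 * \<epsilon> * of_int Q * (1 + ln (of_int Q))"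
      unfolding f_def
    proof (rule logsin_block[OF Q cop eps close])
      fix n assume "n \<in> {t..<t+Q}"
      thus "1 / (2 * of_int Q') \<le> nint_dist (of_int n * exp 1)"
        unfolding Q'_def using t by (intro nint_dist_pade_lower pade_close_exp) (auto simp: Q'_def)
    next
      show "2 * Q \<le> Q'" using big14 Q by linarith
    qed
    also have "ln (of_int Q' / of_int Q) \<le> 6 * s"
    proof -
      have "of_int Q' / of_int Q \<le> 9 * real k" 
      proof -
        have "(4 * real k + 3) * of_int Q \<le> 9 * real k * of_int Q" using k Qr by (intro mult_right_mono) auto
        hence "of_int Q' \<le> 9 * real k * of_int Q" using small by linarith
        thus ?thesis using Qr by (simp add: pos_divide_le_eq)
      qed
      hence "ln (of_int Q' / of_int Q) \<le> ln (9 * real k)" using Qr by (intro ln_mono) auto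
      also have "\<dots> \<le> 2 * sqrt (9 * real k)" using k by (intro ln_le_2_sqrt) auto
      also have "\<dots> = 6 * s" by (simp add: real_sqrt_mult s_def)
      finally show ?thesis .
    qed
    also have "16 * \<epsilon> * of_int Q * (1 + ln (of_int Q)) = 16 * (\<epsilon> * of_int Q * (1 + ln (of_int Q)))" by simp
    finally show ?thesis using prod s1 by linarith
  qed
  have blocks: "\<bar>(\<Sum>n=1..r + int b * Q. f n) - (\<Sum>n=1..r. f n)\<bar> \<le> real b * (52 * s)" if "r + int b * Q < Q'" for b
    using that
  proof (induction b)
    case (Suc b)
    define t where "t = r + int b * Q"
    have t: "r + int (Suc b) * Q = t + Q" by (simp add: t_def algebra_simps)
    have t0: "0 \<le> t" using Q by (simp add: t_def r_def)
    have "{1..t+Q} = {1..t} \<union> {t+1..<t+1+Q}" using t0 Q by auto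
    hence "(\<Sum>n=1..t+Q. f n) = (\<Sum>n\<in>{1..t} \<union> {t+1..<t+1+Q}. f n)" by (simp only:)
    also have "\<dots> = (\<Sum>n=1..t. f n) + (\<Sum>n=t+1..<t+1+Q. f n)" by (rule sum.union_disjoint) auto
    finally have eq: "(\<Sum>n=1..t+Q. f n) = (\<Sum>n=1..t. f n) + (\<Sum>n=t+1..<t+1+Q. f n)" .
    have lt: "t + Q < Q'" using Suc.prems unfolding t .
    have "\<bar>(\<Sum>n=1..t. f n) - (\<Sum>n=1..r. f n)\<bar> \<le> real b * (52 * s)"
      unfolding t_def by (rule Suc.IH) (use lt Q in \<open>simp add: t_def\<close>)
    moreover have "\<bar>\<Sum>n=t+1..<t+1+Q. f n\<bar> \<le> 52 * s" using lt t0 by (intro block) auto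
    moreover have "real (Suc b) * (52 * s) = real b * (52 * s) + 52 * s" by (simp add: algebra_simps)
    ultimately show ?case unfolding t eq by linarith
  qed simp
  define b where "b = nat (N div Q)"
  have b: "int b = N div Q" using N Q by (simp add: b_def pos_imp_zdiv_nonneg_iff)
  have Neq: "N = r + int b * Q" unfolding b r_def by simp
  have "\<bar>(\<Sum>n=1..N. f n) - (\<Sum>n=1..r. f n)\<bar> \<le> real b * (52 * s)"
    using blocks[of b] N unfolding Neq[symmetric] Q'_def by simp
  also have "\<dots> \<le> (5 * real k) * (52 * s)"
  proof (intro mult_right_mono)
    have "0 \<le> r" using Q by (simp add: r_def)
    hence "int b * Q < Q'" using N Neq unfolding Q'_def by linarith
    hence "real_of_int (int b * Q) < of_int Q'" by linarith
    hence "real b * of_int Q < (4 * real k + 3) * of_int Q" using small by simp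
    hence "real b < 4 * real k + 3" using Qr by simp
    thus "real b \<le> 5 * real k" using k by linarith
  qed (use s1 in auto)
  finally have "\<bar>(\<Sum>n=1..N. f n) - logsin_sum Q p r\<bar> \<le> 260 * (real k * s) + 20 * s" using first by simp
  moreover have "1 * s \<le> real k * s" using k s1 by (intro mult_right_mono) auto
  ultimately show ?thesis unfolding f_def Q_def p_def r_def s_def by linarith
qed

section \<open>Second moment\<close>

text \<open>By \<open>pade_transfer\<close> only the remainder of \<open>N\<close> modulo
  \<open>q\<^sub>k\<close> matters, and \<open>{1..M}\<close> is covered by at most \<open>2
  M / q\<^sub>k\<close> full periods.\<close>

lemma logsin_second_moment:
  assumes k: "k \<ge> 3" and M: "pade_den k \<le> M" "M < pade_den (Suc k)"
  shows "(\<Sum>N=1..M. (\<Sum>n=1..N. logsin (of_int n * exp 1))\<^sup>2) \<le> 200000 * of_int M * real k ^ 3"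
proof -
  define Q p where "Q = pade_den k" and "p = pade_num k"
  define f where "f N = (\<Sum>n=1..N. logsin (of_int n * exp 1))" for N
  define h where "h N = (logsin_sum Q p (N mod Q) - ln (of_int Q) / 2)\<^sup>2" for N
  have Q: "Q > 0" using pade_den_pos[of k] by (simp add: Q_def)
  have M0: "M > 0" using M Q by (simp add: Q_def)
  have sq: "(real k * sqrt (real k))\<^sup>2 = real k ^ 3"
    by (simp add: power_mult_distrib power2_eq_square power3_eq_cube)
  \<comment> \<open>split into the fluctuation at \<open>p / Q\<close>, the mean \<open>ln Q / 2\<close> and the transfer error\<close>
  have pt: "(f N)\<^sup>2 \<le> 4 * h N + 160000 * real k ^ 3" if N: "N \<in> {1..M}" for N
  proof -
    define a where "a = logsin_sum Q p (N mod Q) - ln (of_int Q) / 2"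
    define b :: real where "b = ln (of_int Q) / 2"
    define c where "c = f N - logsin_sum Q p (N mod Q)"
    have "\<bar>c\<bar> \<le> 280 * (real k * sqrt (real k))"
      unfolding c_def f_def Q_def p_def using N M by (intro pade_transfer[OF k]) auto
    hence "\<bar>c\<bar>\<^sup>2 \<le> (280 * (real k * sqrt (real k)))\<^sup>2" by (intro power_mono) auto
    hence c: "c\<^sup>2 \<le> 78400 * real k ^ 3" by (simp add: sq power_mult_distrib[of 280])
    have "0 \<le> b" using Q by (simp add: b_def)
    moreover have "b \<le> 2 * (real k * sqrt (real k))"
      using ln_pade_den_le[of k] k by (simp add: b_def Q_def)
    ultimately have "b\<^sup>2 \<le> (2 * (real k * sqrt (real k)))\<^sup>2" by (intro power_mono)
    hence b: "b\<^sup>2 \<le> 4 * real k ^ 3" by (simp add: sq power_mult_distrib[of 2])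
    have sq2: "(x + y)\<^sup>2 \<le> 2 * x\<^sup>2 + 2 * y\<^sup>2" for x y :: real
      using zero_le_power2[of "x - y"] by (simp add: power2_eq_square algebra_simps)
    have "f N = (a + b) + c" by (simp add: a_def b_def c_def)
    hence "(f N)\<^sup>2 \<le> 2 * (a + b)\<^sup>2 + 2 * c\<^sup>2" using sq2 by metis
    also have "\<dots> \<le> 2 * (2 * a\<^sup>2 + 2 * b\<^sup>2) + 2 * c\<^sup>2" using sq2[of a b] by simp
    also have "\<dots> = 4 * a\<^sup>2 + (4 * b\<^sup>2 + 2 * c\<^sup>2)" by simp
    also have "4 * b\<^sup>2 + 2 * c\<^sup>2 \<le> 160000 * real k ^ 3"
    proof -
      have "0 \<le> real k ^ 3" by simp
      thus ?thesis using b c by linarith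
    qed
    finally show ?thesis by (simp add: h_def a_def)
  qed
  have "(\<Sum>N=1..M. h N) \<le> 2 * of_int M * (832 * real k ^ 3)"
  proof -
    define m where "m = nat (M div Q) + 1"
    have m: "int m = M div Q + 1" using M0 Q by (simp add: m_def pos_imp_zdiv_nonneg_iff)
    have Meq: "M = M div Q * Q + M mod Q" by simp
    have "int m * Q = M div Q * Q + Q" unfolding m by (simp add: algebra_simps)
    hence "M < int m * Q" using Meq pos_mod_bound[OF Q, of M] by linarith
    hence "(\<Sum>N=1..M. h N) \<le> (\<Sum>N=0..<int m * Q. h N)"
      by (intro sum_mono2) (auto simp: h_def)
    also have "\<dots> = real m * (\<Sum>N=0..<Q. h N)" by (rule sum_periods[OF Q]) (simp add: h_def)
    also have "(\<Sum>N=0..<Q. h N) = (\<Sum>N=0..<Q. (logsin_sum Q p N - ln (of_int Q) / 2)\<^sup>2)"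
      by (intro sum.cong) (auto simp: h_def)
    also have "\<dots> \<le> 832 * of_int Q * real k ^ 3"
      unfolding Q_def p_def using k by (intro pade_variance) simp
    also have "real m * (832 * of_int Q * real k ^ 3) = (real m * of_int Q) * (832 * real k ^ 3)" by simp
    also have "\<dots> \<le> (2 * of_int M) * (832 * real k ^ 3)"
    proof (intro mult_right_mono)
      have "int m * Q \<le> 2 * M" using \<open>int m * Q = M div Q * Q + Q\<close> Meq pos_mod_sign[OF Q, of M] M
        unfolding Q_def by linarith
      hence "real_of_int (int m * Q) \<le> real_of_int (2 * M)" by linarith
      thus "real m * of_int Q \<le> 2 * of_int M" by simp
    qed simp
    finally show ?thesis by (simp add: mult_left_mono)
  qed
  moreover have "(\<Sum>N=1..M. (f N)\<^sup>2) \<le> (\<Sum>N=1..M. 4 * h N + 160000 * real k ^ 3)"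
    by (rule sum_mono) (rule pt)
  moreover have "(\<Sum>N=1..M. 4 * h N + 160000 * real k ^ 3) = 4 * (\<Sum>N=1..M. h N) + of_int M * (160000 * real k ^ 3)"
    using M0 by (simp add: sum.distrib sum_distrib_left)
  ultimately have "(\<Sum>N=1..M. (f N)\<^sup>2) \<le> 4 * (2 * of_int M * (832 * real k ^ 3)) + of_int M * (160000 * real k ^ 3)"
    by linarith
  also have "\<dots> = 166656 * (of_int M * real k ^ 3)" by simp
  also have "\<dots> \<le> 200000 * (of_int M * real k ^ 3)" using M0 by (intro mult_right_mono) auto
  finally show ?thesis by (simp add: f_def)
qed

text \<open>Hence every \<open>n\<close> lies below some denominator, where
  \<open>nint_dist_pade_lower\<close> applies.\<close>

lemma pade_den_ge_index: "int n \<le> pade_den n"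
proof (induction n)
  case (Suc n)
  show ?case
  proof (cases "n = 0")
    case False
    have "6 * pade_den n \<le> pade_den (Suc n)" using False by (intro pade_den_ge_6) simp
    thus ?thesis using Suc pade_den_pos[of n] by linarith
  qed simp
qed simp

lemma sin_multiple_e_nonzero:
  assumes "n > 0" shows "sin (pi * (real n * exp 1)) \<noteq> 0"
proof -
  define j where "j = Suc n"
  have "1 / (2 * real_of_int (pade_den j)) \<le> nint_dist (of_int (int n) * exp 1)"
    using assms pade_den_ge_index[of j] by (intro nint_dist_pade_lower pade_close_exp) (auto simp: j_def simp del: pade_den.simps)
  moreover have "0 < 1 / (2 * real_of_int (pade_den j))" using pade_den_pos[of j] by simp
  ultimately have "0 < nint_dist (real n * exp 1)" unfolding of_int_of_nat_eq by linarith
  thus ?thesis using nint_dist_le_sin[of "real n * exp 1"] by auto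
qed

lemma sudler_e_pos: "0 < sudler_product N (exp 1)"
  unfolding sudler_product_def using sin_multiple_e_nonzero
  by (intro prod_pos) (auto simp: mult.assoc)

lemma ln_sudler_e: "ln (sudler_product N (exp 1)) = (\<Sum>n=1..int N. logsin (of_int n * exp 1))"
proof -
  have "ln (sudler_product N (exp 1)) = (\<Sum>n=1..N. ln \<bar>2 * sin (pi * real n * exp 1)\<bar>)"
    unfolding sudler_product_def
  proof (rule ln_prod)
    fix n assume "n \<in> {1..N}"
    thus "\<bar>2 * sin (pi * real n * exp 1)\<bar> \<noteq> 0" using sin_multiple_e_nonzero[of n] by (simp add: mult.assoc)
  qed simp
  also have "\<dots> = (\<Sum>n=1..N. logsin (of_int (int n) * exp 1))" by (simp add: logsin_def mult.assoc)
  also have "\<dots> = (\<Sum>n\<in>int ` {1..N}. logsin (of_int n * exp 1))" by (subst sum.reindex) auto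
  also have "int ` {1..N} = {1..int N}" by (simp add: image_int_atLeastAtMost)
  finally show ?thesis .
qed

lemma sudler_second_moment:
  "\<exists>C>0. \<forall>k\<ge>1. \<forall>M. pade_den k \<le> int M \<longrightarrow> int M < pade_den (Suc k) \<longrightarrow>
     (\<Sum>N=1..M. (ln (sudler_product N (exp 1)))\<^sup>2) \<le> C * real M * real k ^ 3"
proof -
  define g where "g N = (ln (sudler_product N (exp 1)))\<^sup>2" for N
  \<comment> \<open>the sum takes care of the levels \<open>k < 3\<close>, where \<open>M < 71 = q\<^sub>3\<close>\<close>
  define C where "C = 200000 + (\<Sum>N=1..71. g N)"
  have g0: "0 \<le> g N" for N by (simp add: g_def)
  have S0: "0 \<le> (\<Sum>N=1..71. g N)" using g0 by (intro sum_nonneg) auto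
  have "(\<Sum>N=1..M. g N) \<le> C * real M * real k ^ 3"
    if k: "k \<ge> 1" and M: "pade_den k \<le> int M" "int M < pade_den (Suc k)" for k M
  proof (cases "k \<ge> 3")
    case True
    have "(\<Sum>N=1..M. g N) = (\<Sum>N\<in>int ` {1..M}. (\<Sum>n=1..N. logsin (of_int n * exp 1))\<^sup>2)"
      by (subst sum.reindex) (auto simp: g_def ln_sudler_e)
    also have "int ` {1..M} = {1..int M}" by (simp add: image_int_atLeastAtMost)
    also have "(\<Sum>N=1..int M. (\<Sum>n=1..N. logsin (of_int n * exp 1))\<^sup>2) \<le> 200000 * of_int (int M) * real k ^ 3"
      by (rule logsin_second_moment[OF True M])
    also have "\<dots> = 200000 * (real M * real k ^ 3)" by simp
    also have "\<dots> \<le> C * (real M * real k ^ 3)" using S0 by (intro mult_right_mono) (auto simp: C_def)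
    finally show ?thesis by simp
  next
    case False
    have "pade_den (Suc k) \<le> pade_den 3" using False by (intro pade_den_mono) simp
    also have "pade_den 3 = 71" by (simp add: numeral_eq_Suc)
    finally have "M \<le> 71" using M by linarith
    hence "(\<Sum>N=1..M. g N) \<le> (\<Sum>N=1..71. g N)" using g0 by (intro sum_mono2) auto
    also have "\<dots> \<le> C * 1" by (simp add: C_def)
    also have "\<dots> \<le> C * (real M * real k ^ 3)"
    proof (rule mult_left_mono)
      have "1 \<le> real M" using M pade_den_pos[of k] by linarith
      moreover have "1 \<le> real k ^ 3" using k by simp
      ultimately have "1 * 1 \<le> real M * real k ^ 3" by (intro mult_mono) auto
      thus "1 \<le> real M * real k ^ 3" by simp
    qed (use S0 in \<open>simp add: C_def\<close>)
    finally show ?thesis by simp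
  qed
  moreover have "C > 0" using S0 by (simp add: C_def)
  ultimately show ?thesis unfolding g_def by blast
qed

section \<open>Exceptional indices\<close>

text \<open>The index \<open>k\<close> with \<open>q\<^sub>k \<le> N <
  q\<^sub>k\<^sub>+\<^sub>1\<close>. The least choice makes the level of 1 equal to 1,
  although \<open>q\<^sub>0 = q\<^sub>1 = 1\<close>.\<close>

definition pade_level :: "nat \<Rightarrow> nat" where
  "pade_level N = (LEAST k. int N < pade_den (Suc k))"

lemma pade_level:
  assumes "N \<ge> 1"
  shows "1 \<le> pade_level N" "pade_den (pade_level N) \<le> int N" "int N < pade_den (Suc (pade_level N))"
proof -
  have "int N < pade_den (Suc N)" using pade_den_ge_index[of "Suc N"] by linarith
  thus 3: "int N < pade_den (Suc (pade_level N))" unfolding pade_level_def by (rule LeastI)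
  show 1: "1 \<le> pade_level N"
  proof (rule ccontr)
    assume "\<not> 1 \<le> pade_level N"
    hence "pade_level N = 0" by simp
    thus False using 3 assms by simp
  qed
  have "\<not> int N < pade_den (Suc (pade_level N - 1))"
    unfolding pade_level_def by (rule not_less_Least) (use 1 in \<open>simp add: pade_level_def\<close>)
  thus "pade_den (pade_level N) \<le> int N" using 1 by simp
qed

lemma pade_level_eq:
  assumes "pade_den k \<le> int N" "int N < pade_den (Suc k)"
  shows "pade_level N = k"
  unfolding pade_level_def
proof (rule Least_equality)
  fix j assume "int N < pade_den (Suc j)"
  show "k \<le> j"
  proof (rule ccontr)
    assume "\<not> k \<le> j"
    hence "pade_den (Suc j) \<le> pade_den k" by (intro pade_den_mono) simp
    thus False using \<open>int N < pade_den (Suc j)\<close> assms by linarith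
  qed
qed (rule assms)

definition sudler_exceptional :: "real \<Rightarrow> nat \<Rightarrow> nat set" where
  "sudler_exceptional s M = {N \<in> {1..M}. s * (real (pade_level N) * sqrt (real (pade_level N))) < \<bar>ln (sudler_product N (exp 1))\<bar>}"

text \<open>Chebyshev's inequality on the top level \<open>q\<^sub>k \<le> N \<le>
  M\<close>, where the threshold is constant, and induction over the lower levels.\<close>

lemma card_sudler_exceptional:
  "\<exists>C>0. \<forall>s>0. \<forall>M. real (card (sudler_exceptional s M)) \<le> C * real M / s\<^sup>2"
proof -
  obtain C where C: "C > 0" and mom: "\<And>k M. k \<ge> 1 \<Longrightarrow> pade_den k \<le> int M \<Longrightarrow> int M < pade_den (Suc k) \<Longrightarrow>
     (\<Sum>N=1..M. (ln (sudler_product N (exp 1)))\<^sup>2) \<le> C * real M * real k ^ 3"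
    using sudler_second_moment by blast
  have fin: "finite (sudler_exceptional s M)" for s M by (simp add: sudler_exceptional_def)
  have top: "real (card (sudler_exceptional s M \<inter> {nat (pade_den k)..M})) \<le> C * real M / s\<^sup>2"
    if s: "s > 0" and k: "k \<ge> 1" and M: "pade_den k \<le> int M" "int M < pade_den (Suc k)" for s M k
  proof -
    let ?B = "sudler_exceptional s M \<inter> {nat (pade_den k)..M}"
    have k0: "real k ^ 3 > 0" using k by simp
    have "real (card ?B) * (s\<^sup>2 * real k ^ 3) = (\<Sum>N\<in>?B. s\<^sup>2 * real k ^ 3)" by simp
    also have "\<dots> \<le> (\<Sum>N\<in>?B. (ln (sudler_product N (exp 1)))\<^sup>2)"
    proof (rule sum_mono)
      fix N assume N: "N \<in> ?B"
      hence "pade_den k \<le> int N" "int N < pade_den (Suc k)" using M by auto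
      hence lev: "pade_level N = k" by (rule pade_level_eq)
      have "s * (real k * sqrt (real k)) \<le> \<bar>ln (sudler_product N (exp 1))\<bar>"
        using N unfolding sudler_exceptional_def lev[symmetric] by auto
      hence "(s * (real k * sqrt (real k)))\<^sup>2 \<le> \<bar>ln (sudler_product N (exp 1))\<bar>\<^sup>2"
        using s by (intro power_mono) auto
      thus "s\<^sup>2 * real k ^ 3 \<le> (ln (sudler_product N (exp 1)))\<^sup>2"
        by (simp add: power_mult_distrib power2_eq_square[of "real k"] power3_eq_cube mult.assoc)
    qed
    also have "\<dots> \<le> (\<Sum>N=1..M. (ln (sudler_product N (exp 1)))\<^sup>2)"
      by (rule sum_mono2) (auto simp: sudler_exceptional_def)
    also have "\<dots> \<le> C * real M * real k ^ 3" by (rule mom[OF k M])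
    finally have "(real (card ?B) * s\<^sup>2) * real k ^ 3 \<le> (C * real M) * real k ^ 3" by (simp only: mult.assoc)
    hence "real (card ?B) * s\<^sup>2 \<le> C * real M" using k0 by simp
    thus ?thesis using s by (simp add: pos_le_divide_eq)
  qed
  have split: "sudler_exceptional s M \<subseteq> sudler_exceptional s (nat (pade_den k) - 1) \<union> (sudler_exceptional s M \<inter> {nat (pade_den k)..M})" for s M k
    by (auto simp: sudler_exceptional_def)
  have split_card: "real (card (sudler_exceptional s M)) \<le> real (card (sudler_exceptional s (nat (pade_den k) - 1)))
     + real (card (sudler_exceptional s M \<inter> {nat (pade_den k)..M}))" for s M k
  proof -
    have "card (sudler_exceptional s M) \<le> card (sudler_exceptional s (nat (pade_den k) - 1) \<union> (sudler_exceptional s M \<inter> {nat (pade_den k)..M}))"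
      using fin by (intro card_mono split) auto
    also have "\<dots> \<le> card (sudler_exceptional s (nat (pade_den k) - 1)) + card (sudler_exceptional s M \<inter> {nat (pade_den k)..M})"
      by (rule card_Un_le)
    finally show ?thesis by simp
  qed
  \<comment> \<open>lower levels contribute a geometric series, since \<open>q\<^sub>k\<^sub>+\<^sub>1 \<ge> 6 q\<^sub>k\<close>\<close>
  have levels: "real (card (sudler_exceptional s (nat (pade_den (Suc j)) - 1))) \<le> 2 * C * of_int (pade_den (Suc j)) / s\<^sup>2"
    if s: "s > 0" for s j
  proof (induction j)
    case 0
    have "sudler_exceptional s (nat (pade_den (Suc 0)) - 1) = {}" by (simp add: sudler_exceptional_def)
    thus ?case using C by simp
  next
    case (Suc j)
    define M where "M = nat (pade_den (Suc (Suc j))) - 1"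
    have six: "6 * pade_den (Suc j) \<le> pade_den (Suc (Suc j))" by (intro pade_den_ge_6) simp
    have p1: "pade_den (Suc j) \<ge> 1" by (rule pade_den_pos)
    have M: "int M = pade_den (Suc (Suc j)) - 1" using six p1 by (simp add: M_def)
    have "real (card (sudler_exceptional s M \<inter> {nat (pade_den (Suc j))..M})) \<le> C * real M / s\<^sup>2"
      using M six p1 by (intro top[OF s]) auto
    hence "real (card (sudler_exceptional s M)) \<le> 2 * C * of_int (pade_den (Suc j)) / s\<^sup>2 + C * real M / s\<^sup>2"
      using split_card[of s M "Suc j"] Suc by linarith
    also have "\<dots> = C * (2 * of_int (pade_den (Suc j)) + real M) / s\<^sup>2"
      by (simp add: add_divide_distrib algebra_simps)
    also have "\<dots> \<le> C * (2 * of_int (pade_den (Suc (Suc j)))) / s\<^sup>2"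
    proof (intro divide_right_mono mult_left_mono)
      have "2 * pade_den (Suc j) + int M \<le> 2 * pade_den (Suc (Suc j))" using six p1 M by linarith
      thus "2 * of_int (pade_den (Suc j)) + real M \<le> 2 * of_int (pade_den (Suc (Suc j)))" by linarith
    qed (use C in auto)
    finally show ?case by (simp add: M_def mult_ac)
  qed
  have "real (card (sudler_exceptional s M)) \<le> 3 * C * real M / s\<^sup>2" if s: "s > 0" for s M
  proof (cases "M = 0")
    case True
    thus ?thesis by (simp add: sudler_exceptional_def)
  next
    case False
    define k where "k = pade_level M"
    have k: "1 \<le> k" "pade_den k \<le> int M" "int M < pade_den (Suc k)"
      unfolding k_def using pade_level[of M] False by auto
    have "real (card (sudler_exceptional s (nat (pade_den k) - 1))) \<le> 2 * C * of_int (pade_den k) / s\<^sup>2"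
      using levels[OF s, of "k - 1"] k by simp
    also have "\<dots> \<le> 2 * C * real M / s\<^sup>2"
      using k C by (intro divide_right_mono mult_left_mono) auto
    finally have "real (card (sudler_exceptional s M)) \<le> 2 * C * real M / s\<^sup>2 + C * real M / s\<^sup>2"
      using split_card[of s M k] top[OF s k] by linarith
    also have "\<dots> = 3 * C * real M / s\<^sup>2" by (simp add: add_divide_distrib[symmetric])
    finally show ?thesis .
  qed
  thus ?thesis using C by (intro exI[of _ "3 * C"]) auto
qed

text \<open>The denominators grow at least like \<open>k\<^bsup>k-1\<^esup>\<close>: the
  factor \<open>4 m + 6\<close> of the recurrence beats the growth of \<open>(m +
  1)\<^sup>m\<close>, which gains at most a factor \<open>e (m + 2) \<le> 3 (m + 2)\<close>
  in each step.\<close>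

lemma pade_den_lower: "(real m + 1) ^ m \<le> of_int (pade_den (Suc m))"
proof (induction m)
  case (Suc m)
  define x where "x = real m + 1"
  have x: "x \<ge> 1" by (simp add: x_def)
  have "(x + 1) ^ m = x ^ m * (1 + 1 / x) ^ m"
    using x by (simp add: power_mult_distrib[symmetric] distrib_left)
  also have "\<dots> \<le> x ^ m * 3"
  proof (rule mult_left_mono)
    have "(1 + 1 / x) ^ m \<le> exp (1 / x) ^ m" using x by (intro power_mono exp_ge_add_one_self) auto
    also have "\<dots> = exp (real m * (1 / x))" by (rule exp_of_nat_mult[symmetric])
    also have "\<dots> \<le> exp 1" unfolding exp_le_cancel_iff by (simp add: x_def)
    also have "\<dots> \<le> 3" by (rule exp_le)
    finally show "(1 + 1 / x) ^ m \<le> 3" .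
  qed (use x in auto)
  finally have "(x + 1) ^ Suc m \<le> (x + 1) * (x ^ m * 3)"
    using x by (simp add: mult_left_mono)
  also have "\<dots> = (3 * (x + 1)) * x ^ m" by simp
  also have "\<dots> \<le> (4 * real (Suc m) + 2) * of_int (pade_den (Suc m))"
    using Suc x by (intro mult_mono) (auto simp: x_def)
  also have "\<dots> = of_int ((4 * int (Suc m) + 2) * pade_den (Suc m))" by simp
  also have "\<dots> \<le> of_int (pade_den (Suc (Suc m)))"
    unfolding of_int_le_iff by (rule pade_den_ge) simp
  finally show ?case by (simp only: x_def) (simp add: add.commute)
qed simp

text \<open>Taking logarithms, \<open>(k - 1) ln k \<le> ln y\<close>; this is inverted
  without appeal to monotonicity of \<open>x / ln x\<close>. The assumption \<open>3 \<le>
  y\<close> guarantees \<open>ln y > 1\<close>.\<close>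

lemma pade_index_bound:
  fixes y :: real
  assumes k: "k \<ge> 1" and y: "of_int (pade_den k) \<le> y" "3 \<le> y"
  shows "0 < ln (ln y)" and "real k \<le> 4 * (ln y / ln (ln y))"
proof -
  define x where "x = ln y"
  have "exp 1 < (3::real)" using pade_error_pos[of 1] by simp
  hence "exp 1 < y" using y by linarith
  hence "ln (exp 1) < ln y" using y by (subst ln_less_cancel_iff) auto
  hence "1 < x" by (simp add: x_def)
  hence x: "1 < x" "0 < ln x" by simp_all
  thus "0 < ln (ln y)" by (simp add: x_def)
  have "real k * ln x \<le> 4 * x"
    \<comment> \<open>either \<open>k\<close> is at most the square root of \<open>ln y\<close>, or \<open>ln (ln y)\<close> is at most \<open>2 ln k\<close>\<close>
  proof (cases "(real k)\<^sup>2 \<le> x")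
    case True
    hence "real k \<le> sqrt x" by (rule real_le_rsqrt)
    hence "real k * ln x \<le> sqrt x * (2 * sqrt x)"
      using x by (intro mult_mono ln_le_2_sqrt) auto
    also have "\<dots> = 2 * x" using x by simp
    finally show ?thesis using x by linarith
  next
    case False
    have k2: "k \<ge> 2"
    proof (rule ccontr)
      assume "\<not> k \<ge> 2"
      hence "k = 1" using k by simp
      thus False using False x by simp
    qed
    have "ln x \<le> ln ((real k)\<^sup>2)" using False x by (intro ln_mono) auto
    also have "\<dots> = 2 * ln (real k)" using k by (simp add: ln_realpow)
    finally have 1: "ln x \<le> 2 * ln (real k)" .
    have "real k ^ (k - 1) \<le> of_int (pade_den k)" using pade_den_lower[of "k - 1"] k by simp
    hence "ln (real k ^ (k - 1)) \<le> ln y" using y k by (intro ln_mono) auto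
    hence "real (k - 1) * ln (real k) \<le> x" using k by (simp add: ln_realpow x_def)
    moreover have "real k / 2 * ln (real k) \<le> real (k - 1) * ln (real k)"
      using k2 by (intro mult_right_mono) auto
    ultimately have 2: "real k * ln (real k) \<le> 2 * x" by simp
    have "real k * ln x \<le> real k * (2 * ln (real k))" using 1 by (intro mult_left_mono) auto
    thus ?thesis using 2 by simp
  qed
  thus "real k \<le> 4 * (ln y / ln (ln y))" using x by (simp add: x_def pos_le_divide_eq)
qed

text \<open>The parameter \<open>y\<close> is \<open>3 N\<close> in the quantitative
  statement and \<open>N\<close> in the statement on densities. The factor 8 is
  \<open>4\<^bsup>3/2\<^esup>\<close>.\<close>

lemma not_exceptional_bounds:
  fixes y t :: real
  assumes N: "1 \<le> N" "N \<le> M" and y: "real N \<le> y" "3 \<le> y" and t: "0 < s" "8 * s \<le> t"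
    and good: "N \<notin> sudler_exceptional s M"
  shows "exp (- t * (ln y / ln (ln y)) powr (3/2)) \<le> sudler_product N (exp 1)"
    and "sudler_product N (exp 1) \<le> exp (t * (ln y / ln (ln y)) powr (3/2))"
proof -
  define k where "k = pade_level N"
  define z where "z = ln y / ln (ln y)"
  have k: "1 \<le> k" "pade_den k \<le> int N" unfolding k_def using pade_level[OF N(1)] by auto
  have "of_int (pade_den k) \<le> y" using k y by linarith
  note bound = pade_index_bound[OF k(1) this y(2)]
  have kz: "real k \<le> 4 * z" unfolding z_def by (rule bound(2))
  hence z0: "0 < z" using k by simp
  have "real k * sqrt (real k) = real k powr (3/2)"
    using k powr_add[of "real k" 1 "1/2"] by (simp add: powr_half_sqrt)
  also have "\<dots> \<le> (4 * z) powr (3/2)" using kz by (intro powr_mono2) auto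
  also have "\<dots> = 8 * z powr (3/2)"
  proof -
    have "(4::real) powr (3/2) = 4 powr (1 + 1/2)" by simp
    also have "\<dots> = 8" unfolding powr_add by (simp add: powr_half_sqrt)
    finally show ?thesis using z0 by (simp add: powr_mult)
  qed
  finally have kz: "real k * sqrt (real k) \<le> 8 * z powr (3/2)" .
  have "\<bar>ln (sudler_product N (exp 1))\<bar> \<le> s * (real k * sqrt (real k))"
    using good N by (auto simp: sudler_exceptional_def k_def)
  also have "\<dots> \<le> s * (8 * z powr (3/2))" using kz t by (intro mult_left_mono) auto
  also have "\<dots> = (8 * s) * z powr (3/2)" by simp
  also have "\<dots> \<le> t * z powr (3/2)" using t by (intro mult_right_mono) auto
  finally have main: "\<bar>ln (sudler_product N (exp 1))\<bar> \<le> t * z powr (3/2)" .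
  have P: "exp (ln (sudler_product N (exp 1))) = sudler_product N (exp 1)"
    using sudler_e_pos by simp
  have "exp (- t * z powr (3/2)) \<le> exp (ln (sudler_product N (exp 1)))"
    using main by (subst exp_le_cancel_iff) linarith
  thus "exp (- t * (ln y / ln (ln y)) powr (3/2)) \<le> sudler_product N (exp 1)" unfolding P z_def .
  have "exp (ln (sudler_product N (exp 1))) \<le> exp (t * z powr (3/2))"
    using main by (subst exp_le_cancel_iff) linarith
  thus "sudler_product N (exp 1) \<le> exp (t * (ln y / ln (ln y)) powr (3/2))" unfolding P z_def .
qed

theorem theorem7:
  shows "(\<exists>C::real. C > 0 \<and> (\<forall>(M::nat) (t::real). M \<ge> 1 \<longrightarrow> t > 0 \<longrightarrow>
      \<bar>1 / real M * real (card {N::nat. 1 \<le> N \<and> N \<le> M \<and>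
          exp (- t * (ln (3 * real N) / ln (ln (3 * real N))) powr (3/2))
            \<le> sudler_product N (exp 1) \<and>
          sudler_product N (exp 1)
            \<le> exp (t * (ln (3 * real N) / ln (ln (3 * real N))) powr (3/2))}) - 1\<bar>
        \<le> C / t\<^sup>2))
    \<and> (\<forall>t :: nat \<Rightarrow> real. filterlim t at_top sequentially \<longrightarrow>
        has_asymptotic_density {N::nat. N \<ge> 3 \<and>
          exp (- t N * (ln (real N) / ln (ln (real N))) powr (3/2))
            \<le> sudler_product N (exp 1) \<and>
          sudler_product N (exp 1)
            \<le> exp (t N * (ln (real N) / ln (ln (real N))) powr (3/2))} 1)"
proof -
  obtain C where C: "C > 0" and exc: "\<And>s M. s > 0 \<Longrightarrow> real (card (sudler_exceptional s M)) \<le> C * real M / s\<^sup>2"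
    using card_sudler_exceptional by blast
  have fin: "finite (sudler_exceptional s M)" for s M by (simp add: sudler_exceptional_def)
  have count: "real M \<le> real (card A) + real (card B)" if "{1..M} \<subseteq> A \<union> B" "finite A" "finite B" for A B :: "nat set" and M
  proof -
    have "card {1..M} \<le> card (A \<union> B)" using that by (intro card_mono) auto
    also have "\<dots> \<le> card A + card B" by (rule card_Un_le)
    finally show ?thesis by simp
  qed
  have part1: "\<bar>1 / real M * real (card {N::nat. 1 \<le> N \<and> N \<le> M \<and>
          exp (- t * (ln (3 * real N) / ln (ln (3 * real N))) powr (3/2)) \<le> sudler_product N (exp 1) \<and>
          sudler_product N (exp 1) \<le> exp (t * (ln (3 * real N) / ln (ln (3 * real N))) powr (3/2))}) - 1\<bar>
        \<le> (64 * C) / t\<^sup>2" (is "\<bar>1 / real M * real (card ?A) - 1\<bar> \<le> _")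
    if M: "M \<ge> 1" and t: "t > 0" for M :: nat and t :: real
  proof -
    let ?B = "sudler_exceptional (t / 8) M"
    have sub: "{1..M} \<subseteq> ?A \<union> ?B"
    proof
      fix N assume N: "N \<in> {1..M}"
      show "N \<in> ?A \<union> ?B"
      proof (cases "N \<in> ?B")
        case False
        thus ?thesis using not_exceptional_bounds[of N M "3 * real N" "t / 8" t] N t by auto
      qed simp
    qed
    have finA: "finite ?A" by (rule finite_subset[of _ "{1..M}"]) auto
    have "?A \<subseteq> {1..M}" by auto
    hence "card ?A \<le> card {1..M}" by (intro card_mono) auto
    hence up: "real (card ?A) \<le> real M" by simp
    have "real M \<le> real (card ?A) + C * real M / (t / 8)\<^sup>2"
      using count[OF sub finA fin] exc[of "t / 8" M] t by simp
    hence "1 - real (card ?A) / real M \<le> 64 * C / t\<^sup>2"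
      using M t by (simp add: power_divide field_simps)
    moreover have "real (card ?A) / real M \<le> 1" using up M by simp
    ultimately show ?thesis by simp
  qed
  have part2: "has_asymptotic_density {N::nat. N \<ge> 3 \<and>
          exp (- t N * (ln (real N) / ln (ln (real N))) powr (3/2)) \<le> sudler_product N (exp 1) \<and>
          sudler_product N (exp 1) \<le> exp (t N * (ln (real N) / ln (ln (real N))) powr (3/2))} 1"
    (is "has_asymptotic_density ?A 1")
    if t: "filterlim t at_top sequentially" for t :: "nat \<Rightarrow> real"
    unfolding has_asymptotic_density_def
  proof (rule LIMSEQ_I)
    fix e :: real assume e: "0 < e"
    \<comment> \<open>this threshold makes the exceptional set of upper density at most \<open>e / 4\<close>\<close>
    define s where "s = sqrt (4 * C / e)"
    have s: "s > 0" "C / s\<^sup>2 = e / 4" using C e by (simp_all add: s_def)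
    obtain n0 where n0: "\<And>N. N \<ge> n0 \<Longrightarrow> 8 * s \<le> t N"
      using t unfolding filterlim_at_top eventually_sequentially by blast
    define n1 where "n1 = max 3 n0"
    define m0 where "m0 = Suc (nat \<lceil>4 * real n1 / e\<rceil>)"
    show "\<exists>no. \<forall>M\<ge>no. norm (real (card (?A \<inter> {1..M})) / real M - 1) < e"
    proof (intro exI allI impI)
      fix M assume M: "M \<ge> m0"
      have M0: "real M > 0" using M by (simp add: m0_def)
      let ?B = "{1..n1} \<union> sudler_exceptional s M"
      have sub: "{1..M} \<subseteq> (?A \<inter> {1..M}) \<union> ?B"
      proof
        fix N assume N: "N \<in> {1..M}"
        show "N \<in> (?A \<inter> {1..M}) \<union> ?B"
        proof (cases "N \<in> ?B")
          case False
          hence N1: "3 \<le> N" "n0 \<le> N" "N \<notin> sudler_exceptional s M" using N by (auto simp: n1_def)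
          thus ?thesis using not_exceptional_bounds[of N M "real N" s "t N"] N s n0[of N] by auto
        qed simp
      qed
      have "real (card ?B) \<le> real n1 + C * real M / s\<^sup>2"
      proof -
        have "card ?B \<le> card {1..n1} + card (sudler_exceptional s M)" by (rule card_Un_le)
        hence "real (card ?B) \<le> real n1 + real (card (sudler_exceptional s M))" by simp
        thus ?thesis using exc[OF s(1), of M] by linarith
      qed
      also have "C * real M / s\<^sup>2 = e / 4 * real M" using s(2) by (metis times_divide_eq_left)
      also have "real n1 \<le> e / 4 * real M"
      proof -
        have "4 * real n1 / e \<le> real m0" unfolding m0_def by linarith
        also have "\<dots> \<le> real M" using M by simp
        finally show ?thesis using e by (simp add: field_simps)
      qed
      finally have "real (card ?B) \<le> e / 2 * real M" by simp
      moreover have "real M \<le> real (card (?A \<inter> {1..M})) + real (card ?B)"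
        by (rule count[OF sub]) (auto simp: fin)
      ultimately have "real M - real (card (?A \<inter> {1..M})) \<le> e / 2 * real M" by linarith
      hence "1 - real (card (?A \<inter> {1..M})) / real M \<le> e / 2"
        using M0 by (simp add: field_simps)
      moreover have "real (card (?A \<inter> {1..M})) / real M \<le> 1"
      proof -
        have "card (?A \<inter> {1..M}) \<le> card {1..M}" by (intro card_mono) auto
        thus ?thesis using M0 by simp
      qed
      ultimately show "norm (real (card (?A \<inter> {1..M})) / real M - 1) < e"
        using e unfolding real_norm_def by linarith
    qed
  qed
  show ?thesis
  proof (intro conjI)
    show "\<exists>C::real. C > 0 \<and> (\<forall>(M::nat) (t::real). M \<ge> 1 \<longrightarrow> t > 0 \<longrightarrow>
      \<bar>1 / real M * real (card {N::nat. 1 \<le> N \<and> N \<le> M \<and>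
          exp (- t * (ln (3 * real N) / ln (ln (3 * real N))) powr (3/2))
            \<le> sudler_product N (exp 1) \<and>
          sudler_product N (exp 1)
            \<le> exp (t * (ln (3 * real N) / ln (ln (3 * real N))) powr (3/2))}) - 1\<bar>
        \<le> C / t\<^sup>2)"
      using part1 C by (intro exI[of _ "64 * C"]) auto
  qed (use part2 in blast)
qed

end
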